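(* The set $\{S^*_{\lambda_1}\cdots S^*_{\lambda_l}.1\mid \lambda=(\lambda_1,\dots,\lambda_l)\vdash n,\ n\in\mathbb Z_+\}$ forms an orthonormal basis of $V$, and for every partition $\lambda$ $$S^*_{\lambda_1}S^*_{\lambda_2}\cdots S^*_{\lambda_l}.1=(-1)^{|\lambda|}s_{\lambda'}=(-1)^{|\lambda|}\det(s_{\lambda'_i-i+j}),$$ where $|\lambda|=\lambda_1+\cdots+\lambda_l$. Moreover, for partitions $\mu$ and $\nu$, $$S_{-\mu_1}\cdots S_{-\mu_l}S^*_{\nu_1}\cdots S^*_{\nu_k}.1=(-1)^{|\nu|}\,\mathrm{sgn}(\mu,\nu')\,s_{\pi(\mu,\nu')}\qquad (\mu=(\mu_1,\dots,\mu_l),\ \nu=(\nu_1,\dots,\nu_k)),$$ $$S^*_{\mu_1}\cdots S^*_{\mu_k}S_{-\nu_1}\cdots S_{-\nu_l}.1=(-1)^{|\mu|}\,\mathrm{sgn}(\mu,\nu')\,s_{\pi(\mu,\nu')'}\qquad (\mu=(\mu_1,\dots,\mu_k),\ \nu=(\nu_1,\dots,\nu_l)),$$ where $(\mu,\nu')$ is the juxtaposition of $\mu$ and $\nu'$; if $(\mu,\nu')$ is degenerate the right-hand sides are $0$.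
   Context: Let $\{b_n\mid n\ne0\}\cup\{c\}$ generate the Heisenberg algebra $[b_m,b_n]=m\delta_{m,-n}c$, $[c,b_m]=0$, acting on the $\mathbb Q$-space $V=\mathrm{Sym}(b_{-n}\text{'s},n\ge1)$ by: $b_{-n}$ acts by multiplication, $b_n$ by $n\,\partial/\partial b_{-n}$ ($n\ge1$), $c$ by $1$. $V$ carries the inner product with $(1,1)=1$ and $b_n^*=b_{-n}$. $V$ is identified with the ring $\Lambda_{\mathbb Q}$ of symmetric functions in infinitely many variables by $b_{-n}\mapsto p_n$ (power sums); this is isometric for the standard inner product in which Schur functions are orthonormal. $s_\lambda$ denotes the Schur function of a partition $\lambda$, and $s_n$ ($n\in\mathbb Z$) the $n$-th complete homogeneous symmetric function ($s_n=0$ for $n<0$). Vertex operators: $$S(z)=\exp\Bigl(\sum_{n\ge1}\tfrac{b_{-n}}{n}z^n\Bigr)\exp\Bigl(-\sum_{n\ge1}\tfrac{b_n}{n}z^{-n}\Bigr)=\sum_{n\in\mathbb Z}S_nz^{-n},$$ $$S^*(z)=\exp\Bigl(-\sum_{n\ge1}\tfrac{b_{-n}}{n}z^n\Bigr)\exp\Bigl(\sum_{n\ge1}\tfrac{b_n}{n}z^{-n}\Bigr)=\sum_{n\in\mathbb Z}S_n^*z^{n}.$$ $\lambda'$ is the conjugate partition. For an $N$-tuple $\kappa\in\mathbb Z^N$ put $\delta=(N-1,\dots,1,0)$. $\kappa$ is degenerate if $\kappa+\delta$ has two equal entries, and then $\mathrm{sgn}(\kappa)=0$. Otherwise there is a unique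 $\sigma\in\mathfrak S_N$ such that $\pi(\kappa):=\sigma(\kappa+\delta)-\delta$ is weakly decreasing, and $\mathrm{sgn}(\kappa)=(-1)^{l(\sigma)}$ with $l(\sigma)$ the length of $\sigma$; if $\kappa$ has nonnegative entries then $\pi(\kappa)$ is a partition. *)

theory Defs
  imports
    "HOL-Library.Poly_Mapping"
    "HOL-Library.FuncSet"
    "HOL-Combinatorics.Permutations"
    "Jordan_Normal_Form.Determinant"
begin

section \<open>The Fock space and the Heisenberg algebra\<close>

text \<open>
  \<open>V = Sym(b\<^sub>-\<^sub>n, n \<ge> 1)\<close> over the rationals, as the polynomial ring with variables indexed by
  \<open>nat\<close>: the variable with index \<open>i\<close> is \<open>b\<^bsub>-(i+1)\<^esub>\<close>.  Elements of \<open>nat \<Rightarrow>\<^sub>0 nat\<close> are exponents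
  of monomials, and \<open>1\<close> is the vacuum vector.
\<close>

type_synonym fock = "(nat \<Rightarrow>\<^sub>0 nat) \<Rightarrow>\<^sub>0 rat"

definition fscale :: "rat \<Rightarrow> fock \<Rightarrow> fock" where
  "fscale c v = Poly_Mapping.single 0 c * v"

definition fvar :: "nat \<Rightarrow> fock" where
  "fvar i = Poly_Mapping.single (Poly_Mapping.single i 1) 1"

definition fderiv :: "nat \<Rightarrow> fock \<Rightarrow> fock" where
  "fderiv i v = (\<Sum>m\<in>Poly_Mapping.keys v.
     Poly_Mapping.single (m - Poly_Mapping.single i 1)
       (of_nat (Poly_Mapping.lookup m i) * Poly_Mapping.lookup v m))"

text \<open>
  \<open>heis n\<close> is the action of \<open>b\<^sub>n\<close> for \<open>n \<noteq> 0\<close>; the value at \<open>n = 0\<close> (which is \<open>0\<close>) is irrelevant.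
  The central element \<open>c\<close> acts as the identity, see \<open>heis_commutator\<close>.
\<close>

definition heis :: "int \<Rightarrow> fock \<Rightarrow> fock" where
  "heis n v = (if n < 0 then fvar (nat (- n) - 1) * v
               else fscale (of_int n) (fderiv (nat n - 1) v))"

interpretation fock: vector_space fscale
  by unfold_locales
    (simp_all add: fscale_def algebra_simps single_add mult_single flip: mult.assoc)

subsection \<open>The Heisenberg relations\<close>

lemma lookup_fscale: "Poly_Mapping.lookup (fscale a v) m = a * Poly_Mapping.lookup v m"
proof -
  have "Poly_Mapping.lookup (fscale a v) m
      = (\<Sum>k. (a when 0 = k) * (\<Sum>q. Poly_Mapping.lookup v q when m = k + q))"
    by (simp add: fscale_def lookup_mult lookup_single)
  also have "\<dots> = a * Poly_Mapping.lookup v m"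
    by (simp add: when_mult)
  finally show ?thesis .
qed

lemma lookup_fvar_mult:
  "Poly_Mapping.lookup (fvar i * v) m =
     (if Poly_Mapping.lookup m i = 0 then 0
      else Poly_Mapping.lookup v (m - Poly_Mapping.single i 1))"
proof -
  let ?e = "Poly_Mapping.single i 1 :: nat \<Rightarrow>\<^sub>0 nat"
  have "Poly_Mapping.lookup (fvar i * v) m
      = (\<Sum>k. (1 when ?e = k) * (\<Sum>q. Poly_Mapping.lookup v q when m = k + q))"
    by (simp add: fvar_def lookup_mult lookup_single)
  also have "\<dots> = (\<Sum>q. Poly_Mapping.lookup v q when m = ?e + q)"
    by (simp add: when_mult)
  also have "\<dots> = (if Poly_Mapping.lookup m i = 0 then 0 else Poly_Mapping.lookup v (m - ?e))"
  proof (cases "Poly_Mapping.lookup m i = 0")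
    case True
    then have "m \<noteq> ?e + q" for q
      by (auto simp: lookup_add)
    with True show ?thesis by simp
  next
    case False
    then have "m = ?e + q \<longleftrightarrow> m - ?e = q" for q
      by (auto simp: poly_mapping_eq_iff fun_eq_iff lookup_add lookup_minus lookup_single when_def
          split: if_splits)
    with False show ?thesis by simp
  qed
  finally show ?thesis .
qed

lemma lookup_fderiv:
  "Poly_Mapping.lookup (fderiv i v) m = of_nat (Poly_Mapping.lookup m i + 1) *
     Poly_Mapping.lookup v (m + Poly_Mapping.single i 1)"
proof -
  let ?e = "Poly_Mapping.single i 1 :: nat \<Rightarrow>\<^sub>0 nat"
  let ?f = "\<lambda>k. (of_nat (Poly_Mapping.lookup k i) * Poly_Mapping.lookup v k when k - ?e = m)"
  have eq: "?f k = (if k = m + ?e then of_nat (Poly_Mapping.lookup m i + 1) *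
     Poly_Mapping.lookup v (m + ?e) else 0)" for k
  proof (cases "k = m + ?e")
    case True
    then show ?thesis by (simp add: lookup_add)
  next
    case False
    have "Poly_Mapping.lookup k i = 0" if km: "k - ?e = m"
    proof (rule ccontr)
      assume "Poly_Mapping.lookup k i \<noteq> 0"
      then have "k = (k - ?e) + ?e"
        by (intro poly_mapping_eqI) (auto simp: lookup_add lookup_minus lookup_single when_def)
      with km False show False by simp
    qed
    with False show ?thesis by (auto simp: when_def)
  qed
  have "Poly_Mapping.lookup (fderiv i v) m = (\<Sum>k\<in>Poly_Mapping.keys v. ?f k)"
    by (simp add: fderiv_def lookup_sum lookup_single)
  also have "\<dots> = of_nat (Poly_Mapping.lookup m i + 1) * Poly_Mapping.lookup v (m + ?e)"
    unfolding eq by (auto simp: not_in_keys_iff_lookup_eq_zero)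
  finally show ?thesis .
qed

lemma fscale_of_nat: "fscale (of_nat n) v = of_nat n * v"
  by (simp add: fscale_def)

lemma heis_pos: "n > 0 \<Longrightarrow> heis (int n) v = fscale (of_nat n) (fderiv (n - 1) v)"
  and heis_neg: "n > 0 \<Longrightarrow> heis (- int n) v = fvar (n - 1) * v"
  by (simp_all add: heis_def)

lemma fderiv_fscale: "fderiv i (fscale a v) = fscale a (fderiv i v)"
  by (rule poly_mapping_eqI) (simp add: lookup_fderiv lookup_fscale)

lemma fvar_mult_fscale: "fvar i * fscale a v = fscale a (fvar i * v)"
  by (simp add: fscale_def mult.left_commute)

lemma fderiv_commute: "fderiv i (fderiv j v) = fderiv j (fderiv i v)"
  by (rule poly_mapping_eqI) (simp add: lookup_fderiv lookup_add lookup_single when_def ac_simps)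

lemma fderiv_fvar_mult:
  "fderiv i (fvar j * v) = fvar j * fderiv i v + (if i = j then v else 0)"
proof (rule poly_mapping_eqI)
  fix m :: "nat \<Rightarrow>\<^sub>0 nat"
  have *: "m + Poly_Mapping.single i 1 - Poly_Mapping.single j 1
      = m - Poly_Mapping.single j 1 + Poly_Mapping.single i 1"
    if "i \<noteq> j \<or> Poly_Mapping.lookup m j \<noteq> 0"
    using that by (intro poly_mapping_eqI) (auto simp: lookup_add lookup_minus lookup_single when_def)
  show "Poly_Mapping.lookup (fderiv i (fvar j * v)) m
      = Poly_Mapping.lookup (fvar j * fderiv i v + (if i = j then v else 0)) m"
  proof (cases "i = j \<and> Poly_Mapping.lookup m j \<noteq> 0")
    case True
    then have "Poly_Mapping.lookup (m - Poly_Mapping.single j 1) j + 1 = Poly_Mapping.lookup m j"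
      and "m - Poly_Mapping.single j 1 + Poly_Mapping.single j 1 = m"
      by (auto intro!: poly_mapping_eqI simp: lookup_add lookup_minus lookup_single when_def)
    with True show ?thesis
      by (simp only: lookup_fderiv lookup_fvar_mult lookup_add)
        (simp add: algebra_simps)
  next
    case False
    with * show ?thesis
      by (auto simp: lookup_fderiv lookup_fvar_mult lookup_add lookup_minus lookup_single when_def)
  qed
qed

lemma heis_commutator:
  assumes "m \<noteq> 0" "n \<noteq> 0"
  shows "heis m (heis n v) - heis n (heis m v) = (if m = - n then fscale (of_int m) v else 0)"
proof -
  consider (pp) a b where "m = int a" "n = int b" "a > 0" "b > 0"
    | (pn) a b where "m = int a" "n = - int b" "a > 0" "b > 0"
    | (np) a b where "m = - int a" "n = int b" "a > 0" "b > 0"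
    | (nn) a b where "m = - int a" "n = - int b" "a > 0" "b > 0"
    using assms by (metis int_cases3)
  then show ?thesis
  proof cases
    case pp
    then show ?thesis
      by (simp add: heis_pos fderiv_fscale mult.commute) (metis fderiv_commute)
  next
    case pn
    then show ?thesis
      by (auto simp: heis_pos heis_neg fderiv_fvar_mult fvar_mult_fscale fock.scale_right_distrib
          Suc_pred' dest: arg_cong[of _ _ Suc])
  next
    case np
    then show ?thesis
      by (auto simp: heis_pos heis_neg fderiv_fvar_mult fvar_mult_fscale fock.scale_right_distrib
          Suc_pred' dest: arg_cong[of _ _ Suc])
  next
    case nn
    then show ?thesis by (simp add: heis_neg mult.left_commute)
  qed
qed

subsection \<open>The inner product\<close>

definition fock_inner_product :: "(fock \<Rightarrow> fock \<Rightarrow> rat) \<Rightarrow> bool" where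
  "fock_inner_product ip \<longleftrightarrow>
     (\<forall>u v w. ip (u + v) w = ip u w + ip v w) \<and>
     (\<forall>a u v. ip (fscale a u) v = a * ip u v) \<and>
     (\<forall>u v. ip u v = ip v u) \<and>
     (\<forall>u. u \<noteq> 0 \<longrightarrow> ip u u > 0) \<and>
     ip 1 1 = 1 \<and>
     (\<forall>n u v. n \<noteq> 0 \<longrightarrow> ip (heis n u) v = ip u (heis (- n) v))"

text \<open>The hypothesis \<open>fock_inner_product ip\<close> is satisfiable.\<close>

definition zee :: "(nat \<Rightarrow>\<^sub>0 nat) \<Rightarrow> rat" where
  "zee m = (\<Prod>i\<in>Poly_Mapping.keys m.
     of_nat (Suc i) ^ Poly_Mapping.lookup m i * fact (Poly_Mapping.lookup m i))"

lemma zee_pos: "zee m > 0"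
  unfolding zee_def by (intro prod_pos) (auto intro!: mult_pos_pos zero_less_power)

lemma zee_single: "zee (m + Poly_Mapping.single i 1)
    = of_nat (Suc i) * of_nat (Poly_Mapping.lookup m i + 1) * zee m"
proof -
  let ?e = "Poly_Mapping.single i 1 :: nat \<Rightarrow>\<^sub>0 nat"
  let ?A = "insert i (Poly_Mapping.keys m)"
  let ?g = "\<lambda>m k. of_nat (Suc k) ^ Poly_Mapping.lookup m k * fact (Poly_Mapping.lookup m k) :: rat"
  have "zee (m + ?e) = (\<Prod>k\<in>?A. ?g (m + ?e) k)"
    unfolding zee_def by (rule prod.mono_neutral_left)
      (auto simp: in_keys_iff lookup_add lookup_single when_def split: if_splits)
  also have "\<dots> = ?g (m + ?e) i * (\<Prod>k\<in>?A - {i}. ?g (m + ?e) k)"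
    by (rule prod.remove) auto
  also have "(\<Prod>k\<in>?A - {i}. ?g (m + ?e) k) = (\<Prod>k\<in>?A - {i}. ?g m k)"
    by (rule prod.cong) (auto simp: lookup_add lookup_single when_def)
  also have "?g (m + ?e) i * \<dots>
      = of_nat (Suc i) * of_nat (Poly_Mapping.lookup m i + 1) * (?g m i * (\<Prod>k\<in>?A - {i}. ?g m k))"
    by (simp add: lookup_add algebra_simps)
  also have "?g m i * (\<Prod>k\<in>?A - {i}. ?g m k) = (\<Prod>k\<in>?A. ?g m k)"
    by (rule prod.remove[symmetric]) auto
  also have "\<dots> = zee m"
    unfolding zee_def by (rule prod.mono_neutral_right) (auto simp: in_keys_iff)
  finally show ?thesis .
qed

definition zee_form :: "fock \<Rightarrow> fock \<Rightarrow> rat" where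
  "zee_form u v = (\<Sum>m\<in>Poly_Mapping.keys u.
     Poly_Mapping.lookup u m * Poly_Mapping.lookup v m * zee m)"

lemma zee_form_superset:
  assumes "finite A" "Poly_Mapping.keys u \<inter> Poly_Mapping.keys v \<subseteq> A"
  shows "zee_form u v = (\<Sum>m\<in>A. Poly_Mapping.lookup u m * Poly_Mapping.lookup v m * zee m)"
  unfolding zee_form_def using assms
  by (intro sum.mono_neutral_cong) (auto simp: in_keys_iff)

lemma zee_form_commute: "zee_form u v = zee_form v u"
  by (subst zee_form_superset[of "Poly_Mapping.keys v"]) (auto simp: zee_form_def mult.commute)

lemma zee_form_adjoint:
  "zee_form (fscale (of_nat (Suc i)) (fderiv i u)) v = zee_form u (fvar i * v)"
proof -
  let ?e = "Poly_Mapping.single i 1 :: nat \<Rightarrow>\<^sub>0 nat"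
  have "zee_form (fscale (of_nat (Suc i)) (fderiv i u)) v
      = (\<Sum>m\<in>Poly_Mapping.keys v.
          Poly_Mapping.lookup (fscale (of_nat (Suc i)) (fderiv i u)) m * Poly_Mapping.lookup v m * zee m)"
    by (rule zee_form_superset) auto
  also have "\<dots> = (\<Sum>m\<in>Poly_Mapping.keys v.
      Poly_Mapping.lookup u (m + ?e) * Poly_Mapping.lookup (fvar i * v) (m + ?e) * zee (m + ?e))"
    by (intro sum.cong refl)
      (simp only: lookup_fscale lookup_fderiv zee_single lookup_fvar_mult,
       simp add: lookup_add algebra_simps)
  also have "\<dots> = (\<Sum>m\<in>(\<lambda>m. m + ?e) ` Poly_Mapping.keys v.
      Poly_Mapping.lookup u m * Poly_Mapping.lookup (fvar i * v) m * zee m)"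
    by (subst sum.reindex) (auto simp: inj_on_def)
  also have "\<dots> = zee_form u (fvar i * v)"
  proof (rule zee_form_superset[symmetric])
    show "Poly_Mapping.keys u \<inter> Poly_Mapping.keys (fvar i * v) \<subseteq> (\<lambda>m. m + ?e) ` Poly_Mapping.keys v"
    proof
      fix m assume "m \<in> Poly_Mapping.keys u \<inter> Poly_Mapping.keys (fvar i * v)"
      then have "Poly_Mapping.lookup m i \<noteq> 0" and k: "m - ?e \<in> Poly_Mapping.keys v"
        by (auto simp: in_keys_iff lookup_fvar_mult split: if_splits)
      then have "m = (m - ?e) + ?e"
        by (intro poly_mapping_eqI) (auto simp: lookup_add lookup_minus lookup_single when_def)
      with k show "m \<in> (\<lambda>m. m + ?e) ` Poly_Mapping.keys v" by blast
    qed
  qed auto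
  finally show ?thesis .
qed

lemma fock_inner_product_exists: "fock_inner_product zee_form"
  unfolding fock_inner_product_def
proof (intro conjI allI impI)
  fix u v w :: fock and a :: rat and n :: int
  show "zee_form (u + v) w = zee_form u w + zee_form v w"
    using zee_form_superset[of "Poly_Mapping.keys w"]
    by (simp add: lookup_add sum.distrib algebra_simps)
  show "zee_form (fscale a u) v = a * zee_form u v"
    using zee_form_superset[of "Poly_Mapping.keys v"]
    by (simp add: lookup_fscale sum_distrib_left algebra_simps)
  show "zee_form u v = zee_form v u"
    by (rule zee_form_commute)
  show "zee_form 1 1 = 1"
    by (simp add: zee_form_def zee_def)
  show "zee_form u u > 0" if "u \<noteq> 0"
    unfolding zee_form_def
  proof (rule sum_pos)
    show "Poly_Mapping.keys u \<noteq> {}"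
      using that by (simp flip: keys_eq_empty)
    show "Poly_Mapping.lookup u m * Poly_Mapping.lookup u m * zee m > 0"
      if "m \<in> Poly_Mapping.keys u" for m
      using that zee_pos[of m] by (auto simp: in_keys_iff zero_less_mult_iff neq_iff)
  qed simp
  show "zee_form (heis n u) v = zee_form u (heis (- n) v)" if n: "n \<noteq> 0"
  proof (cases "n > 0")
    case True
    then obtain i where "n = int (Suc i)"
      using pos_int_cases[of n] by (metis Suc_pred)
    then show ?thesis
      using zee_form_adjoint[of i u v] heis_pos[of "Suc i" u] heis_neg[of "Suc i" v] by simp
  next
    case False
    then obtain i where "n = - int (Suc i)"
      using n by (metis Suc_pred int_cases3 of_nat_0_less_iff)
    then show ?thesis
      using zee_form_adjoint[of i v u] heis_pos[of "Suc i" v] heis_neg[of "Suc i" u]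
      by (metis minus_minus zero_less_Suc zee_form_commute diff_Suc_1)
  qed
qed

definition orthonormal_basis :: "(fock \<Rightarrow> fock \<Rightarrow> rat) \<Rightarrow> fock set \<Rightarrow> bool" where
  "orthonormal_basis ip B \<longleftrightarrow>
     (\<forall>u\<in>B. \<forall>v\<in>B. ip u v = (if u = v then 1 else 0)) \<and>
     fock.independent B \<and> fock.span B = UNIV"

section \<open>Vertex operators\<close>

text \<open>
  For a formal series \<open>A(w) = \<Sum>n\<ge>1. A\<^sub>n w\<^sup>n\<close> of operators on \<open>V\<close> without constant term (\<open>A 0\<close> is
  ignored), \<open>op_power A k n\<close> is the coefficient of \<open>w\<^sup>n\<close> in \<open>A(w)\<^sup>k\<close>, and \<open>op_exp A n\<close> is the
  coefficient of \<open>w\<^sup>n\<close> in \<open>exp (A(w)) = \<Sum>k. A(w)\<^sup>k / k!\<close>, to which only \<open>k \<le> n\<close> contributes.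
\<close>

primrec op_power :: "(nat \<Rightarrow> fock \<Rightarrow> fock) \<Rightarrow> nat \<Rightarrow> nat \<Rightarrow> fock \<Rightarrow> fock" where
  "op_power A 0 n v = (if n = 0 then v else 0)"
| "op_power A (Suc k) n v = (\<Sum>m=1..n. A m (op_power A k (n - m) v))"

definition op_exp :: "(nat \<Rightarrow> fock \<Rightarrow> fock) \<Rightarrow> nat \<Rightarrow> fock \<Rightarrow> fock" where
  "op_exp A n v = (\<Sum>k\<le>n. fscale (1 / fact k) (op_power A k n v))"

text \<open>
  \<open>creation \<epsilon> i\<close> is the coefficient of \<open>z\<^sup>i\<close> in \<open>exp (\<epsilon> \<Sum>n\<ge>1. b\<^sub>-\<^sub>n z\<^sup>n / n)\<close>, and
  \<open>annihilation \<epsilon> j\<close> that of \<open>z\<^bsup>-j\<^esup>\<close> in \<open>exp (\<epsilon> \<Sum>n\<ge>1. b\<^sub>n z\<^bsup>-n\<^esup> / n)\<close>.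
\<close>

definition creation :: "rat \<Rightarrow> nat \<Rightarrow> fock \<Rightarrow> fock" where
  "creation \<epsilon> = op_exp (\<lambda>n v. fscale (\<epsilon> / of_nat n) (heis (- int n) v))"

definition annihilation :: "rat \<Rightarrow> nat \<Rightarrow> fock \<Rightarrow> fock" where
  "annihilation \<epsilon> = op_exp (\<lambda>n v. fscale (\<epsilon> / of_nat n) (heis (int n) v))"

text \<open>
  \<open>vertex_coeff \<epsilon> k\<close> is the coefficient of \<open>z\<^sup>k\<close> in
  \<open>exp (\<epsilon> \<Sum>n\<ge>1. b\<^sub>-\<^sub>n z\<^sup>n / n) exp (- \<epsilon> \<Sum>n\<ge>1. b\<^sub>n z\<^bsup>-n\<^esup> / n)\<close>.  On each vector only finitely many
  summands are nonzero (\<open>finite_vertex_coeff\<close>), so \<open>Sum_any\<close> is the intended sum.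
\<close>

definition vertex_coeff :: "rat \<Rightarrow> int \<Rightarrow> fock \<Rightarrow> fock" where
  "vertex_coeff \<epsilon> k v = Sum_any (\<lambda>j::nat.
     if 0 \<le> k + int j then creation \<epsilon> (nat (k + int j)) (annihilation (- \<epsilon>) j v) else 0)"

lemma op_power_degree:
  assumes "\<And>m v d. m > 0 \<Longrightarrow> P d v \<Longrightarrow> P (d - int m) (A m v)"
    and "\<And>d. P d 0" and "\<And>d u v. P d u \<Longrightarrow> P d v \<Longrightarrow> P d (u + v)" and "P d v"
  shows "P (d - int n) (op_power A k n v)"
proof (induction k arbitrary: n)
  case 0
  then show ?case using assms by simp
next
  case (Suc k)
  have "P (d - int n) (\<Sum>m\<in>B. A m (op_power A k (n - m) v))"
    if "finite B" "B \<subseteq> {1..n}" for B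
    using that
  proof (induction B rule: finite_induct)
    case empty
    then show ?case using assms by simp
  next
    case (insert m B)
    then have "P (d - int (n - m) - int m) (A m (op_power A k (n - m) v))"
      using insert.prems by (intro assms(1) Suc) auto
    moreover have "d - int (n - m) - int m = d - int n"
      using insert by auto
    ultimately show ?case using insert assms(3) by simp
  qed
  then show ?case by simp
qed

definition weight :: "(nat \<Rightarrow>\<^sub>0 nat) \<Rightarrow> nat" where
  "weight m = (\<Sum>i\<in>Poly_Mapping.keys m. Suc i * Poly_Mapping.lookup m i)"

lemma weight_single: "weight (m + Poly_Mapping.single i 1) = weight m + Suc i"
  unfolding weight_def
  by (subst setsum_keys_plus_distrib) (auto simp: algebra_simps)

definition weight_le :: "int \<Rightarrow> fock \<Rightarrow> bool" where
  "weight_le d v \<longleftrightarrow> (\<forall>m. Poly_Mapping.lookup v m \<noteq> 0 \<longrightarrow> int (weight m) \<le> d)"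

lemma weight_le_heis:
  assumes "n > 0" "weight_le d v"
  shows "weight_le (d - int n) (fscale a (heis (int n) v))"
  using assms weight_single[of _ "n - 1"]
  by (fastforce simp: weight_le_def heis_pos lookup_fscale lookup_fderiv)

lemma annihilation_eventually_zero: "\<exists>d. \<forall>j>d. annihilation \<epsilon> j v = 0"
proof -
  define d where "d = Max (insert 0 (weight ` Poly_Mapping.keys v))"
  have d: "weight_le (int d) v"
    by (auto simp: weight_le_def d_def in_keys_iff)
  have "annihilation \<epsilon> j v = 0" if "j > d" for j
  proof -
    have "op_power (\<lambda>n v. fscale (\<epsilon> / of_nat n) (heis (int n) v)) k j v = 0" for k
    proof -
      have "weight_le (int d - int j) (op_power (\<lambda>n v. fscale (\<epsilon> / of_nat n) (heis (int n) v)) k j v)"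
      proof (rule op_power_degree[where P = weight_le])
        show "weight_le d (u + v)" if "weight_le d u" "weight_le d v" for d u v
          using that unfolding weight_le_def lookup_add by (metis add_0)
      qed (use d weight_le_heis in \<open>auto simp: weight_le_def[of _ 0]\<close>)
      with that show ?thesis
        by (intro poly_mapping_eqI) (force simp: weight_le_def)
    qed
    then show ?thesis by (simp add: annihilation_def op_exp_def)
  qed
  then show ?thesis by blast
qed

lemma op_exp_zero:
  assumes "\<And>m. A m 0 = 0"
  shows "op_exp A n 0 = 0"
proof -
  have "op_power A k n 0 = 0" for k n
    by (induction k arbitrary: n) (simp_all add: assms)
  then show ?thesis by (simp add: op_exp_def)
qed

lemma finite_vertex_coeff:
  "finite {j::nat. (if 0 \<le> k + int j
     then creation \<epsilon> (nat (k + int j)) (annihilation \<epsilon>' j v) else 0) \<noteq> 0}"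
proof -
  obtain d where d: "\<And>j. j > d \<Longrightarrow> annihilation \<epsilon>' j v = 0"
    using annihilation_eventually_zero by blast
  have "creation \<epsilon> n 0 = 0" for n
    unfolding creation_def by (rule op_exp_zero) (simp add: heis_def fderiv_def)
  then have "{j::nat. (if 0 \<le> k + int j
     then creation \<epsilon> (nat (k + int j)) (annihilation \<epsilon>' j v) else 0) \<noteq> 0} \<subseteq> {..d}"
    using d by (auto simp: not_less[symmetric])
  then show ?thesis using finite_subset by blast
qed

text \<open>The sign conventions differ: \<open>S(z) = \<Sum>n. S\<^sub>n z\<^bsup>-n\<^esup>\<close> but \<open>S\<^sup>*(z) = \<Sum>n. S\<^sup>*\<^sub>n z\<^sup>n\<close>.\<close>

definition vS :: "int \<Rightarrow> fock \<Rightarrow> fock" where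
  "vS n = vertex_coeff 1 (- n)"

definition vS_star :: "int \<Rightarrow> fock \<Rightarrow> fock" where
  "vS_star n = vertex_coeff (- 1) n"

section \<open>Symmetric functions in infinitely many variables\<close>

text \<open>
  The ring of formal power series in the variables \<open>x\<^sub>0, x\<^sub>1, \<dots>\<close>, in which the symmetric functions
  (bounded degree, symmetric) live; an element is its family of coefficients.
\<close>

typedef 'a mps = "UNIV :: ((nat \<Rightarrow>\<^sub>0 nat) \<Rightarrow> 'a) set"
  morphisms mps_coeff Abs_mps ..

setup_lifting type_definition_mps

definition splits :: "(nat \<Rightarrow>\<^sub>0 nat) \<Rightarrow> ((nat \<Rightarrow>\<^sub>0 nat) \<times> (nat \<Rightarrow>\<^sub>0 nat)) set" where
  "splits a = {(b, c). b + c = a}"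

lemma finite_splits: "finite (splits a)"
proof -
  let ?F = "{f. \<forall>i. (i \<in> Poly_Mapping.keys a \<longrightarrow> f i \<in> {..Max (Poly_Mapping.lookup a ` Poly_Mapping.keys a)})
      \<and> (i \<notin> Poly_Mapping.keys a \<longrightarrow> f i = (0::nat))}"
  have fF: "finite ?F"
    by (rule finite_set_of_finite_funs) auto
  have "(\<lambda>(b, c). Poly_Mapping.lookup b) ` splits a \<subseteq> ?F"
  proof (clarsimp simp: splits_def, intro conjI impI)
    fix b c :: "nat \<Rightarrow>\<^sub>0 nat" and i
    assume "a = b + c" and i: "i \<in> Poly_Mapping.keys (b + c)"
    have "Poly_Mapping.lookup b i \<le> Poly_Mapping.lookup (b + c) i"
      by (simp add: lookup_add)
    also have "\<dots> \<le> Max (Poly_Mapping.lookup (b + c) ` Poly_Mapping.keys (b + c))"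
      using i by (intro Max_ge) auto
    finally show "Poly_Mapping.lookup b i
        \<le> Max (Poly_Mapping.lookup (b + c) ` Poly_Mapping.keys (b + c))" .
  next
    fix b c :: "nat \<Rightarrow>\<^sub>0 nat" and i
    assume "i \<notin> Poly_Mapping.keys (b + c)"
    then show "Poly_Mapping.lookup b i = 0"
      by (simp add: in_keys_iff lookup_add)
  qed
  then have "finite ((\<lambda>(b, c). Poly_Mapping.lookup b) ` splits a)"
    using fF finite_subset by blast
  moreover have "inj_on (\<lambda>(b, c). Poly_Mapping.lookup b) (splits a)"
    by (auto simp: inj_on_def splits_def)
  ultimately show ?thesis
    using finite_imageD by blast
qed

lemma sum_splits_assoc:
  fixes F :: "(nat \<Rightarrow>\<^sub>0 nat) \<Rightarrow> (nat \<Rightarrow>\<^sub>0 nat) \<Rightarrow> (nat \<Rightarrow>\<^sub>0 nat) \<Rightarrow> 'a::comm_monoid_add"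
  shows "(\<Sum>(b, c)\<in>splits a. \<Sum>(d, e)\<in>splits b. F d e c)
       = (\<Sum>(d, b)\<in>splits a. \<Sum>(e, c)\<in>splits b. F d e c)"
proof -
  have "(\<Sum>(b, c)\<in>splits a. \<Sum>(d, e)\<in>splits b. F d e c)
      = (\<Sum>(p, q)\<in>(SIGMA p:splits a. splits (fst p)). F (fst q) (snd q) (snd p))"
    by (subst sum.Sigma[symmetric]) (auto simp: finite_splits split_def)
  also have "\<dots> = (\<Sum>(p, q)\<in>(SIGMA p:splits a. splits (snd p)). F (fst p) (fst q) (snd q))"
    by (rule sum.reindex_bij_witness[where
          j = "\<lambda>((b, c), (d, e)). ((d, e + c), (e, c))" and
          i = "\<lambda>((d, b), (e, c)). ((d + e, c), (d, e))"])
      (auto simp: splits_def add.assoc)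
  also have "\<dots> = (\<Sum>(d, b)\<in>splits a. \<Sum>(e, c)\<in>splits b. F d e c)"
    by (subst sum.Sigma[symmetric]) (auto simp: finite_splits split_def)
  finally show ?thesis .
qed

lemma sum_splits_commute:
  "(\<Sum>(b, c)\<in>splits a. F b c) = (\<Sum>(b, c)\<in>splits a. F c b)"
  by (rule sum.reindex_bij_witness[where i = prod.swap and j = prod.swap])
    (auto simp: splits_def add.commute)

lemma sum_splits_zero:
  fixes F :: "(nat \<Rightarrow>\<^sub>0 nat) \<Rightarrow> (nat \<Rightarrow>\<^sub>0 nat) \<Rightarrow> 'a::comm_monoid_add"
  assumes "\<And>b c. b \<noteq> 0 \<Longrightarrow> F b c = 0"
  shows "(\<Sum>(b, c)\<in>splits a. F b c) = F 0 a"
proof -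
  have "(\<Sum>(b, c)\<in>splits a. F b c) = (\<Sum>(b, c)\<in>{(0, a)}. F b c)"
    using assms by (intro sum.mono_neutral_right finite_splits) (fastforce simp: splits_def)+
  then show ?thesis by simp
qed

instantiation mps :: (comm_ring_1) comm_ring_1
begin

lift_definition zero_mps :: "'a mps" is "\<lambda>_. 0" .
lift_definition one_mps :: "'a mps" is "\<lambda>a. if a = 0 then 1 else 0" .
lift_definition plus_mps :: "'a mps \<Rightarrow> 'a mps \<Rightarrow> 'a mps" is "\<lambda>f g a. f a + g a" .
lift_definition minus_mps :: "'a mps \<Rightarrow> 'a mps \<Rightarrow> 'a mps" is "\<lambda>f g a. f a - g a" .
lift_definition uminus_mps :: "'a mps \<Rightarrow> 'a mps" is "\<lambda>f a. - f a" .
lift_definition times_mps :: "'a mps \<Rightarrow> 'a mps \<Rightarrow> 'a mps" is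
  "\<lambda>f g a. \<Sum>(b, c)\<in>splits a. f b * g c" .

instance
proof
  fix f g h :: "'a mps"
  show "f * g * h = f * (g * h)"
  proof (transfer, rule ext)
    fix f g h :: "(nat \<Rightarrow>\<^sub>0 nat) \<Rightarrow> 'a" and a
    have "(\<Sum>(b, c)\<in>splits a. (\<Sum>(d, e)\<in>splits b. f d * g e) * h c)
        = (\<Sum>(b, c)\<in>splits a. \<Sum>(d, e)\<in>splits b. f d * g e * h c)"
      by (simp add: sum_distrib_right split_def)
    also have "\<dots> = (\<Sum>(d, b)\<in>splits a. \<Sum>(e, c)\<in>splits b. f d * g e * h c)"
      by (rule sum_splits_assoc)
    also have "\<dots> = (\<Sum>(d, b)\<in>splits a. f d * (\<Sum>(e, c)\<in>splits b. g e * h c))"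
      by (simp add: sum_distrib_left split_def mult.assoc)
    finally show "(\<Sum>(b, c)\<in>splits a. (\<Sum>(d, e)\<in>splits b. f d * g e) * h c)
        = (\<Sum>(d, b)\<in>splits a. f d * (\<Sum>(e, c)\<in>splits b. g e * h c))" .
  qed
  show "f * g = g * f"
    by (transfer, rule ext, subst sum_splits_commute) (simp add: mult.commute)
  show "1 * f = f"
    by (transfer, rule ext, subst sum_splits_zero) auto
  show "(f + g) * h = f * h + g * h"
    by (transfer, rule ext) (simp add: distrib_right sum.distrib split_def)
  show "f + g + h = f + (g + h)" by transfer (simp add: add.assoc)
  show "f + g = g + f" by transfer (simp add: add.commute)
  show "0 + f = f" by transfer simp
  show "- f + f = 0" by transfer simp
  show "f - g = f + - g" by transfer simp
  show "(0::'a mps) \<noteq> 1" by transfer (auto simp: fun_eq_iff)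
qed

end

lift_definition mps_const :: "'a::zero \<Rightarrow> 'a mps" is "\<lambda>r a. if a = 0 then r else 0" .

text \<open>\<open>p\<^sub>n = \<Sum>i. x\<^sub>i\<^sup>n\<close>, for \<open>n \<ge> 1\<close>\<close>

lift_definition power_sum :: "nat \<Rightarrow> rat mps" is
  "\<lambda>n a. if \<exists>i. a = Poly_Mapping.single i n then 1 else 0" .

text \<open>
  The identification of \<open>V\<close> with the ring of symmetric functions: the substitution
  \<open>b\<^sub>-\<^sub>n \<mapsto> p\<^sub>n\<close>.
\<close>

definition fock_to_sym :: "fock \<Rightarrow> rat mps" where
  "fock_to_sym v = (\<Sum>m\<in>Poly_Mapping.keys v. mps_const (Poly_Mapping.lookup v m) *
     (\<Prod>i\<in>Poly_Mapping.keys m. power_sum (i + 1) ^ Poly_Mapping.lookup m i))"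

text \<open>The complete homogeneous symmetric function \<open>s\<^sub>n\<close>, the sum of all monomials of degree \<open>n\<close>\<close>

lift_definition complete_sym :: "int \<Rightarrow> rat mps" is
  "\<lambda>n a. if int (\<Sum>i\<in>Poly_Mapping.keys a. Poly_Mapping.lookup a i) = n then 1 else 0" .

definition is_partition :: "nat list \<Rightarrow> bool" where
  "is_partition l \<longleftrightarrow> sorted_wrt (\<ge>) l \<and> 0 \<notin> set l"

definition conj_partition :: "nat list \<Rightarrow> nat list" where
  "conj_partition l = map (\<lambda>j. card {i. i < length l \<and> j < l ! i}) [0..<(if l = [] then 0 else hd l)]"

definition diagram :: "nat list \<Rightarrow> (nat \<times> nat) set" where
  "diagram l = {(i, j). i < length l \<and> j < l ! i}"

text \<open>Semistandard tableaux, extended by \<open>undefined\<close> outside the diagram\<close>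

definition ssyt :: "nat list \<Rightarrow> (nat \<times> nat \<Rightarrow> nat) set" where
  "ssyt l = {T \<in> diagram l \<rightarrow>\<^sub>E UNIV.
     (\<forall>i j. (i, j) \<in> diagram l \<and> (i, Suc j) \<in> diagram l \<longrightarrow> T (i, j) \<le> T (i, Suc j)) \<and>
     (\<forall>i j. (i, j) \<in> diagram l \<and> (Suc i, j) \<in> diagram l \<longrightarrow> T (i, j) < T (Suc i, j))}"

text \<open>The Schur function as the generating function of semistandard tableaux by content\<close>

lift_definition schur :: "nat list \<Rightarrow> rat mps" is
  "\<lambda>l a. of_nat (card {T \<in> ssyt l. \<forall>k. card {c \<in> diagram l. T c = k} = Poly_Mapping.lookup a k})" .

section \<open>Straightening of integer tuples\<close>

definition delta :: "nat \<Rightarrow> int list" where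
  "delta N = map (\<lambda>i. int (N - 1 - i)) [0..<N]"

definition delta_shift :: "int list \<Rightarrow> int list" where
  "delta_shift k = map2 (+) k (delta (length k))"

definition degenerate :: "int list \<Rightarrow> bool" where
  "degenerate k \<longleftrightarrow> \<not> distinct (delta_shift k)"

text \<open>The permutation \<open>\<sigma>\<close>, unique for nondegenerate \<open>k\<close> (\<open>straightener_unique\<close>)\<close>

definition straightener :: "int list \<Rightarrow> nat \<Rightarrow> nat" where
  "straightener k = (THE \<sigma>. \<sigma> permutes {..<length k} \<and>
     sorted_wrt (\<ge>) (map2 (-) (permute_list \<sigma> (delta_shift k)) (delta (length k))))"

lemma straightener_unique:
  assumes "\<not> degenerate k"
  shows "\<exists>!\<sigma>. \<sigma> permutes {..<length k} \<and>
     sorted_wrt (\<ge>) (map2 (-) (permute_list \<sigma> (delta_shift k)) (delta (length k)))"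
proof -
  define a where "a = delta_shift k"
  define N where "N = length k"
  have len: "length a = N" "length (delta N) = N"
    by (simp_all add: a_def N_def delta_shift_def delta_def)
  have dist: "distinct a"
    using assms by (simp add: degenerate_def a_def)
  have strict: "sorted_wrt (\<ge>) (map2 (-) xs (delta N)) \<longleftrightarrow> sorted_wrt (>) xs"
    if lx: "length xs = N" for xs :: "int list"
  proof -
    have "sorted_wrt (\<ge>) (map2 (-) xs (delta N)) \<longleftrightarrow>
        (\<forall>i. Suc i < N \<longrightarrow> xs ! Suc i - int (N - 1 - Suc i) \<le> xs ! i - int (N - 1 - i))"
      using lx by (subst sorted_wrt_iff_nth_Suc_transp) (auto simp: transp_def delta_def)
    also have "\<dots> \<longleftrightarrow> (\<forall>i. Suc i < N \<longrightarrow> xs ! Suc i < xs ! i)"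
      by (intro all_cong) auto
    also have "\<dots> \<longleftrightarrow> sorted_wrt (>) xs"
      using lx by (subst sorted_wrt_iff_nth_Suc_transp) (auto simp: transp_def)
    finally show ?thesis .
  qed
  have eq: "(\<sigma> permutes {..<N} \<and> sorted_wrt (\<ge>) (map2 (-) (permute_list \<sigma> a) (delta N))) \<longleftrightarrow>
      (\<sigma> permutes {..<N} \<and> permute_list \<sigma> a = rev (sort a))" (is "?L \<longleftrightarrow> ?R") for \<sigma>
  proof -
    have "sorted_wrt (>) (permute_list \<sigma> a) \<longleftrightarrow> permute_list \<sigma> a = rev (sort a)"
      if p: "\<sigma> permutes {..<N}"
    proof
      assume "sorted_wrt (>) (permute_list \<sigma> a)"
      then have "sorted (rev (permute_list \<sigma> a))"
        by (simp add: sorted_wrt_rev) (metis (mono_tags, lifting) order_less_imp_le sorted_wrt_mono_rel)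
      moreover have "mset (rev (permute_list \<sigma> a)) = mset a"
        using p len by simp
      ultimately show "permute_list \<sigma> a = rev (sort a)"
        by (metis properties_for_sort rev_rev_ident)
    next
      assume "permute_list \<sigma> a = rev (sort a)"
      moreover have "sorted_wrt (<) (sort a)"
        using dist by (simp add: strict_sorted_iff)
      ultimately show "sorted_wrt (>) (permute_list \<sigma> a)"
        by (simp add: sorted_wrt_rev)
    qed
    then show ?thesis using strict[of "permute_list \<sigma> a"] len by auto
  qed
  have "mset (rev (sort a)) = mset a" by simp
  then obtain \<sigma> where s: "\<sigma> permutes {..<N}" "permute_list \<sigma> a = rev (sort a)"
    using mset_eq_permutation[of "rev (sort a)" a] len by metis
  have "\<tau> = \<sigma>" if t: "\<tau> permutes {..<N}" "permute_list \<tau> a = rev (sort a)" for \<tau>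
  proof
    fix i
    show "\<tau> i = \<sigma> i"
    proof (cases "i < N")
      case True
      have "a ! \<tau> i = a ! \<sigma> i"
        using s t True len by (metis permute_list_nth)
      moreover have "\<tau> i < N" "\<sigma> i < N"
        using s(1) t(1) True permutes_in_image by (metis lessThan_iff)+
      ultimately show ?thesis
        using dist len by (simp add: nth_eq_iff_index_eq)
    next
      case False
      then show ?thesis using s t by (simp add: permutes_not_in)
    qed
  qed
  with s show ?thesis
    unfolding eq[unfolded a_def N_def] by (metis a_def N_def)
qed

definition straighten :: "int list \<Rightarrow> int list" where
  "straighten k = map2 (-) (permute_list (straightener k) (delta_shift k)) (delta (length k))"

definition perm_length :: "nat \<Rightarrow> (nat \<Rightarrow> nat) \<Rightarrow> nat" where
  "perm_length N \<sigma> = card {(i, j). i < j \<and> j < N \<and> \<sigma> j < \<sigma> i}"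

definition tuple_sgn :: "int list \<Rightarrow> int" where
  "tuple_sgn k = (if degenerate k then 0 else (- 1) ^ perm_length (length k) (straightener k))"

end

theory Submission
  imports Defs "HOL-Computational_Algebra.Formal_Power_Series"
begin

text \<open>
  Write \<open>C\<^sub>\<epsilon>(z) = exp (\<epsilon> \<Sum>n\<ge>1. b\<^sub>-\<^sub>n z\<^sup>n / n)\<close> and \<open>A\<^sub>\<epsilon>(y) = exp (\<epsilon> \<Sum>n\<ge>1. b\<^sub>n y\<^sup>n / n)\<close>.  The second one is the ring
  homomorphism \<open>p\<^sub>n \<mapsto> p\<^sub>n + \<epsilon> y\<^sup>n\<close>, so that \<open>A\<^sub>\<epsilon>(y)\<close> sends \<open>C\<^sub>\<eta>(z)\<close> to \<open>(1 - y z)\<^bsup>-\<epsilon>\<eta>\<^esup> C\<^sub>\<eta>(z)\<close>.  For the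
  coefficients \<open>T\<^bsub>\<epsilon>,m\<^esub>\<close> of \<open>C\<^sub>\<epsilon>(z) A\<^bsub>-\<epsilon>\<^esub>(1/z)\<close> (thus \<open>S\<^bsub>-m\<^esub> = T\<^bsub>1,m\<^esub>\<close> and \<open>S\<^sup>*\<^sub>m = T\<^bsub>-1,m\<^esub>\<close>) this gives
  \<open>T\<^bsub>\<epsilon>,m\<^esub> T\<^bsub>\<epsilon>,n\<^esub> = - T\<^bsub>\<epsilon>,n-1\<^esub> T\<^bsub>\<epsilon>,m+1\<^esub>\<close> and \<open>T\<^bsub>\<epsilon>,a\<^esub> T\<^bsub>-\<epsilon>,b\<^esub> + T\<^bsub>-\<epsilon>,b+1\<^esub> T\<^bsub>\<epsilon>,a-1\<^esub> = \<delta>\<^bsub>a+b,0\<^esub>\<close>.  The first relation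
  says that \<open>T\<^bsub>\<epsilon>,\<kappa>\<^esub>.1\<close> is alternating in \<open>\<kappa> + \<delta>\<close>, which yields the straightening law.  By the second
  one, applying \<open>S\<^sup>*\<^sub>k\<close> to \<open>S\<^bsub>-\<lambda>\<^esub>.1\<close> adds a column of length \<open>k \<ge> length \<lambda>\<close> to \<open>\<lambda>\<close>, up to the sign \<open>(-1)\<^sup>k\<close>, so that
  \<open>S\<^sup>*\<^sub>\<nu>.1 = (-1)\<^bsup>|\<nu>|\<^esup> S\<^bsub>-\<nu>'\<^esub>.1\<close>; together with adjointness it also yields orthonormality.  Finally
  \<open>S\<^bsub>-\<kappa>\<^esub>.1 = det (h\<^bsub>\<kappa>\<^sub>i-i+j\<^esub>)\<close>, which for partitions is the Schur function by the Jacobi-Trudi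
  formula; the latter holds because determinants and tableaux obey the same branching rule when one
  variable is removed.
\<close>

section \<open>Exponentials of the Heisenberg generators\<close>

lemma fock_induct_sum [case_names single add]:
  assumes "\<And>m c. P (Poly_Mapping.single m c)" "\<And>u v. P u \<Longrightarrow> P v \<Longrightarrow> P (u + v)"
  shows "P (u :: fock)"
proof -
  have "P (\<Sum>m\<in>K. Poly_Mapping.single m (Poly_Mapping.lookup u m))" if "finite K" for K
    using that
  proof (induction K)
    case empty
    then show ?case using assms(1)[of 0 0] by simp
  next
    case (insert m K)
    then show ?case using assms by simp
  qed
  moreover have "u = (\<Sum>m\<in>Poly_Mapping.keys u. Poly_Mapping.single m (Poly_Mapping.lookup u m))"
    by (rule poly_mapping_eqI) (simp add: lookup_sum lookup_single when_def in_keys_iff)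
  ultimately show ?thesis
    by (metis finite_keys)
qed

text \<open>Peeling one variable off a monomial lowers its \<open>weight\<close>, so induction on
  the weight ends at the constants.\<close>

lemma fock_induct_single:
  assumes "\<And>c. P (Poly_Mapping.single 0 c)" "\<And>i u. P u \<Longrightarrow> P (fvar i * u)"
  shows "P (Poly_Mapping.single m (c::rat))"
proof (induction "weight m" arbitrary: m rule: less_induct)
  case less
  show ?case
  proof (cases "m = 0")
    case True
    then show ?thesis using assms(1) by simp
  next
    case False
    then obtain i where i: "Poly_Mapping.lookup m i \<noteq> 0"
      by (metis lookup_zero poly_mapping_eqI)
    let ?e = "Poly_Mapping.single i 1 :: nat \<Rightarrow>\<^sub>0 nat"
    have m: "m = (m - ?e) + ?e"
      using i by (intro poly_mapping_eqI) (auto simp: lookup_add lookup_minus lookup_single when_def)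
    then have "weight m = weight (m - ?e) + Suc i"
      by (metis weight_single)
    then have "P (fvar i * Poly_Mapping.single (m - ?e) c)"
      by (intro assms(2) less) auto
    moreover have "fvar i * Poly_Mapping.single (m - ?e) c = Poly_Mapping.single m c"
      by (subst (2) m) (simp add: fvar_def mult_single add.commute)
    ultimately show ?thesis by simp
  qed
qed

text \<open>Reduces a claim about all of \<open>V\<close> to constants, multiplication by one
  generator, and sums. It serves for the multiplicativity \<open>ann_mult\<close> and for showing
  that a subspace stable under the generators is everything.\<close>

lemma fock_induct [case_names const fvar add]:
  assumes "\<And>c. P (Poly_Mapping.single 0 c)" "\<And>i u. P u \<Longrightarrow> P (fvar i * u)"
    and "\<And>u v. P u \<Longrightarrow> P v \<Longrightarrow> P (u + v)"
  shows "P (u :: fock)"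
  using fock_induct_single[of P] assms by (induction u rule: fock_induct_sum) blast+

text \<open>The recursions for exponentials determine only \<open>n\<close> times the coefficient of
  degree \<open>n\<close>; over the rationals this factor can be removed.\<close>

lemma fock_of_nat_cancel: "n > 0 \<Longrightarrow> of_nat n * u = of_nat n * v \<Longrightarrow> u = (v :: fock)"
  by (simp flip: fscale_of_nat)

lemma fock_single_0: "Poly_Mapping.single 0 c = fscale c 1"
  by (simp add: fscale_def)

lemma fscale_mult_left: "fscale a u * v = fscale a (u * v)"
  by (simp add: fscale_def mult.assoc)

lemma fscale_mult_right: "u * fscale a v = fscale a (u * v)"
  by (simp add: fscale_def mult.left_commute)

lemma heis_add: "heis n (u + v) = heis n u + heis n v"
  by (cases "n < 0")
    (auto simp: heis_def algebra_simps fock.scale_right_distrib intro!: poly_mapping_eqI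
      simp: lookup_fderiv lookup_add lookup_fscale)

lemma heis_fscale: "heis n (fscale a u) = fscale a (heis n u)"
  by (cases "n < 0") (auto simp: heis_def fvar_mult_fscale fderiv_fscale mult.commute[of a])

section \<open>Exponentials of series of commuting operators\<close>

lemma sum_triangle_swap:
  fixes F :: "nat \<Rightarrow> nat \<Rightarrow> nat \<Rightarrow> 'a :: comm_monoid_add"
  shows "(\<Sum>m=1..n. \<Sum>i=1..n - m. F m i (n - m - i)) = (\<Sum>i=1..n. \<Sum>m=1..n - i. F m i (n - i - m))"
  unfolding sum.Sigma[OF finite_atLeastAtMost ballI[OF finite_atLeastAtMost]]
  by (rule sum.reindex_bij_witness[where i = prod.swap and j = prod.swap])
    (auto simp: add.commute)

text \<open>Covers both halves of a vertex operator: modes of one sign commute with each other,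
  which is all that is needed to differentiate an exponential.\<close>

locale heis_series =
  fixes A :: "nat \<Rightarrow> fock \<Rightarrow> fock"
  assumes A_add: "A n (u + v) = A n u + A n v"
    and A_fscale: "A n (fscale a u) = fscale a (A n u)"
    and A_commute: "m > 0 \<Longrightarrow> n > 0 \<Longrightarrow> A m (A n u) = A n (A m u)"
begin

lemma A_zero [simp]: "A n 0 = 0"
  using A_add[of n 0 0] by simp

lemma A_sum: "A n (sum f S) = (\<Sum>x\<in>S. A n (f x))"
  by (induction S rule: infinite_finite_induct) (auto simp: A_add)

lemma op_power_add: "op_power A k n (u + v) = op_power A k n u + op_power A k n v"
  by (induction k arbitrary: n) (auto simp: A_add sum.distrib)

lemma op_power_fscale: "op_power A k n (fscale a u) = fscale a (op_power A k n u)"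
  by (induction k arbitrary: n) (auto simp: A_fscale fock.scale_sum_right)

lemma op_power_commute: "m > 0 \<Longrightarrow> A m (op_power A k n u) = op_power A k n (A m u)"
proof (induction k arbitrary: n)
  case (Suc k)
  have "A m (A i (op_power A k (n - i) u)) = A i (op_power A k (n - i) (A m u))" if "i \<in> {1..n}" for i
    using that Suc.prems by (subst A_commute) (auto simp: Suc)
  then show ?case by (simp add: A_sum)
qed auto

lemma op_power_eq_0: "n < k \<Longrightarrow> op_power A k n u = 0"
proof (induction k arbitrary: n)
  case (Suc k)
  then show ?case by (auto intro!: sum.neutral)
qed auto

text \<open>The coefficientwise form of \<open>w (d/dw) A(w)\<^sup>k = k (w A'(w)) A(w)\<^bsup>k-1\<^esup>\<close>.\<close>

lemma of_nat_mult_op_power: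
  "of_nat n * op_power A (Suc k) n u
     = of_nat (Suc k) * (\<Sum>m=1..n. of_nat m * A m (op_power A k (n - m) u))"
proof (induction k arbitrary: n)
  case 0
  have *: "A m (op_power A 0 (n - m) u) = (if m = n then A m u else 0)" if "m \<in> {1..n}" for m
    using that by simp
  have "op_power A (Suc 0) n u = (\<Sum>m=1..n. if m = n then A m u else 0)"
    unfolding op_power.simps(2) by (rule sum.cong[OF refl *])
  moreover have "(\<Sum>m=1..n. of_nat m * A m (op_power A 0 (n - m) u))
      = (\<Sum>m=1..n. if m = n then of_nat m * A m u else 0)"
    using * by (intro sum.cong refl) simp
  ultimately show ?case by (simp del: op_power.simps)
next
  case (Suc k)
  \<comment> \<open>Leibniz rule: \<open>n = m + (n - m)\<close> distributes the derivative over the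
    first factor and the remaining power, and the induction hypothesis handles the latter.\<close>
  have "of_nat n * op_power A (Suc (Suc k)) n u
      = (\<Sum>m=1..n. of_nat m * A m (op_power A (Suc k) (n - m) u))
      + (\<Sum>m=1..n. of_nat (n - m) * A m (op_power A (Suc k) (n - m) u))"
    unfolding op_power.simps(2)[of A "Suc k"] sum_distrib_left sum.distrib[symmetric]
    by (intro sum.cong refl) (auto simp del: op_power.simps simp flip: distrib_right of_nat_add)
  also have "(\<Sum>m=1..n. of_nat (n - m) * A m (op_power A (Suc k) (n - m) u))
      = (\<Sum>m=1..n. A m (of_nat (Suc k) * (\<Sum>i=1..n-m. of_nat i * A i (op_power A k (n - m - i) u))))"
    by (simp only: Suc.IH[symmetric]) (simp only: A_fscale fscale_of_nat[symmetric])
  also have "\<dots> = of_nat (Suc k) * (\<Sum>m=1..n. \<Sum>i=1..n-m. of_nat i * A m (A i (op_power A k (n - m - i) u)))"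
    unfolding fscale_of_nat[symmetric] A_fscale A_sum fock.scale_sum_right ..
  \<comment> \<open>After the swap the differentiated factor \<open>A i\<close> stands outermost and
    the inner sum is again a power, so both summands are multiples of the same expression, with
    multiplicities 1 and \<open>Suc k\<close>.\<close>
  also have "(\<Sum>m=1..n. \<Sum>i=1..n-m. of_nat i * A m (A i (op_power A k (n - m - i) u)))
      = (\<Sum>i=1..n. \<Sum>m=1..n-i. of_nat i * A m (A i (op_power A k (n - i - m) u)))"
    by (rule sum_triangle_swap)
  also have "\<dots> = (\<Sum>i=1..n. of_nat i * A i (op_power A (Suc k) (n - i) u))"
  proof (rule sum.cong[OF refl])
    fix i assume i: "i \<in> {1..n}"
    have "(\<Sum>m=1..n-i. of_nat i * A m (A i (op_power A k (n - i - m) u)))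
        = (\<Sum>m=1..n-i. of_nat i * A i (A m (op_power A k (n - i - m) u)))"
      using i by (intro sum.cong refl) (subst A_commute, auto)
    then show "(\<Sum>m=1..n-i. of_nat i * A m (A i (op_power A k (n - i - m) u)))
        = of_nat i * A i (op_power A (Suc k) (n - i) u)"
      by (simp only: A_sum sum_distrib_left op_power.simps)
  qed
  finally show ?case by (simp add: algebra_simps)
qed

lemma op_exp_add: "op_exp A n (u + v) = op_exp A n u + op_exp A n v"
  by (simp add: op_exp_def op_power_add fock.scale_right_distrib sum.distrib)

lemma op_exp_fscale: "op_exp A n (fscale a u) = fscale a (op_exp A n u)"
  by (simp add: op_exp_def op_power_fscale fock.scale_sum_right mult.commute)

lemma op_exp_0: "op_exp A 0 u = u"
  by (simp add: op_exp_def)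

lemma op_exp_commute: "m > 0 \<Longrightarrow> A m (op_exp A n u) = op_exp A n (A m u)"
  by (simp add: op_exp_def A_sum A_fscale op_power_commute)

text \<open>A truncation bound independent of \<open>n\<close> lets coefficients of different
  degrees be summed over one range.\<close>

lemma op_exp_superset: "n \<le> N \<Longrightarrow> op_exp A n u = (\<Sum>k\<le>N. fscale (1 / fact k) (op_power A k n u))"
  unfolding op_exp_def by (rule sum.mono_neutral_left) (auto simp: op_power_eq_0)

text \<open>The differential equation \<open>w E' = (w A') E\<close> of \<open>E = exp A\<close>,
  read off coefficientwise; the computations with creation and annihilation coefficients rest on
  this recursion.\<close>

lemma of_nat_mult_op_exp:
  "of_nat n * op_exp A n u = (\<Sum>m=1..n. of_nat m * A m (op_exp A (n - m) u))"
proof (cases n)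
  case (Suc N)
  have "of_nat n * op_exp A n u
     = (\<Sum>k\<le>Suc N. fscale (1 / fact k) (of_nat n * op_power A k n u))"
    by (simp only: op_exp_def sum_distrib_left fscale_mult_right Suc)
  \<comment> \<open>The term \<open>k = 0\<close> vanishes because \<open>n\<close> is positive; the
    others are reindexed.\<close>
  also have "\<dots> = (\<Sum>k\<le>N. fscale (1 / fact (Suc k)) (of_nat n * op_power A (Suc k) n u))"
    by (subst sum.atMost_Suc_shift) (simp add: Suc del: op_power.simps(2))
  also have "\<dots> = (\<Sum>k\<le>N. fscale (1 / fact k) (\<Sum>m=1..n. of_nat m * A m (op_power A k (n - m) u)))"
  proof (rule sum.cong[OF refl])
    fix k
    have "fscale (1 / fact (Suc k)) (of_nat (Suc k) * w) = fscale (1 / fact k) w" for w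
      by (simp only: fock.scale_scale fact_Suc flip: fscale_of_nat)
        (simp add: divide_simps del: of_nat_Suc)
    then show "fscale (1 / fact (Suc k)) (of_nat n * op_power A (Suc k) n u)
      = fscale (1 / fact k) (\<Sum>m=1..n. of_nat m * A m (op_power A k (n - m) u))"
      by (simp only: of_nat_mult_op_power)
  qed
  also have "\<dots> = (\<Sum>m=1..n. of_nat m * A m (\<Sum>k\<le>N. fscale (1 / fact k) (op_power A k (n - m) u)))"
    by (simp only: fock.scale_sum_right A_sum A_fscale sum_distrib_left fscale_mult_right)
      (rule sum.swap)
  also have "\<dots> = (\<Sum>m=1..n. of_nat m * A m (op_exp A (n - m) u))"
    using Suc by (intro sum.cong refl) (subst op_exp_superset[of _ N], auto)
  finally show ?thesis .
qed simp

end

section \<open>Creation and annihilation coefficients and their commutation rules\<close>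

lemma heis_commute:
  assumes "m \<noteq> 0" "n \<noteq> 0" "m \<noteq> - n"
  shows "heis m (heis n v) = heis n (heis m v)"
  using heis_commutator[OF assms(1,2)] assms(3) by simp

interpretation creation: heis_series "\<lambda>n v. fscale (\<epsilon> / of_nat n) (heis (- int n) v)" for \<epsilon>
  by unfold_locales
    (auto simp: heis_add heis_fscale fock.scale_right_distrib heis_commute mult.commute)

interpretation annihilation: heis_series "\<lambda>n v. fscale (\<epsilon> / of_nat n) (heis (int n) v)" for \<epsilon>
  by unfold_locales
    (auto simp: heis_add heis_fscale fock.scale_right_distrib heis_commute mult.commute)

lemmas annihilation_add = annihilation.op_exp_add[folded annihilation_def]
  and annihilation_fscale = annihilation.op_exp_fscale[folded annihilation_def]
  and creation_0 = creation.op_exp_0[folded creation_def]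
  and annihilation_0 = annihilation.op_exp_0[folded annihilation_def]

lemma creation_rec: "of_nat n * creation \<epsilon> n u
    = (\<Sum>m=1..n. fscale \<epsilon> (fvar (m - 1) * creation \<epsilon> (n - m) u))"
  unfolding creation.of_nat_mult_op_exp[of n \<epsilon> u, folded creation_def]
  by (rule sum.cong) (auto simp: heis_neg simp flip: fscale_of_nat)

lemma annihilation_rec: "of_nat n * annihilation \<epsilon> n u
    = (\<Sum>m=1..n. fscale \<epsilon> (heis (int m) (annihilation \<epsilon> (n - m) u)))"
  unfolding annihilation.of_nat_mult_op_exp[of n \<epsilon> u, folded annihilation_def]
  by (rule sum.cong) (auto simp flip: fscale_of_nat)

lemma annihilation_heis_commute:
  assumes "m > 0"
  shows "heis (int m) (annihilation \<epsilon> n u) = annihilation \<epsilon> n (heis (int m) u)"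
proof (cases "\<epsilon> = 0")
  case False
  from annihilation.op_exp_commute[OF assms, of \<epsilon> n u, folded annihilation_def]
  have "fscale (\<epsilon> / of_nat m) (heis (int m) (annihilation \<epsilon> n u))
      = fscale (\<epsilon> / of_nat m) (annihilation \<epsilon> n (heis (int m) u))"
    by (simp add: annihilation_fscale)
  then show ?thesis using False assms by simp
next
  \<comment> \<open>For \<open>\<epsilon> = 0\<close> the scalar cannot be cancelled, but then the
    exponential is the identity.\<close>
  case True
  have "annihilation 0 n u = (if n = 0 then u else 0)" for u
    using annihilation_rec[of n 0 u] annihilation_0 fock_of_nat_cancel[of n _ 0] by auto
  then show ?thesis using True by (simp add: heis_def fderiv_def)
qed

text \<open>Extending the coefficients by 0 to negative integers removes side conditions from index
  shifts. Under the identification with symmetric functions, \<open>cre 1 n\<close> is the complete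
  homogeneous and \<open>cre (- 1) n\<close> the elementary symmetric function up to the sign
  \<open>(-1)^n\<close>.\<close>

definition cre :: "rat \<Rightarrow> int \<Rightarrow> fock" where
  "cre \<epsilon> n = (if n < 0 then 0 else creation \<epsilon> (nat n) 1)"

definition ann :: "rat \<Rightarrow> int \<Rightarrow> fock \<Rightarrow> fock" where
  "ann \<epsilon> n v = (if n < 0 then 0 else annihilation \<epsilon> (nat n) v)"

text \<open>The creation modes act by multiplication, so their exponential is multiplication by its
  value at the vacuum.\<close>

lemma creation_eq_mult: "creation \<epsilon> n v = creation \<epsilon> n 1 * v"
proof (induction n rule: less_induct)
  case (less n)
  show ?case
  proof (cases "n = 0")
    case False
    have "of_nat n * creation \<epsilon> n v = of_nat n * (creation \<epsilon> n 1 * v)"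
      unfolding creation_rec[of n \<epsilon> v] mult.assoc[symmetric] creation_rec[of n \<epsilon> 1] sum_distrib_right
      using less by (intro sum.cong refl) (simp add: mult.assoc fscale_mult_left)
    then show ?thesis
      using False fock_of_nat_cancel by blast
  qed (simp add: creation_0)
qed

lemma cre_neg [simp]: "n < 0 \<Longrightarrow> cre \<epsilon> n = 0"
  and ann_neg [simp]: "n < 0 \<Longrightarrow> ann \<epsilon> n v = 0"
  by (simp_all add: cre_def ann_def)

lemma cre_0 [simp]: "cre \<epsilon> 0 = 1"
  and ann_0 [simp]: "ann \<epsilon> 0 v = v"
  by (simp_all add: cre_def ann_def creation_0 annihilation_0)

lemma ann_add: "ann \<epsilon> n (u + v) = ann \<epsilon> n u + ann \<epsilon> n v"
  and ann_fscale: "ann \<epsilon> n (fscale a u) = fscale a (ann \<epsilon> n u)"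
  by (simp_all add: ann_def annihilation_add annihilation_fscale)

lemma ann_zero [simp]: "ann \<epsilon> n 0 = 0"
  using ann_add[of \<epsilon> n 0 0] by simp

lemma ann_sum: "ann \<epsilon> n (sum f S) = (\<Sum>x\<in>S. ann \<epsilon> n (f x))"
  by (induction S rule: infinite_finite_induct) (auto simp: ann_add)

text \<open>The bound \<open>N\<close> is free because the terms with \<open>m > n\<close> have
  negative index; recursions at several indices can then share a range.\<close>

lemma cre_rec:
  assumes "n \<le> int N"
  shows "of_int n * cre \<epsilon> n = (\<Sum>m=1..N. fscale \<epsilon> (fvar (m - 1) * cre \<epsilon> (n - int m)))"
proof (cases "n < 0")
  case False
  define k where "k = nat n"
  have "(\<Sum>m=1..k. fscale \<epsilon> (fvar (m - 1) * creation \<epsilon> (k - m) 1))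
      = (\<Sum>m=1..k. fscale \<epsilon> (fvar (m - 1) * cre \<epsilon> (n - int m)))"
    using False by (intro sum.cong refl) (auto simp: cre_def k_def nat_diff_distrib)
  also have "\<dots> = (\<Sum>m=1..N. fscale \<epsilon> (fvar (m - 1) * cre \<epsilon> (n - int m)))"
    using assms False by (intro sum.mono_neutral_left) (auto simp: k_def)
  finally show ?thesis
    using creation_rec[of k \<epsilon> 1] False by (simp add: cre_def k_def)
qed auto

lemma ann_rec:
  assumes "n \<le> int N"
  shows "of_int n * ann \<epsilon> n v = (\<Sum>m=1..N. fscale \<epsilon> (heis (int m) (ann \<epsilon> (n - int m) v)))"
proof (cases "n < 0")
  case True
  then show ?thesis by (simp add: heis_def fderiv_def)
next
  case False
  define k where "k = nat n"
  have "(\<Sum>m=1..k. fscale \<epsilon> (heis (int m) (annihilation \<epsilon> (k - m) v)))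
      = (\<Sum>m=1..k. fscale \<epsilon> (heis (int m) (ann \<epsilon> (n - int m) v)))"
    using False by (intro sum.cong refl) (auto simp: ann_def k_def nat_diff_distrib)
  also have "\<dots> = (\<Sum>m=1..N. fscale \<epsilon> (heis (int m) (ann \<epsilon> (n - int m) v)))"
    using assms False by (intro sum.mono_neutral_left) (auto simp: k_def heis_def fderiv_def)
  finally show ?thesis
    using annihilation_rec[of k \<epsilon> v] False by (simp add: ann_def k_def)
qed

lemma ann_heis_commute:
  "m > 0 \<Longrightarrow> heis (int m) (ann \<epsilon> n v) = ann \<epsilon> n (heis (int m) v)"
  using annihilation_heis_commute by (auto simp: ann_def heis_def fderiv_def)

lemma fscale_of_int: "fscale (of_int n) v = of_int n * v"
  by (simp add: fscale_def)

lemma fock_of_int_cancel: "n \<noteq> 0 \<Longrightarrow> of_int n * u = of_int n * v \<Longrightarrow> u = (v :: fock)"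
  by (simp flip: fscale_of_int)

text \<open>The induction that fits families vanishing at negative indices: in the main case the
  hypothesis covers all smaller integers, negative ones included.\<close>

lemma nat_int_induct [case_names neg nonneg]:
  assumes "\<And>n::int. n < 0 \<Longrightarrow> P n" and "\<And>n. n \<ge> 0 \<Longrightarrow> (\<And>m. m < n \<Longrightarrow> P m) \<Longrightarrow> P n"
  shows "P n"
proof (induction "nat (n + 1)" arbitrary: n rule: less_induct)
  case less
  show ?case
    using assms less by (cases "n < 0") auto
qed

text \<open>The annihilation exponential substitutes \<open>b + \<epsilon> y^(i+1)\<close> for the
  variable \<open>b\<close> with index \<open>i\<close>. In the recursion the extra term comes from
  the commutator with the variable, which is nonzero only at \<open>m = Suc i\<close>.\<close>

lemma ann_fvar_mult:
  "ann \<epsilon> n (fvar i * v) = fvar i * ann \<epsilon> n v + fscale \<epsilon> (ann \<epsilon> (n - int (Suc i)) v)"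
proof (induction n rule: nat_int_induct)
  case (nonneg n)
  show ?case
  proof (cases "n = 0")
    case False
    \<comment> \<open>Large enough that \<open>m = Suc i\<close> always lies in the range and that
      the recursions at \<open>n\<close> and \<open>n - Suc i\<close> both apply.\<close>
    define N where "N = nat n + Suc i"
    have heis: "heis (int m) (fvar i * w) = fvar i * heis (int m) w + (if m = Suc i then of_int (Suc i) * w else 0)"
      if "m > 0" for m w
      using that by (cases "m = Suc i")
        (simp_all add: heis_pos fderiv_fvar_mult fscale_of_nat fock.scale_right_distrib fvar_mult_fscale del: of_nat_Suc)
    have "of_int n * ann \<epsilon> n (fvar i * v)
        = (\<Sum>m=1..N. fscale \<epsilon> (heis (int m) (ann \<epsilon> (n - int m) (fvar i * v))))"
      by (rule ann_rec) (simp add: N_def)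
    also have "\<dots> = (\<Sum>m=1..N. fvar i * fscale \<epsilon> (heis (int m) (ann \<epsilon> (n - int m) v)) +
         (fscale \<epsilon> (fscale \<epsilon> (heis (int m) (ann \<epsilon> (n - int (Suc i) - int m) v))) +
         (if m = Suc i then fscale \<epsilon> (of_int (Suc i) * ann \<epsilon> (n - int m) v) else 0)))"
    proof (rule sum.cong[OF refl])
      fix m assume m: "m \<in> {1..N}"
      then have "ann \<epsilon> (n - int m) (fvar i * v)
          = fvar i * ann \<epsilon> (n - int m) v + fscale \<epsilon> (ann \<epsilon> (n - int (Suc i) - int m) v)"
        using nonneg by (subst nonneg) (auto simp: algebra_simps)
      then show "fscale \<epsilon> (heis (int m) (ann \<epsilon> (n - int m) (fvar i * v)))
         = fvar i * fscale \<epsilon> (heis (int m) (ann \<epsilon> (n - int m) v)) +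
         (fscale \<epsilon> (fscale \<epsilon> (heis (int m) (ann \<epsilon> (n - int (Suc i) - int m) v))) +
         (if m = Suc i then fscale \<epsilon> (of_int (Suc i) * ann \<epsilon> (n - int m) v) else 0))"
        using m by (simp add: heis_add heis_fscale heis fock.scale_right_distrib fscale_mult_right)
    qed
    also have "\<dots> = fvar i * (\<Sum>m=1..N. fscale \<epsilon> (heis (int m) (ann \<epsilon> (n - int m) v))) +
         (fscale \<epsilon> (\<Sum>m=1..N. fscale \<epsilon> (heis (int m) (ann \<epsilon> (n - int (Suc i) - int m) v))) +
          fscale \<epsilon> (of_int (Suc i) * ann \<epsilon> (n - int (Suc i)) v))"
      by (simp only: sum.distrib sum_distrib_left fock.scale_sum_right)
        (auto simp: N_def)
    also have "\<dots> = fvar i * (of_int n * ann \<epsilon> n v) +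
        (fscale \<epsilon> (of_int (n - int (Suc i)) * ann \<epsilon> (n - int (Suc i)) v) +
         fscale \<epsilon> (of_int (Suc i) * ann \<epsilon> (n - int (Suc i)) v))"
      by (subst (1 2) ann_rec[where N = N]) (auto simp: N_def)
    \<comment> \<open>The factor \<open>n - Suc i\<close> from the recursion and
      \<open>Suc i\<close> from the commutator add up to \<open>n\<close>.\<close>
    also have "\<dots> = of_int n * (fvar i * ann \<epsilon> n v + fscale \<epsilon> (ann \<epsilon> (n - int (Suc i)) v))"
      by (simp only: fock.scale_right_distrib[symmetric] distrib_right[symmetric] of_int_add[symmetric]
          fscale_mult_right[symmetric] distrib_left mult.left_commute[of "fvar i"]) simp
    finally show ?thesis
      using False fock_of_int_cancel by blast
  qed simp
qed simp

lemma ann_1: "ann \<epsilon> n 1 = (if n = 0 then 1 else 0)"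
proof (induction n rule: nat_int_induct)
  case (nonneg n)
  have heis: "heis (int m) (if P then 1 else 0) = 0" if "m > 0" for m P
    using that by (auto simp: heis_pos fderiv_def)
  have "ann \<epsilon> n 1 = 0" if "n > 0"
  proof -
    have "fscale \<epsilon> (heis (int m) (ann \<epsilon> (n - int m) 1)) = 0" if "m \<in> {1..nat n}" for m
      using that by (subst nonneg(2)) (auto simp only: heis atLeastAtMost_iff fock.scale_zero_right)
    then have "of_int n * ann \<epsilon> n 1 = of_int n * 0"
      using that by (subst ann_rec[of _ "nat n"]) (simp_all only: mult_zero_right sum.neutral_const cong: sum.cong)
    with that show ?thesis
      using fock_of_int_cancel[of n "ann \<epsilon> n 1" 0] by simp
  qed
  then show ?case
    using nonneg(1) by (cases "n = 0") auto
qed simp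

text \<open>A substitution is a ring homomorphism; by \<open>fock_induct\<close> only the
  generators, treated in \<open>ann_fvar_mult\<close>, have to be checked.\<close>

lemma ann_mult:
  assumes "n \<le> N"
  shows "ann \<epsilon> n (u * v) = (\<Sum>i\<in>{0..N}. ann \<epsilon> i u * ann \<epsilon> (n - i) v)"
  using assms
proof (induction u arbitrary: n rule: fock_induct)
  case (const c)
  have "(\<Sum>i\<in>{0..N}. ann \<epsilon> i 1 * ann \<epsilon> (n - i) v) = ann \<epsilon> n v"
    using const by (cases "N \<ge> 0") (auto simp: ann_1 if_distrib[of "\<lambda>x. x * _"] cong: if_cong)
  then show ?case
    by (simp add: fock_single_0 ann_fscale fscale_mult_left flip: fock.scale_sum_right)
next
  case (fvar k u)
  let ?k = "int (Suc k)"
  have "(\<Sum>i\<in>{0..N}. ann \<epsilon> (i - ?k) u * ann \<epsilon> (n - i) v) = (\<Sum>i\<in>{?k..N}. ann \<epsilon> (i - ?k) u * ann \<epsilon> (n - i) v)"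
    by (intro sum.mono_neutral_right) auto
  also have "\<dots> = (\<Sum>i\<in>{0..N - ?k}. ann \<epsilon> i u * ann \<epsilon> (n - ?k - i) v)"
    by (rule sum.reindex_bij_witness[where i = "\<lambda>i. i + ?k" and j = "\<lambda>i. i - ?k"]) (auto simp: algebra_simps)
  also have "\<dots> = (\<Sum>i\<in>{0..N}. ann \<epsilon> i u * ann \<epsilon> (n - ?k - i) v)"
    using fvar by (intro sum.mono_neutral_left) auto
  also have "\<dots> = ann \<epsilon> (n - ?k) (u * v)"
    using fvar by simp
  finally show ?case
    using fvar by (simp add: mult.assoc ann_fvar_mult distrib_right sum.distrib fscale_mult_left
      sum_distrib_left flip: fock.scale_sum_right)
next
  case (add u u')
  then show ?case by (simp add: distrib_right ann_add sum.distrib)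
qed

text \<open>For equal signs the substitution multiplies \<open>C\<^sub>\<eta>(z)\<close> by the
  geometric series of \<open>y z\<close>.\<close>

lemma ann_cre_same:
  assumes "\<epsilon> * \<eta> = 1" "j \<ge> 0"
  shows "ann \<epsilon> j (cre \<eta> n) = cre \<eta> (n - j)"
  using assms(2)
proof (induction n arbitrary: j rule: nat_int_induct)
  case (nonneg n)
  show ?case
  proof (cases "n = 0")
    case False
    let ?N = "nat n"
    have "of_int n * ann \<epsilon> j (cre \<eta> n) = ann \<epsilon> j (of_int n * cre \<eta> n)"
      by (simp only: fscale_of_int[symmetric] ann_fscale)
    also have "\<dots> = (\<Sum>m=1..?N. fscale \<eta> (ann \<epsilon> j (fvar (m - 1) * cre \<eta> (n - int m))))"
      using nonneg by (subst cre_rec[of _ ?N]) (auto simp: ann_sum ann_fscale)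
    also have "\<dots> = (\<Sum>m=1..?N. fscale \<eta> (fvar (m - 1) * cre \<eta> (n - j - int m))
        + (if int m \<le> j then cre \<eta> (n - j) else 0))"
    proof (rule sum.cong[OF refl])
      fix m assume m: "m \<in> {1..?N}"
      then have "ann \<epsilon> (j - int m) (cre \<eta> (n - int m)) = (if int m \<le> j then cre \<eta> (n - j) else 0)"
        and "ann \<epsilon> j (cre \<eta> (n - int m)) = cre \<eta> (n - j - int m)"
        using nonneg by (auto simp: algebra_simps)
      then show "fscale \<eta> (ann \<epsilon> j (fvar (m - 1) * cre \<eta> (n - int m)))
        = fscale \<eta> (fvar (m - 1) * cre \<eta> (n - j - int m)) + (if int m \<le> j then cre \<eta> (n - j) else 0)"
        using m assms(1) by (simp add: ann_fvar_mult fock.scale_right_distrib mult.commute)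
    qed
    also have "\<dots> = of_int (n - j) * cre \<eta> (n - j) + (\<Sum>m=1..?N. if int m \<le> j then cre \<eta> (n - j) else 0)"
      using nonneg by (subst cre_rec[of _ ?N]) (auto simp: sum.distrib)
    \<comment> \<open>For \<open>j \<le> n\<close> the constant summand occurs \<open>j\<close>
      times; for \<open>j > n\<close> it is 0, its index being negative. Together with the factor
      \<open>n - j\<close> this gives \<open>n\<close>.\<close>
    also have "(\<Sum>m=1..?N. if int m \<le> j then cre \<eta> (n - j) else 0) = of_int j * cre \<eta> (n - j)"
    proof (cases "j \<le> n")
      case True
      then have "(\<Sum>m=1..?N. if int m \<le> j then cre \<eta> (n - j) else 0) = (\<Sum>m=1..nat j. cre \<eta> (n - j))"
        by (intro sum.mono_neutral_cong_right) auto
      then show ?thesis using nonneg by simp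
    qed (auto intro!: sum.neutral)
    finally have "of_int n * ann \<epsilon> j (cre \<eta> n) = of_int n * cre \<eta> (n - j)"
      by (simp add: algebra_simps)
    then show ?thesis
      using False fock_of_int_cancel by blast
  qed (use nonneg in \<open>auto simp: ann_1\<close>)
qed simp

text \<open>For opposite signs the factor is the polynomial \<open>1 - y z\<close>, so only the
  degrees 0 and 1 in \<open>y\<close> survive.\<close>

lemma ann_cre_opp:
  assumes "\<epsilon> * \<eta> = - 1"
  shows "ann \<epsilon> j (cre \<eta> n) = (if j = 0 then cre \<eta> n else 0) - (if j = 1 then cre \<eta> (n - 1) else 0)"
proof (induction n arbitrary: j rule: nat_int_induct)
  case (nonneg n)
  show ?case
  proof (cases "n = 0")
    case False
    let ?N = "nat n"
    let ?S = "\<lambda>k. \<Sum>m=1..?N. fscale \<eta> (fvar (m - 1) * cre \<eta> (n - k - int m))"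
    have "of_int n * ann \<epsilon> j (cre \<eta> n) = ann \<epsilon> j (of_int n * cre \<eta> n)"
      by (simp only: fscale_of_int[symmetric] ann_fscale)
    also have "\<dots> = (\<Sum>m=1..?N. fscale \<eta> (ann \<epsilon> j (fvar (m - 1) * cre \<eta> (n - int m))))"
      using nonneg by (subst cre_rec[of _ ?N]) (auto simp: ann_sum ann_fscale)
    also have "\<dots> = (\<Sum>m=1..?N. (if j = 0 then fscale \<eta> (fvar (m - 1) * cre \<eta> (n - 0 - int m)) else 0)
        - (if j = 1 then fscale \<eta> (fvar (m - 1) * cre \<eta> (n - 1 - int m)) else 0)
        - (if m = nat j then cre \<eta> (n - j) else 0) + (if m = nat (j - 1) then cre \<eta> (n - j) else 0))"
    proof (rule sum.cong[OF refl])
      fix m assume m: "m \<in> {1..?N}"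
      have "ann \<epsilon> (j - int m) (cre \<eta> (n - int m))
          = (if m = nat j then cre \<eta> (n - j) else 0) - (if m = nat (j - 1) then cre \<eta> (n - j) else 0)"
      proof -
        have "j - int m = 0 \<longleftrightarrow> m = nat j" "j - int m = 1 \<longleftrightarrow> m = nat (j - 1)"
          "m = nat j \<Longrightarrow> n - int m = n - j" "m = nat (j - 1) \<Longrightarrow> n - int m - 1 = n - j"
          using m by auto
        then show ?thesis
          using m by (subst nonneg(2)) auto
      qed
      moreover have "ann \<epsilon> j (cre \<eta> (n - int m))
          = (if j = 0 then cre \<eta> (n - int m) else 0) - (if j = 1 then cre \<eta> (n - 1 - int m) else 0)"
        using m by (subst nonneg(2)) (auto simp: algebra_simps)
      ultimately show "fscale \<eta> (ann \<epsilon> j (fvar (m - 1) * cre \<eta> (n - int m)))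
        = (if j = 0 then fscale \<eta> (fvar (m - 1) * cre \<eta> (n - 0 - int m)) else 0)
        - (if j = 1 then fscale \<eta> (fvar (m - 1) * cre \<eta> (n - 1 - int m)) else 0)
        - (if m = nat j then cre \<eta> (n - j) else 0) + (if m = nat (j - 1) then cre \<eta> (n - j) else 0)"
        using m assms by (auto simp: ann_fvar_mult fock.scale_right_distrib mult.commute[of \<eta>])
    qed
    also have "\<dots> = (if j = 0 then ?S 0 else 0) - (if j = 1 then ?S 1 else 0)
      - (if j \<ge> 1 \<and> j \<le> n then cre \<eta> (n - j) else 0) + (if j \<ge> 2 \<and> j \<le> n + 1 then cre \<eta> (n - j) else 0)"
      using nonneg by (simp only: sum.distrib sum_subtractf sum.delta finite_atLeastAtMost) auto
    also have "?S 0 = of_int n * cre \<eta> n"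
      using nonneg by (subst cre_rec[of _ ?N]) auto
    also have "?S 1 = of_int (n - 1) * cre \<eta> (n - 1)"
      using nonneg by (subst cre_rec[of _ ?N]) auto
    \<comment> \<open>At \<open>j = n + 1\<close> the value is \<open>cre \<eta> (- 1) = 0\<close>.
      Hence the last two terms cancel for \<open>j \<ge> 2\<close>, while for \<open>j = 1\<close>
      the first of them raises the factor \<open>n - 1\<close> to \<open>n\<close>.\<close>
    also have "(if j \<ge> 2 \<and> j \<le> n + 1 then cre \<eta> (n - j) else 0) = (if j \<ge> 2 \<and> j \<le> n then cre \<eta> (n - j) else 0)"
      by auto
    finally have "of_int n * ann \<epsilon> j (cre \<eta> n)
      = of_int n * ((if j = 0 then cre \<eta> n else 0) - (if j = 1 then cre \<eta> (n - 1) else 0))"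
      using False nonneg(1) by (auto simp: algebra_simps split: if_splits)
    then show ?thesis
      using False fock_of_int_cancel by blast
  qed (use nonneg in \<open>auto simp: ann_1\<close>)
qed simp

text \<open>The operator form: moving the annihilation exponential past multiplication by
  \<open>C\<^sub>\<eta>(z)\<close> costs the factor \<open>1 - y z\<close>. The bound
  \<open>max j 1\<close> keeps both surviving terms in range.\<close>

lemma ann_cre_opp_mult:
  assumes "\<epsilon> * \<eta> = - 1"
  shows "ann \<epsilon> j (cre \<eta> n * v) = cre \<eta> n * ann \<epsilon> j v - cre \<eta> (n - 1) * ann \<epsilon> (j - 1) v"
proof -
  have "ann \<epsilon> j (cre \<eta> n * v) = (\<Sum>i\<in>{0..max j 1}. ann \<epsilon> i (cre \<eta> n) * ann \<epsilon> (j - i) v)"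
    by (rule ann_mult) simp
  also have "\<dots> = (\<Sum>i\<in>{0..max j 1}. (if i = 0 then cre \<eta> n * ann \<epsilon> j v else 0)
      - (if i = 1 then cre \<eta> (n - 1) * ann \<epsilon> (j - 1) v else 0))"
    by (rule sum.cong) (auto simp: ann_cre_opp[OF assms])
  finally show ?thesis
    by (simp add: sum_subtractf)
qed

text \<open>Here the cost is a geometric series, which may be cut off at any
  \<open>K \<ge> n\<close>.\<close>

lemma ann_cre_same_mult:
  assumes "\<epsilon> * \<eta> = 1" "n \<le> K"
  shows "ann \<epsilon> j (cre \<eta> n * v) = (\<Sum>k\<in>{0..K}. cre \<eta> (n - k) * ann \<epsilon> (j - k) v)"
proof -
  have "ann \<epsilon> j (cre \<eta> n * v) = (\<Sum>k\<in>{0..max j K}. ann \<epsilon> k (cre \<eta> n) * ann \<epsilon> (j - k) v)"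
    by (rule ann_mult) simp
  also have "\<dots> = (\<Sum>k\<in>{0..max j K}. cre \<eta> (n - k) * ann \<epsilon> (j - k) v)"
    using assms by (intro sum.cong refl) (simp add: ann_cre_same)
  also have "\<dots> = (\<Sum>k\<in>{0..K}. cre \<eta> (n - k) * ann \<epsilon> (j - k) v)"
    using assms by (intro sum.mono_neutral_right) auto
  finally show ?thesis .
qed

section \<open>Relations between the vertex operators\<close>

lemma ann_bounded: "\<exists>D\<ge>0. \<forall>j>D. ann \<epsilon> j v = 0"
proof -
  obtain d where "\<And>j. j > d \<Longrightarrow> annihilation \<epsilon> j v = 0"
    using annihilation_eventually_zero by blast
  then show ?thesis
    by (intro exI[of _ "int d"]) (auto simp: ann_def)
qed

text \<open>A finite sum with a free bound, so that the values of the operator on several vectors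
  can be compared termwise.\<close>

lemma vertex_coeff_eq:
  assumes "\<And>j. j > D \<Longrightarrow> ann (- \<epsilon>) j v = 0"
  shows "vertex_coeff \<epsilon> m v = (\<Sum>j\<in>{0..D}. cre \<epsilon> (m + j) * ann (- \<epsilon>) j v)"
proof -
  have eq: "(if 0 \<le> m + int j then creation \<epsilon> (nat (m + int j)) (annihilation (- \<epsilon>) j v) else 0)
      = cre \<epsilon> (m + int j) * ann (- \<epsilon>) (int j) v" for j
    by (auto simp: cre_def ann_def creation_eq_mult[of _ _ "annihilation _ _ _"])
  have "vertex_coeff \<epsilon> m v = (\<Sum>j\<in>{..nat D}. cre \<epsilon> (m + int j) * ann (- \<epsilon>) (int j) v)"
    unfolding vertex_coeff_def eq
    by (intro Sum_any.expand_superset) (use assms in \<open>auto simp flip: not_less\<close>)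
  also have "\<dots> = (\<Sum>j\<in>{0..int (nat D)}. cre \<epsilon> (m + j) * ann (- \<epsilon>) j v)"
    by (rule sum.reindex_bij_witness[where i = nat and j = int]) (auto split: if_splits)
  also have "\<dots> = (\<Sum>j\<in>{0..D}. cre \<epsilon> (m + j) * ann (- \<epsilon>) j v)"
    using assms assms[of 0] by (intro sum.mono_neutral_right) auto
  finally show ?thesis .
qed

lemma vertex_coeff_add: "vertex_coeff \<epsilon> m (u + v) = vertex_coeff \<epsilon> m u + vertex_coeff \<epsilon> m v"
proof -
  obtain D where D: "\<forall>j>D. ann (- \<epsilon>) j u = 0" using ann_bounded by metis
  obtain E where E: "\<forall>j>E. ann (- \<epsilon>) j v = 0" using ann_bounded by metis
  show ?thesis
    using D E by (subst (1 2 3) vertex_coeff_eq[of "max D E"])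
      (auto simp: ann_add distrib_left sum.distrib)
qed

lemma vertex_coeff_fscale: "vertex_coeff \<epsilon> m (fscale a v) = fscale a (vertex_coeff \<epsilon> m v)"
proof -
  obtain D where D: "\<forall>j>D. ann (- \<epsilon>) j v = 0" using ann_bounded by metis
  then show ?thesis
    by (subst (1 2) vertex_coeff_eq[of D]) (auto simp: ann_fscale fscale_mult_right fock.scale_sum_right)
qed

lemma vertex_coeff_zero [simp]: "vertex_coeff \<epsilon> m 0 = 0"
  using vertex_coeff_add[of \<epsilon> m 0 0] by simp

lemma vertex_coeff_uminus: "vertex_coeff \<epsilon> m (- v) = - vertex_coeff \<epsilon> m v"
  using vertex_coeff_add[of \<epsilon> m v "- v"] by (simp add: eq_neg_iff_add_eq_0 add.commute)

lemma vertex_coeff_sum: "vertex_coeff \<epsilon> m (sum f S) = (\<Sum>x\<in>S. vertex_coeff \<epsilon> m (f x))"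
  by (induction S rule: infinite_finite_induct) (auto simp: vertex_coeff_add)

lemma vertex_coeff_1: "vertex_coeff \<epsilon> m 1 = cre \<epsilon> m"
  by (subst vertex_coeff_eq[of 0]) (auto simp: ann_1)

text \<open>Coefficients of \<open>T(z) C(w) = (1 - w/z) C(w) T(z)\<close>.\<close>

lemma vertex_coeff_cre_mult:
  assumes "\<epsilon> * \<epsilon> = 1"
  shows "vertex_coeff \<epsilon> m (cre \<epsilon> n * v)
      = cre \<epsilon> n * vertex_coeff \<epsilon> m v - cre \<epsilon> (n - 1) * vertex_coeff \<epsilon> (m + 1) v"
proof -
  obtain D where D: "D \<ge> 0" "\<And>j. j > D \<Longrightarrow> ann (- \<epsilon>) j v = 0"
    using ann_bounded by metis
  have L: "ann (- \<epsilon>) j (cre \<epsilon> n * v) = cre \<epsilon> n * ann (- \<epsilon>) j v - cre \<epsilon> (n - 1) * ann (- \<epsilon>) (j - 1) v" for j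
    using assms by (intro ann_cre_opp_mult) simp
  have "(\<Sum>j\<in>{0..D + 1}. cre \<epsilon> (m + j) * ann (- \<epsilon>) (j - 1) v)
      = (\<Sum>j\<in>{1..D + 1}. cre \<epsilon> (m + j) * ann (- \<epsilon>) (j - 1) v)"
    by (rule sum.mono_neutral_right) auto
  also have "\<dots> = (\<Sum>j\<in>{0..D}. cre \<epsilon> (m + 1 + j) * ann (- \<epsilon>) j v)"
    by (rule sum.reindex_bij_witness[where i = "\<lambda>j. j + 1" and j = "\<lambda>j. j - 1"]) (auto simp: algebra_simps)
  also have "\<dots> = vertex_coeff \<epsilon> (m + 1) v"
    using D by (intro vertex_coeff_eq[symmetric])
  finally have *: "(\<Sum>j\<in>{0..D + 1}. cre \<epsilon> (m + j) * ann (- \<epsilon>) (j - 1) v) = vertex_coeff \<epsilon> (m + 1) v" .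
  have "vertex_coeff \<epsilon> m (cre \<epsilon> n * v)
      = (\<Sum>j\<in>{0..D + 1}. cre \<epsilon> (m + j) * (cre \<epsilon> n * ann (- \<epsilon>) j v - cre \<epsilon> (n - 1) * ann (- \<epsilon>) (j - 1) v))"
    by (subst vertex_coeff_eq[of "D + 1"]) (simp_all add: L D)
  also have "\<dots> = cre \<epsilon> n * (\<Sum>j\<in>{0..D + 1}. cre \<epsilon> (m + j) * ann (- \<epsilon>) j v)
      - cre \<epsilon> (n - 1) * (\<Sum>j\<in>{0..D + 1}. cre \<epsilon> (m + j) * ann (- \<epsilon>) (j - 1) v)"
    by (simp only: right_diff_distrib sum_subtractf sum_distrib_left mult.left_commute)
  also have "(\<Sum>j\<in>{0..D + 1}. cre \<epsilon> (m + j) * ann (- \<epsilon>) j v) = vertex_coeff \<epsilon> m v"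
    using D by (subst vertex_coeff_eq[of "D + 1"]) auto
  finally show ?thesis
    unfolding * .
qed

text \<open>The same exchange for opposite signs, with \<open>1 / (1 - w/z)\<close> expanded in
  powers of \<open>w/z\<close>.\<close>

lemma vertex_coeff_cre_mult_opp:
  assumes "\<epsilon> * \<epsilon> = 1" "n \<le> K"
  shows "vertex_coeff \<epsilon> m (cre (- \<epsilon>) n * v) = (\<Sum>k\<in>{0..K}. cre (- \<epsilon>) (n - k) * vertex_coeff \<epsilon> (m + k) v)"
proof -
  obtain D where D: "D \<ge> 0" "\<And>j. j > D \<Longrightarrow> ann (- \<epsilon>) j v = 0"
    using ann_bounded by metis
  define E where "E = D + max 0 K"
  have L: "ann (- \<epsilon>) j (cre (- \<epsilon>) n * v) = (\<Sum>k\<in>{0..K}. cre (- \<epsilon>) (n - k) * ann (- \<epsilon>) (j - k) v)" for j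
    using assms by (intro ann_cre_same_mult) auto
  have shift: "(\<Sum>j\<in>{0..E}. cre \<epsilon> (m + j) * ann (- \<epsilon>) (j - k) v) = vertex_coeff \<epsilon> (m + k) v" if "k \<in> {0..K}" for k
  proof -
    have "(\<Sum>j\<in>{0..E}. cre \<epsilon> (m + j) * ann (- \<epsilon>) (j - k) v)
        = (\<Sum>j\<in>{k..D + k}. cre \<epsilon> (m + j) * ann (- \<epsilon>) (j - k) v)"
      using that D by (intro sum.mono_neutral_right) (auto simp: E_def)
    also have "\<dots> = (\<Sum>j\<in>{0..D}. cre \<epsilon> (m + k + j) * ann (- \<epsilon>) j v)"
      by (rule sum.reindex_bij_witness[where i = "\<lambda>j. j + k" and j = "\<lambda>j. j - k"]) (auto simp: algebra_simps)
    also have "\<dots> = vertex_coeff \<epsilon> (m + k) v"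
      using D by (intro vertex_coeff_eq[symmetric])
    finally show ?thesis .
  qed
  have "vertex_coeff \<epsilon> m (cre (- \<epsilon>) n * v)
      = (\<Sum>j\<in>{0..E}. cre \<epsilon> (m + j) * (\<Sum>k\<in>{0..K}. cre (- \<epsilon>) (n - k) * ann (- \<epsilon>) (j - k) v))"
    by (subst vertex_coeff_eq[of E]) (auto simp: L E_def intro!: sum.neutral D)
  also have "\<dots> = (\<Sum>k\<in>{0..K}. cre (- \<epsilon>) (n - k) * (\<Sum>j\<in>{0..E}. cre \<epsilon> (m + j) * ann (- \<epsilon>) (j - k) v))"
    unfolding sum_distrib_left by (subst sum.swap) (simp only: mult.left_commute)
  also have "\<dots> = (\<Sum>k\<in>{0..K}. cre (- \<epsilon>) (n - k) * vertex_coeff \<epsilon> (m + k) v)"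
    using shift by (intro sum.cong refl) simp
  finally show ?thesis .
qed

section \<open>Adjoints with respect to an inner product on the Fock space\<close>

context
  fixes ip :: "fock \<Rightarrow> fock \<Rightarrow> rat"
  assumes ip: "fock_inner_product ip"
begin

lemma ip_add_left: "ip (u + v) w = ip u w + ip v w"
  and ip_fscale_left: "ip (fscale a u) v = a * ip u v"
  and ip_commute: "ip u v = ip v u"
  and ip_pos: "u \<noteq> 0 \<Longrightarrow> ip u u > 0"
  and ip_1_1: "ip 1 1 = 1"
  and ip_heis: "n \<noteq> 0 \<Longrightarrow> ip (heis n u) v = ip u (heis (- n) v)"
  using ip unfolding fock_inner_product_def by blast+

lemma ip_add_right: "ip w (u + v) = ip w u + ip w v"
  and ip_fscale_right: "ip v (fscale a u) = a * ip v u"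
  by (metis ip_commute ip_add_left) (metis ip_commute ip_fscale_left)

lemma ip_zero: "ip 0 v = 0" "ip v 0 = 0"
  using ip_fscale_left[of 0 0 v] ip_fscale_right[of v 0 0] by simp_all

lemma ip_sum: "ip (sum f S) v = (\<Sum>x\<in>S. ip (f x) v)" "ip v (sum f S) = (\<Sum>x\<in>S. ip v (f x))"
  by (induction S rule: infinite_finite_induct) (auto simp: ip_zero ip_add_left ip_add_right)

lemma ip_eqI:
  assumes "\<And>w. ip w u = ip w v"
  shows "u = v"
proof (rule ccontr)
  assume "u \<noteq> v"
  then have "ip (u - v) (u - v) > 0"
    by (intro ip_pos) simp
  moreover have "ip (u - v) (u - v + v) = ip (u - v) v"
    using assms by simp
  ultimately show False
    unfolding ip_add_right by simp
qed

text \<open>The recursions \<open>cre_rec\<close> and \<open>ann_rec\<close> are adjoint to each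
  other, because multiplication by a variable is adjoint to the corresponding
  \<open>heis\<close>.\<close>

lemma ip_cre: "ip (cre \<epsilon> n * u) v = ip u (ann \<epsilon> n v)"
proof (induction n arbitrary: u v rule: nat_int_induct)
  case (nonneg n)
  show ?case
  proof (cases "n = 0")
    case False
    let ?N = "nat n"
    have "of_int n * ip (cre \<epsilon> n * u) v = ip ((of_int n * cre \<epsilon> n) * u) v"
      by (simp only: fscale_mult_left fscale_of_int[symmetric] ip_fscale_left)
    also have "\<dots> = (\<Sum>m=1..?N. \<epsilon> * ip (fvar (m - 1) * (cre \<epsilon> (n - int m) * u)) v)"
      using nonneg(1) by (subst cre_rec[of _ ?N]) (auto simp: sum_distrib_right ip_sum fscale_mult_left ip_fscale_left mult.assoc)
    also have "\<dots> = (\<Sum>m=1..?N. \<epsilon> * ip u (heis (int m) (ann \<epsilon> (n - int m) v)))"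
    proof (rule sum.cong[OF refl])
      fix m assume m: "m \<in> {1..?N}"
      then have "ip (fvar (m - 1) * (cre \<epsilon> (n - int m) * u)) v = ip (cre \<epsilon> (n - int m) * u) (heis (int m) v)"
        using ip_heis[of "- int m" _ v] by (simp add: heis_neg)
      also have "\<dots> = ip u (heis (int m) (ann \<epsilon> (n - int m) v))"
        using m by (simp add: nonneg(2) ann_heis_commute)
      finally show "\<epsilon> * ip (fvar (m - 1) * (cre \<epsilon> (n - int m) * u)) v = \<epsilon> * ip u (heis (int m) (ann \<epsilon> (n - int m) v))"
        by simp
    qed
    also have "\<dots> = ip u (of_int n * ann \<epsilon> n v)"
      using nonneg(1) by (subst ann_rec[of _ ?N]) (auto simp: ip_sum ip_fscale_right)
    finally show ?thesis
      using False by (simp add: ip_fscale_right flip: fscale_of_int)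
  qed simp
qed (simp add: ip_zero)

lemma ip_ann: "ip (ann \<epsilon> n u) v = ip u (cre \<epsilon> n * v)"
  by (metis ip_commute ip_cre)

text \<open>Taking adjoints exchanges the two exponential factors and turns \<open>z\<close> into
  \<open>1/z\<close>, so \<open>C\<^sub>\<epsilon>(z) A(1/z)\<close> becomes the vertex operator of
  sign \<open>- \<epsilon>\<close> in \<open>1/z\<close>.\<close>

lemma ip_vertex_coeff: "ip (vertex_coeff \<epsilon> m u) v = ip u (vertex_coeff (- \<epsilon>) (- m) v)"
proof -
  obtain D where D: "D \<ge> 0" "\<And>j. j > D \<Longrightarrow> ann (- \<epsilon>) j u = 0"
    using ann_bounded by metis
  obtain E where E: "E \<ge> 0" "\<And>j. j > E \<Longrightarrow> ann \<epsilon> j v = 0"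
    using ann_bounded by metis
  \<comment> \<open>Beyond \<open>F\<close> both annihilation families vanish even after a shift by
    \<open>m\<close>, so the substitution of \<open>m + j\<close> for \<open>j\<close> loses no
    term.\<close>
  define F where "F = D + E + \<bar>m\<bar>"
  have "ip (vertex_coeff \<epsilon> m u) v = (\<Sum>j\<in>{0..F}. ip (ann (- \<epsilon>) j u) (ann \<epsilon> (m + j) v))"
    using D E by (subst vertex_coeff_eq[of F]) (auto simp: ip_sum ip_cre F_def)
  also have "\<dots> = (\<Sum>j\<in>{max 0 (- m)..F + min 0 (- m)}. ip (ann (- \<epsilon>) j u) (ann \<epsilon> (m + j) v))"
    using D E by (intro sum.mono_neutral_right) (auto simp: F_def ip_zero min_def max_def split: if_splits)
  also have "\<dots> = (\<Sum>j\<in>{max 0 m..F + min 0 m}. ip (ann (- \<epsilon>) (- m + j) u) (ann \<epsilon> j v))"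
    by (rule sum.reindex_bij_witness[where i = "\<lambda>j. j - m" and j = "\<lambda>j. m + j"]) (auto simp: min_def max_def split: if_splits)
  also have "\<dots> = (\<Sum>j\<in>{0..F}. ip (ann (- \<epsilon>) (- m + j) u) (ann \<epsilon> j v))"
    using D E by (intro sum.mono_neutral_left) (auto simp: F_def ip_zero min_def max_def split: if_splits)
  also have "\<dots> = ip u (vertex_coeff (- \<epsilon>) (- m) v)"
    using D E by (subst vertex_coeff_eq[of F]) (auto simp: ip_sum ip_ann F_def)
  finally show ?thesis .
qed

end

text \<open>Adjoint to the commutativity of multiplication; the existing form
  \<open>zee_form\<close> allows the transfer.\<close>

lemma ann_commute: "ann \<epsilon> m (ann \<eta> n v) = ann \<eta> n (ann \<epsilon> m v)"
  by (rule ip_eqI[OF fock_inner_product_exists])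
    (simp add: mult.left_commute flip: ip_cre[OF fock_inner_product_exists])

text \<open>The product \<open>T(z) T(w)\<close> is \<open>1 - w/z\<close> times the normally
  ordered product, whose coefficients \<open>X\<close> are symmetric. Hence
  \<open>T_m T_n = X m n - X (m + 1) (n - 1)\<close>, and the exchange on the right only swaps the
  two terms.\<close>

lemma vertex_coeff_anticommute:
  assumes "\<epsilon> * \<epsilon> = 1"
  shows "vertex_coeff \<epsilon> m (vertex_coeff \<epsilon> n v) = - vertex_coeff \<epsilon> (n - 1) (vertex_coeff \<epsilon> (m + 1) v)"
proof -
  obtain D where D: "D \<ge> 0" "\<And>j. j > D \<Longrightarrow> ann (- \<epsilon>) j v = 0"
    using ann_bounded by metis
  define X where "X m n = (\<Sum>i\<in>{0..D}. \<Sum>j\<in>{0..D}.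
      cre \<epsilon> (m + j) * cre \<epsilon> (n + i) * ann (- \<epsilon>) j (ann (- \<epsilon>) i v))" for m n
  have X_commute: "X m n = X n m" for m n
    unfolding X_def by (subst sum.swap) (simp add: ann_commute mult.commute)
  have "vertex_coeff \<epsilon> m (ann (- \<epsilon>) i v) = (\<Sum>j\<in>{0..D}. cre \<epsilon> (m + j) * ann (- \<epsilon>) j (ann (- \<epsilon>) i v))" for m i
    using D by (intro vertex_coeff_eq) (subst ann_commute, auto)
  then have T: "(\<Sum>i\<in>{0..D}. cre \<epsilon> (n + i) * vertex_coeff \<epsilon> m (ann (- \<epsilon>) i v)) = X m n" for m n
    by (simp add: X_def sum_distrib_left mult.left_commute mult.assoc)
  have TT: "vertex_coeff \<epsilon> m (vertex_coeff \<epsilon> n v) = X m n - X (m + 1) (n - 1)" for m n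
  proof -
    have "vertex_coeff \<epsilon> m (vertex_coeff \<epsilon> n v)
        = (\<Sum>i\<in>{0..D}. vertex_coeff \<epsilon> m (cre \<epsilon> (n + i) * ann (- \<epsilon>) i v))"
      using D by (simp add: vertex_coeff_eq[of D _ v] vertex_coeff_sum)
    also have "\<dots> = (\<Sum>i\<in>{0..D}. cre \<epsilon> (n + i) * vertex_coeff \<epsilon> m (ann (- \<epsilon>) i v))
        - (\<Sum>i\<in>{0..D}. cre \<epsilon> (n - 1 + i) * vertex_coeff \<epsilon> (m + 1) (ann (- \<epsilon>) i v))"
      by (simp only: vertex_coeff_cre_mult[OF assms] sum_subtractf)
        (simp add: algebra_simps)
    finally show ?thesis unfolding T .
  qed
  show ?thesis
    by (simp add: TT X_commute[of m n] X_commute[of "m + 1"])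
qed

text \<open>The coefficients of \<open>C\<^bsub>\<epsilon>\<^esub>(z) C\<^bsub>-\<epsilon>\<^esub>(z) = 1\<close>.\<close>

lemma cre_convolution:
  assumes "L \<le> - x" "y \<le> U"
  shows "(\<Sum>k\<in>{L..U}. cre \<epsilon> (x + k) * cre (- \<epsilon>) (y - k)) = (if x + y = 0 then 1 else 0)"
proof -
  define F where "F n = (\<Sum>k\<in>{0..n}. cre \<epsilon> k * cre (- \<epsilon>) (n - k))" for n
  define n where "n = x + y"
  have "(\<Sum>k\<in>{L..U}. cre \<epsilon> (x + k) * cre (- \<epsilon>) (y - k)) = (\<Sum>k\<in>{-x..y}. cre \<epsilon> (x + k) * cre (- \<epsilon>) (y - k))"
    using assms by (intro sum.mono_neutral_right) auto
  also have "\<dots> = F n"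
    unfolding F_def n_def
    by (rule sum.reindex_bij_witness[where i = "\<lambda>j. j - x" and j = "\<lambda>j. x + j"]) auto
  also have "F n = (if n = 0 then 1 else 0)"
  proof (cases "n > 0")
    case True
    let ?N = "nat n"
    \<comment> \<open>With \<open>n = k + (n - k)\<close>, \<open>cre_rec\<close> applies to each
      factor; the two resulting sums differ only in the sign of \<open>\<epsilon>\<close> and
      cancel.\<close>
    have "of_int n * F n = (\<Sum>k\<in>{0..n}. (of_int k * cre \<epsilon> k) * cre (- \<epsilon>) (n - k))
        + (\<Sum>k\<in>{0..n}. cre \<epsilon> k * (of_int (n - k) * cre (- \<epsilon>) (n - k)))"
      unfolding F_def sum_distrib_left sum.distrib[symmetric]
      by (rule sum.cong) (simp_all add: algebra_simps)
    also have "(\<Sum>k\<in>{0..n}. (of_int k * cre \<epsilon> k) * cre (- \<epsilon>) (n - k))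
        = (\<Sum>k\<in>{0..n}. \<Sum>m=1..?N. fscale \<epsilon> (fvar (m - 1) * (cre \<epsilon> (k - int m) * cre (- \<epsilon>) (n - k))))"
      by (intro sum.cong refl, subst cre_rec[of _ ?N])
        (auto simp: sum_distrib_right fscale_mult_left mult.assoc)
    also have "\<dots> = (\<Sum>m=1..?N. fscale \<epsilon> (fvar (m - 1) * (\<Sum>k\<in>{0..n}. cre \<epsilon> (k - int m) * cre (- \<epsilon>) (n - k))))"
      by (subst sum.swap) (simp add: sum_distrib_left fock.scale_sum_right)
    also have "\<dots> = (\<Sum>m=1..?N. fscale \<epsilon> (fvar (m - 1) * F (n - int m)))"
    proof (intro sum.cong refl)
      fix m assume m: "m \<in> {1..?N}"
      have "(\<Sum>k\<in>{0..n}. cre \<epsilon> (k - int m) * cre (- \<epsilon>) (n - k)) = (\<Sum>k\<in>{int m..n}. cre \<epsilon> (k - int m) * cre (- \<epsilon>) (n - k))"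
        by (intro sum.mono_neutral_right) auto
      also have "\<dots> = F (n - int m)"
        unfolding F_def by (rule sum.reindex_bij_witness[where i = "\<lambda>k. k + int m" and j = "\<lambda>k. k - int m"])
            (auto simp: algebra_simps)
      finally show "fscale \<epsilon> (fvar (m - 1) * (\<Sum>k\<in>{0..n}. cre \<epsilon> (k - int m) * cre (- \<epsilon>) (n - k)))
        = fscale \<epsilon> (fvar (m - 1) * F (n - int m))" by simp
    qed
    also have "(\<Sum>k\<in>{0..n}. cre \<epsilon> k * (of_int (n - k) * cre (- \<epsilon>) (n - k)))
        = (\<Sum>k\<in>{0..n}. \<Sum>m=1..?N. fscale (- \<epsilon>) (fvar (m - 1) * (cre \<epsilon> k * cre (- \<epsilon>) (n - k - int m))))"
      by (intro sum.cong refl, subst cre_rec[of _ ?N])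
        (auto simp: sum_distrib_left fscale_mult_right mult.left_commute)
    also have "\<dots> = (\<Sum>m=1..?N. fscale (- \<epsilon>) (fvar (m - 1) * (\<Sum>k\<in>{0..n}. cre \<epsilon> k * cre (- \<epsilon>) (n - k - int m))))"
      by (subst sum.swap) (simp add: sum_distrib_left fock.scale_sum_right)
    also have "\<dots> = (\<Sum>m=1..?N. fscale (- \<epsilon>) (fvar (m - 1) * F (n - int m)))"
    proof (intro sum.cong refl)
      fix m assume m: "m \<in> {1..?N}"
      have "(\<Sum>k\<in>{0..n}. cre \<epsilon> k * cre (- \<epsilon>) (n - k - int m)) = F (n - int m)"
        unfolding F_def by (intro sum.mono_neutral_cong_right) (auto simp: algebra_simps)
      then show "fscale (- \<epsilon>) (fvar (m - 1) * (\<Sum>k\<in>{0..n}. cre \<epsilon> k * cre (- \<epsilon>) (n - k - int m)))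
        = fscale (- \<epsilon>) (fvar (m - 1) * F (n - int m))" by simp
    qed
    finally have "of_int n * F n = of_int n * 0"
      by (simp add: sum_negf)
    then show ?thesis
      using True fock_of_int_cancel[of n "F n" 0] by simp
  qed (auto simp: F_def not_less)
  finally show ?thesis by (simp add: n_def)
qed

text \<open>The adjoint of \<open>cre_convolution\<close>, transferred by nondegeneracy of the
  form.\<close>

lemma ann_convolution:
  assumes "n \<le> D"
  shows "(\<Sum>j\<in>{0..D}. ann \<epsilon> j (ann (- \<epsilon>) (n - j) v)) = (if n = 0 then v else 0)"
proof (rule ip_eqI[OF fock_inner_product_exists])
  fix w
  have "zee_form w (\<Sum>j\<in>{0..D}. ann \<epsilon> j (ann (- \<epsilon>) (n - j) v))
      = zee_form ((\<Sum>j\<in>{0..D}. cre \<epsilon> (0 + j) * cre (- \<epsilon>) (n - j)) * w) v"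
    by (simp add: ip_sum[OF fock_inner_product_exists] ip_cre[OF fock_inner_product_exists, symmetric]
        sum_distrib_right mult.assoc mult.left_commute[of "cre \<epsilon> _"])
  also have "\<dots> = zee_form w (if n = 0 then v else 0)"
    using assms by (subst cre_convolution) (auto simp: ip_zero[OF fock_inner_product_exists])
  finally show "zee_form w (\<Sum>j\<in>{0..D}. ann \<epsilon> j (ann (- \<epsilon>) (n - j) v)) = zee_form w (if n = 0 then v else 0)" .
qed

text \<open>Both products are one normally ordered product \<open>Y\<close> times expansions of
  geometric series in opposite directions, which add up to the formal delta function of
  \<open>w/z\<close>. At \<open>z = w\<close> the creation factors cancel and so do the annihilation
  factors, leaving the identity.\<close>

lemma vertex_coeff_clifford:
  assumes "\<epsilon> * \<epsilon> = 1"
  shows "vertex_coeff \<epsilon> a (vertex_coeff (- \<epsilon>) b v) + vertex_coeff (- \<epsilon>) (b + 1) (vertex_coeff \<epsilon> (a - 1) v)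
      = (if a + b = 0 then v else 0)"
proof -
  obtain D\<^sub>1 where D1: "D\<^sub>1 \<ge> 0" "\<And>j. j > D\<^sub>1 \<Longrightarrow> ann (- \<epsilon>) j v = 0"
    using ann_bounded by metis
  obtain D\<^sub>2 where D2: "D\<^sub>2 \<ge> 0" "\<And>j. j > D\<^sub>2 \<Longrightarrow> ann \<epsilon> j v = 0"
    using ann_bounded by metis
  \<comment> \<open>Besides bounding the annihilation terms, \<open>D\<close> is at least
    \<open>- a - b - j\<close> for every \<open>j \<ge> 0\<close>, the index forced below.\<close>
  define D where "D = max D\<^sub>1 D\<^sub>2 + \<bar>a\<bar> + \<bar>b\<bar>"
  have D: "D \<ge> 0" "ann (- \<epsilon>) j v = 0" "ann \<epsilon> j v = 0" if "j > D" for j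
    using that D1 D2 by (auto simp: D_def)
  have "D \<ge> 0" using D1 by (simp add: D_def)
  \<comment> \<open>No creation index exceeds \<open>K\<close>, so both geometric series may be cut
    off there.\<close>
  define K where "K = D + \<bar>a\<bar> + \<bar>b\<bar> + 2"
  define Y where "Y a b = (\<Sum>i\<in>{0..D}. \<Sum>j\<in>{0..D}.
      cre \<epsilon> (a + j) * cre (- \<epsilon>) (b + i) * ann (- \<epsilon>) j (ann \<epsilon> i v))" for a b
  have T: "vertex_coeff \<epsilon> m (ann \<epsilon> i v) = (\<Sum>j\<in>{0..D}. cre \<epsilon> (m + j) * ann (- \<epsilon>) j (ann \<epsilon> i v))" for m i
    using D by (intro vertex_coeff_eq) (subst ann_commute, auto)
  have T': "vertex_coeff (- \<epsilon>) m (ann (- \<epsilon>) i v) = (\<Sum>j\<in>{0..D}. cre (- \<epsilon>) (m + j) * ann \<epsilon> j (ann (- \<epsilon>) i v))" for m i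
    using D by (subst vertex_coeff_eq[of D]) (subst ann_commute, auto)
  have "vertex_coeff \<epsilon> a (vertex_coeff (- \<epsilon>) b v)
      = (\<Sum>i\<in>{0..D}. vertex_coeff \<epsilon> a (cre (- \<epsilon>) (b + i) * ann \<epsilon> i v))"
    using D by (simp add: vertex_coeff_eq[of D _ v] vertex_coeff_sum)
  also have "\<dots> = (\<Sum>i\<in>{0..D}. \<Sum>k\<in>{0..K}. cre (- \<epsilon>) (b + i - k) * vertex_coeff \<epsilon> (a + k) (ann \<epsilon> i v))"
    by (intro sum.cong refl vertex_coeff_cre_mult_opp assms) (auto simp: K_def)
  also have "\<dots> = (\<Sum>k\<in>{0..K}. Y (a + k) (b - k))"
    unfolding T Y_def
    by (subst sum.swap) (simp add: sum_distrib_left algebra_simps)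
  finally have 1: "vertex_coeff \<epsilon> a (vertex_coeff (- \<epsilon>) b v) = (\<Sum>k\<in>{0..K}. Y (a + k) (b - k))" .
  have "vertex_coeff (- \<epsilon>) (b + 1) (vertex_coeff \<epsilon> (a - 1) v)
      = (\<Sum>i\<in>{0..D}. vertex_coeff (- \<epsilon>) (b + 1) (cre (- (- \<epsilon>)) (a - 1 + i) * ann (- \<epsilon>) i v))"
    using D by (simp add: vertex_coeff_eq[of D _ v] vertex_coeff_sum)
  also have "\<dots> = (\<Sum>i\<in>{0..D}. \<Sum>k\<in>{0..K}. cre (- (- \<epsilon>)) (a - 1 + i - k) * vertex_coeff (- \<epsilon>) (b + 1 + k) (ann (- \<epsilon>) i v))"
    using assms by (intro sum.cong refl vertex_coeff_cre_mult_opp) (auto simp: K_def)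
  also have "\<dots> = (\<Sum>k\<in>{0..K}. \<Sum>i\<in>{0..D}. \<Sum>j\<in>{0..D}. cre \<epsilon> (a - 1 - k + i) * cre (- \<epsilon>) (b + 1 + k + j) * ann \<epsilon> j (ann (- \<epsilon>) i v))"
    unfolding T'
    by (subst sum.swap) (simp add: sum_distrib_left algebra_simps)
  also have "\<dots> = (\<Sum>k\<in>{0..K}. Y (a - 1 - k) (b + 1 + k))"
    unfolding Y_def by (subst (2) sum.swap) (simp add: ann_commute[of \<epsilon>])
  also have "\<dots> = (\<Sum>k\<in>{- 1 - K..- 1}. Y (a + k) (b - k))"
    by (rule sum.reindex_bij_witness[where i = "\<lambda>k. - 1 - k" and j = "\<lambda>k. - 1 - k"]) (auto simp: algebra_simps)
  finally have 2: "vertex_coeff (- \<epsilon>) (b + 1) (vertex_coeff \<epsilon> (a - 1) v) = (\<Sum>k\<in>{- 1 - K..- 1}. Y (a + k) (b - k))" .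
  \<comment> \<open>The first product contributes the nonnegative \<open>k\<close> and the second
    the negative ones: together all powers of \<open>w/z\<close>.\<close>
  have "{- 1 - K..K} = {0..K} \<union> {- 1 - K..- 1}" "{0..K} \<inter> {- 1 - K..- 1} = {}"
    using \<open>D \<ge> 0\<close> by (auto simp: K_def)
  then have "(\<Sum>k\<in>{0..K}. Y (a + k) (b - k)) + (\<Sum>k\<in>{- 1 - K..- 1}. Y (a + k) (b - k)) = (\<Sum>k\<in>{- 1 - K..K}. Y (a + k) (b - k))"
    by (simp add: sum.union_disjoint)
  also have "\<dots> = (\<Sum>i\<in>{0..D}. \<Sum>j\<in>{0..D}. (\<Sum>k\<in>{- 1 - K..K}. cre \<epsilon> (a + j + k) * cre (- \<epsilon>) (b + i - k)) * ann (- \<epsilon>) j (ann \<epsilon> i v))"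
    unfolding Y_def
    by (subst sum.swap, rule sum.cong[OF refl], subst sum.swap, unfold sum_distrib_right)
      (simp add: algebra_simps)
  also have "\<dots> = (\<Sum>i\<in>{0..D}. \<Sum>j\<in>{0..D}. if i = - a - b - j then ann (- \<epsilon>) j (ann \<epsilon> i v) else 0)"
    by (intro sum.cong refl, subst cre_convolution) (auto simp: K_def)
  also have "\<dots> = (\<Sum>j\<in>{0..D}. ann (- \<epsilon>) j (ann (- (- \<epsilon>)) (- a - b - j) v))"
    by (subst sum.swap, intro sum.cong refl) (auto simp: D)
  also have "\<dots> = (if a + b = 0 then v else 0)"
    using D1 by (subst ann_convolution) (auto simp: D_def)
  finally show ?thesis
    unfolding 1 2 .
qed

section \<open>Adding columns and straightening\<close>

definition vertex_word :: "rat \<Rightarrow> int list \<Rightarrow> fock \<Rightarrow> fock" where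
  "vertex_word \<epsilon> = foldr (vertex_coeff \<epsilon>)"

lemma vertex_word_simps [simp]:
  "vertex_word \<epsilon> [] v = v"
  "vertex_word \<epsilon> (k # \<kappa>) v = vertex_coeff \<epsilon> k (vertex_word \<epsilon> \<kappa> v)"
  by (simp_all add: vertex_word_def)

lemma vertex_word_append: "vertex_word \<epsilon> (\<kappa> @ \<kappa>') v = vertex_word \<epsilon> \<kappa> (vertex_word \<epsilon> \<kappa>' v)"
  by (simp add: vertex_word_def)

lemma foldr_vS: "foldr (\<lambda>n. vS (- int n)) \<mu> v = vertex_word 1 (map int \<mu>) v"
  and foldr_vS_star: "foldr (\<lambda>n. vS_star (int n)) \<mu> v = vertex_word (- 1) (map int \<mu>) v"
  by (simp_all add: vertex_word_def foldr_map vS_def vS_star_def o_def)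

lemma minus_one_power_cases: "(- 1) ^ n * v = (if even n then v else - v)" for v :: "'a :: ring_1"
  by simp

lemma vertex_word_sign: "vertex_word \<epsilon> \<kappa> ((- 1) ^ n * v) = (- 1) ^ n * vertex_word \<epsilon> \<kappa> v"
  by (induction \<kappa>) (auto simp: minus_one_power_cases vertex_coeff_uminus)

lemma vertex_word_zero [simp]: "vertex_word \<epsilon> \<kappa> 0 = 0"
  by (induction \<kappa>) auto

text \<open>Each passage by the Clifford relation costs a sign, raises the passed letter by 1 and
  lowers the moving index by 1. At letter \<open>i\<close> the moving index is \<open>k - i\<close>,
  so the hypothesis says that no delta term ever appears.\<close>

lemma vertex_coeff_opp_vertex_word:
  assumes "\<epsilon> * \<epsilon> = 1" and "\<And>i. i < length \<kappa> \<Longrightarrow> \<kappa> ! i \<noteq> int i - k"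
  shows "vertex_coeff (- \<epsilon>) k (vertex_word \<epsilon> \<kappa> 1)
    = (- 1) ^ length \<kappa> * vertex_word \<epsilon> (map (\<lambda>x. x + 1) \<kappa>) (cre (- \<epsilon>) (k - int (length \<kappa>)))"
  using assms(2)
proof (induction \<kappa> arbitrary: k)
  case Nil
  then show ?case by (simp add: vertex_coeff_1)
next
  case (Cons b \<kappa>)
  have IH: "vertex_coeff (- \<epsilon>) (k - 1) (vertex_word \<epsilon> \<kappa> 1)
      = (- 1) ^ length \<kappa> * vertex_word \<epsilon> (map (\<lambda>x. x + 1) \<kappa>) (cre (- \<epsilon>) (k - 1 - int (length \<kappa>)))"
    using Cons.prems[of "Suc _"] by (intro Cons.IH) (fastforce simp: algebra_simps)
  have "k + b \<noteq> 0"
    using Cons.prems[of 0] by auto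
  then have "vertex_coeff (- \<epsilon>) k (vertex_coeff \<epsilon> b (vertex_word \<epsilon> \<kappa> 1))
      = - vertex_coeff \<epsilon> (b + 1) (vertex_coeff (- \<epsilon>) (k - 1) (vertex_word \<epsilon> \<kappa> 1))"
    using vertex_coeff_clifford[of "- \<epsilon>" k b] assms(1) by (simp add: eq_neg_iff_add_eq_0)
  also have "\<dots> = - ((- 1) ^ length \<kappa> * vertex_coeff \<epsilon> (b + 1)
      (vertex_word \<epsilon> (map (\<lambda>x. x + 1) \<kappa>) (cre (- \<epsilon>) (k - 1 - int (length \<kappa>)))))"
    unfolding IH by (simp add: minus_one_power_cases vertex_coeff_uminus)
  finally show ?case
    by (simp add: algebra_simps)
qed

text \<open>Since the coefficient 0 fixes the vacuum, the Clifford relation with indices 1 and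
  \<open>n\<close> prepends one letter 1: the case of a single column.\<close>

lemma cre_opp_eq_vertex_word:
  assumes "\<epsilon> * \<epsilon> = 1"
  shows "cre (- \<epsilon>) (int n) = (- 1) ^ n * vertex_word \<epsilon> (replicate n 1) 1"
proof (induction n)
  case (Suc n)
  have "vertex_coeff \<epsilon> 1 (cre (- \<epsilon>) (int n)) + cre (- \<epsilon>) (int (Suc n)) = 0"
    using vertex_coeff_clifford[OF assms, of 1 "int n" 1] by (simp add: vertex_coeff_1 add.commute)
  then have "cre (- \<epsilon>) (int (Suc n)) = - vertex_coeff \<epsilon> 1 (cre (- \<epsilon>) (int n))"
    by (simp add: eq_neg_iff_add_eq_0 add.commute)
  then show ?case
    by (simp add: Suc minus_one_power_cases vertex_coeff_uminus)
qed simp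

text \<open>The bound \<open>length l \<le> k\<close> excludes delta terms. Passing the word puts
  one cell into each existing row, and the remaining
  \<open>cre (- \<epsilon>) (k - length l)\<close> supplies the cells below.\<close>

lemma vertex_coeff_opp_adds_column:
  assumes "\<epsilon> * \<epsilon> = 1" "length l \<le> k"
  shows "vertex_coeff (- \<epsilon>) (int k) (vertex_word \<epsilon> (map int l) 1)
    = (- 1) ^ k * vertex_word \<epsilon> (map int (map Suc l @ replicate (k - length l) 1)) 1"
proof -
  have "vertex_coeff (- \<epsilon>) (int k) (vertex_word \<epsilon> (map int l) 1)
      = (- 1) ^ length l * vertex_word \<epsilon> (map (\<lambda>x. x + 1) (map int l)) (cre (- \<epsilon>) (int (k - length l)))"
    using assms by (subst vertex_coeff_opp_vertex_word) (auto simp: of_nat_diff)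
  also have "\<dots> = (- 1) ^ (length l + (k - length l)) *
      vertex_word \<epsilon> (map (\<lambda>x. x + 1) (map int l) @ replicate (k - length l) 1) 1"
    by (simp only: cre_opp_eq_vertex_word[OF assms(1)] vertex_word_sign vertex_word_append power_add mult.assoc)
  also have "map (\<lambda>x. x + 1) (map int l) @ replicate (k - length l) 1 = map int (map Suc l @ replicate (k - length l) 1)"
    by simp
  finally show ?thesis
    using assms by simp
qed

section \<open>Conjugate partitions\<close>

lemma length_conj_partition: "length (conj_partition l) = (if l = [] then 0 else hd l)"
  by (simp add: conj_partition_def)

lemma nth_conj_partition:
  "j < length (conj_partition l) \<Longrightarrow> conj_partition l ! j = card {i. i < length l \<and> j < l ! i}"
  by (simp add: conj_partition_def)

text \<open>A new longest row on top adds a cell to each column and opens columns of height 1. In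
  the conjugate diagram this is the column added by
  \<open>vertex_coeff_opp_adds_column\<close>.\<close>

lemma conj_partition_Cons:
  assumes "sorted_wrt (\<ge>) (k # l)"
  shows "conj_partition (k # l) = map Suc (conj_partition l) @ replicate (k - length (conj_partition l)) 1"
    and "length (conj_partition l) \<le> k"
proof -
  show le: "length (conj_partition l) \<le> k"
    using assms by (cases l) (auto simp: length_conj_partition)
  show "conj_partition (k # l) = map Suc (conj_partition l) @ replicate (k - length (conj_partition l)) 1"
  proof (rule nth_equalityI)
    fix j assume "j < length (conj_partition (k # l))"
    then have j: "j < k"
      by (simp add: length_conj_partition)
    have "{i. i < length (k # l) \<and> j < (k # l) ! i} = insert 0 (Suc ` {i. i < length l \<and> j < l ! i})"
      using j by (auto simp: image_iff less_Suc_eq_0_disj)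
    then have c: "conj_partition (k # l) ! j = Suc (card {i. i < length l \<and> j < l ! i})"
      using j by (simp add: nth_conj_partition length_conj_partition card_image)
    show "conj_partition (k # l) ! j = (map Suc (conj_partition l) @ replicate (k - length (conj_partition l)) 1) ! j"
    proof (cases "j < length (conj_partition l)")
      case True
      then show ?thesis by (simp add: c nth_append nth_conj_partition)
    next
      case False
      have "l ! i \<le> j" if "i < length l" for i
      proof -
        have "l ! i \<le> hd l"
          using assms that by (cases l; cases i) auto
        then show ?thesis
          using False that by (auto simp: length_conj_partition split: if_splits)
      qed
      then have "{i. i < length l \<and> j < l ! i} = {}"
        by (fastforce simp: not_less)
      then show ?thesis using False j by (simp only: c) (simp add: nth_append)
    qed
  qed (use le in \<open>simp add: length_conj_partition[of "k # l"]\<close>)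
qed

text \<open>Read from the right, each letter of \<open>l\<close> adds a column to the conjugate of
  the letters after it.\<close>

lemma vertex_word_conj:
  assumes "\<epsilon> * \<epsilon> = 1" "sorted_wrt (\<ge>) l"
  shows "vertex_word (- \<epsilon>) (map int l) 1 = (- 1) ^ sum_list l * vertex_word \<epsilon> (map int (conj_partition l)) 1"
  using assms(2)
proof (induction l)
  case (Cons k l)
  have "vertex_word (- \<epsilon>) (map int (k # l)) 1
      = (- 1) ^ sum_list l * vertex_coeff (- \<epsilon>) (int k) (vertex_word \<epsilon> (map int (conj_partition l)) 1)"
    using Cons by (simp add: minus_one_power_cases vertex_coeff_uminus)
  then show ?case
    using vertex_coeff_opp_adds_column[OF assms(1) conj_partition_Cons(2)[OF Cons.prems]]
    by (simp only: conj_partition_Cons(1)[OF Cons.prems]) (simp add: power_add mult_ac)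
qed (simp add: conj_partition_def)

lemma sum_list_conj_partition: "sorted_wrt (\<ge>) l \<Longrightarrow> sum_list (conj_partition l) = sum_list l"
proof (induction l)
  case (Cons k l)
  have "sum_list (map Suc xs) = sum_list xs + length xs" for xs
    by (induction xs) auto
  with Cons conj_partition_Cons[OF Cons.prems] show ?case
    by (simp add: sum_list_replicate)
qed (simp add: conj_partition_def)

section \<open>Straightening by sorting \<open>\<kappa> + \<delta>\<close>\<close>

fun shifted_word :: "rat \<Rightarrow> int list \<Rightarrow> fock" where
  "shifted_word \<epsilon> [] = 1"
| "shifted_word \<epsilon> (x # xs) = vertex_coeff \<epsilon> (x - int (length xs)) (shifted_word \<epsilon> xs)"

lemma delta_Suc: "delta (Suc n) = int n # delta n"
  unfolding delta_def by (simp add: upt_conv_Cons map_Suc_upt[symmetric] del: upt_Suc)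

lemma length_delta [simp]: "length (delta n) = n"
  by (simp add: delta_def)

lemma shifted_word_eq: "shifted_word \<epsilon> a = vertex_word \<epsilon> (map2 (-) a (delta (length a))) 1"
  by (induction a) (auto simp: delta_Suc)

lemma length_delta_shift [simp]: "length (delta_shift \<kappa>) = length \<kappa>"
  by (simp add: delta_shift_def)

lemma delta_shift_minus_delta: "map2 (-) (delta_shift \<kappa>) (delta (length \<kappa>)) = \<kappa>"
  by (rule nth_equalityI) (auto simp: delta_shift_def)

lemma vertex_word_eq_shifted_word: "vertex_word \<epsilon> \<kappa> 1 = shifted_word \<epsilon> (delta_shift \<kappa>)"
  by (simp add: shifted_word_eq delta_shift_minus_delta)

text \<open>The reason for the coordinates \<open>\<kappa> + \<delta>\<close>: in them the quadratic
  relation is plain antisymmetry.\<close>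

lemma shifted_word_swap:
  assumes "\<epsilon> * \<epsilon> = 1"
  shows "shifted_word \<epsilon> (x # y # xs) = - shifted_word \<epsilon> (y # x # xs)"
  using vertex_coeff_anticommute[OF assms, of "x - int (length xs) - 1" "y - int (length xs)"]
  by (simp add: algebra_simps)

lemma shifted_word_repeat:
  assumes "\<epsilon> * \<epsilon> = 1"
  shows "shifted_word \<epsilon> (x # x # xs) = 0"
proof -
  have "of_nat 2 * shifted_word \<epsilon> (x # x # xs) = of_nat 2 * 0"
    using shifted_word_swap[OF assms, of x x xs] by (simp add: mult_2 eq_neg_iff_add_eq_0 del: shifted_word.simps)
  then show ?thesis
    using fock_of_nat_cancel[of 2 "shifted_word \<epsilon> (x # x # xs)" 0] by simp
qed

fun insert_desc :: "int \<Rightarrow> int list \<Rightarrow> int list" where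
  "insert_desc x [] = [x]"
| "insert_desc x (y # ys) = (if y < x then x # y # ys else y # insert_desc x ys)"

text \<open>Counts ascending pairs, because the target order is decreasing. Insertion uses adjacent
  transpositions only, so this number gives the sign.\<close>

fun inversions :: "int list \<Rightarrow> nat" where
  "inversions [] = 0"
| "inversions (x # xs) = length (filter (\<lambda>y. x < y) xs) + inversions xs"

lemma mset_insert_desc [simp]: "mset (insert_desc x ys) = add_mset x (mset ys)"
  by (induction ys) auto

lemma set_insert_desc [simp]: "set (insert_desc x ys) = insert x (set ys)"
  by (metis mset_insert_desc set_mset_add_mset_insert set_mset_mset)

lemma length_insert_desc [simp]: "length (insert_desc x ys) = Suc (length ys)"
  by (induction ys) auto

lemma sorted_insert_desc:
  "sorted_wrt (>) ys \<Longrightarrow> x \<notin> set ys \<Longrightarrow> sorted_wrt (>) (insert_desc x ys)"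
  by (induction ys) auto

text \<open>The entry \<open>x\<close> passes the larger entries one by one, each with a sign; if it
  meets an equal entry, the word vanishes by \<open>shifted_word_repeat\<close>.\<close>

lemma shifted_word_insert_desc:
  assumes "\<epsilon> * \<epsilon> = 1" "sorted_wrt (>) ys"
  shows "shifted_word \<epsilon> (x # ys) = (if x \<in> set ys then 0
    else (- 1) ^ length (filter (\<lambda>y. x < y) ys) * shifted_word \<epsilon> (insert_desc x ys))"
  using assms(2)
proof (induction ys)
  case (Cons y ys)
  consider "x = y" | "y < x" | "x < y" by linarith
  then show ?case
  proof cases
    case 1
    then show ?thesis by (simp add: shifted_word_repeat[OF assms(1)] del: shifted_word.simps)
  next
    case 2
    then have "filter (\<lambda>z. x < z) ys = []" "x \<notin> set ys"
      using Cons.prems by (auto simp: filter_empty_conv)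
    then show ?thesis using 2 by simp
  next
    case 3
    have "shifted_word \<epsilon> (x # y # ys) = - vertex_coeff \<epsilon> (y - int (Suc (length ys))) (shifted_word \<epsilon> (x # ys))"
      by (subst shifted_word_swap[OF assms(1)]) simp
    also have "shifted_word \<epsilon> (x # ys) = (if x \<in> set ys then 0
       else (- 1) ^ length (filter (\<lambda>y. x < y) ys) * shifted_word \<epsilon> (insert_desc x ys))"
      using Cons by simp
    finally show ?thesis
      using 3 by (auto simp: minus_one_power_cases vertex_coeff_uminus)
  qed
qed simp

lemma shifted_word_sort:
  assumes "\<epsilon> * \<epsilon> = 1"
  shows "if distinct a
    then \<exists>b. mset b = mset a \<and> sorted_wrt (>) b \<and> shifted_word \<epsilon> a = (- 1) ^ inversions a * shifted_word \<epsilon> b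
    else shifted_word \<epsilon> a = 0"
proof (induction a)
  case (Cons x a)
  show ?case
  proof (cases "distinct a")
    case True
    with Cons obtain b where b: "mset b = mset a" "sorted_wrt (>) b"
      "shifted_word \<epsilon> a = (- 1) ^ inversions a * shifted_word \<epsilon> b"
      by auto
    have len: "length b = length a" and set: "set b = set a"
      using b(1) by (metis mset_eq_length, metis set_mset_mset)
    have filter: "length (filter P b) = length (filter P a)" for P
      using b(1) by (metis mset_filter size_mset)
    have "shifted_word \<epsilon> (x # a) = (- 1) ^ inversions a * shifted_word \<epsilon> (x # b)"
      by (simp add: b(3) len minus_one_power_cases vertex_coeff_uminus)
    \<comment> \<open>The entries larger than \<open>x\<close> may be counted in \<open>a\<close>
      instead of the sorted \<open>b\<close>, since both have the same multiset.\<close>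
    also have "\<dots> = (if x \<in> set a then 0 else (- 1) ^ inversions (x # a) * shifted_word \<epsilon> (insert_desc x b))"
      by (subst shifted_word_insert_desc[OF assms b(2)]) (simp add: set filter power_add)
    finally show ?thesis
      using True b sorted_insert_desc[OF b(2), of x] set
      by (auto intro!: exI[of _ "insert_desc x b"] simp del: shifted_word.simps)
  next
    case False
    then show ?thesis using Cons by simp
  qed
qed simp

lemma inversions_eq_card: "inversions a = card {(i, j). i < j \<and> j < length a \<and> a ! i < a ! j}"
proof (induction a)
  case (Cons x xs)
  have fin: "finite {(i, j). i < j \<and> j < length xs \<and> xs ! i < xs ! j}"
    by (rule finite_subset[of _ "{..<length xs} \<times> {..<length xs}"]) auto
  have "{(i, j). i < j \<and> j < length (x # xs) \<and> (x # xs) ! i < (x # xs) ! j}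
      = (\<lambda>j. (0, Suc j)) ` {j. j < length xs \<and> x < xs ! j}
        \<union> (\<lambda>(i, j). (Suc i, Suc j)) ` {(i, j). i < j \<and> j < length xs \<and> xs ! i < xs ! j}" (is "?A = ?B \<union> ?C")
  proof (intro equalityI subsetI)
    fix p assume "p \<in> ?A"
    then show "p \<in> ?B \<union> ?C"
      by (cases p; cases "fst p"; cases "snd p") (auto simp: image_iff)
  qed auto
  then have "card ?A = card ?B + card ?C"
    using fin by (simp only:) (subst card_Un_disjoint, auto)
  also have "card ?B = length (filter (\<lambda>y. x < y) xs)"
    by (subst card_image) (auto simp: inj_on_def length_filter_conv_card)
  also have "card ?C = inversions xs"
    by (subst card_image) (auto simp: inj_on_def Cons)
  finally show ?case by simp
qed simp

lemma sorted_delta_iff: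
  assumes "length xs = N"
  shows "sorted_wrt (\<ge>) (map2 (-) xs (delta N)) \<longleftrightarrow> sorted_wrt (>) (xs :: int list)"
proof -
  have "sorted_wrt (\<ge>) (map2 (-) xs (delta N)) \<longleftrightarrow>
      (\<forall>i. Suc i < N \<longrightarrow> xs ! Suc i - int (N - 1 - Suc i) \<le> xs ! i - int (N - 1 - i))"
    using assms by (subst sorted_wrt_iff_nth_Suc_transp) (auto simp: transp_def delta_def)
  also have "\<dots> \<longleftrightarrow> (\<forall>i. Suc i < N \<longrightarrow> xs ! Suc i < xs ! i)"
    by (intro all_cong) auto
  also have "\<dots> \<longleftrightarrow> sorted_wrt (>) xs"
    using assms by (subst sorted_wrt_iff_nth_Suc_transp) (auto simp: transp_def)
  finally show ?thesis .
qed

lemma sorted_desc_unique: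
  assumes "sorted_wrt (>) (xs :: int list)" "sorted_wrt (>) ys" "mset xs = mset ys"
  shows "xs = ys"
proof -
  have *: "sorted (rev zs)" if "sorted_wrt (>) zs" for zs :: "int list"
    using that by (simp add: sorted_wrt_rev) (metis (mono_tags, lifting) order_less_imp_le sorted_wrt_mono_rel)
  have "rev xs = sort (rev xs)" "rev ys = sort (rev ys)"
    using *[OF assms(1)] *[OF assms(2)] by (simp_all add: sorted_sort_id)
  moreover have "sort (rev xs) = sort (rev ys)"
    using assms(3) by (intro properties_for_sort) simp_all
  ultimately show ?thesis by (metis rev_rev_ident)
qed

context
  fixes \<kappa> :: "int list"
  assumes nondegenerate: "\<not> degenerate \<kappa>"
begin

lemma straightener_permutes: "straightener \<kappa> permutes {..<length \<kappa>}"
  and sorted_straighten: "sorted_wrt (\<ge>) (straighten \<kappa>)"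
  using theI'[OF straightener_unique[OF nondegenerate]]
  by (simp_all add: straightener_def straighten_def)

lemma sorted_permuted: "sorted_wrt (>) (permute_list (straightener \<kappa>) (delta_shift \<kappa>))"
  using sorted_straighten by (simp add: straighten_def sorted_delta_iff)

lemma mset_permuted: "mset (permute_list (straightener \<kappa>) (delta_shift \<kappa>)) = mset (delta_shift \<kappa>)"
  using straightener_permutes by simp

text \<open>As \<open>a\<close> composed with \<sigma> is decreasing, the pair \<open>(i, j)\<close>
  with \<open>i < j\<close> is an inversion of \<sigma> exactly if
  \<open>(\<sigma> j, \<sigma> i)\<close> is an ascending pair of positions in
  \<open>a\<close>.\<close>

lemma perm_length_straightener: "perm_length (length \<kappa>) (straightener \<kappa>) = inversions (delta_shift \<kappa>)"
proof -
  let ?N = "length \<kappa>" and ?\<sigma> = "straightener \<kappa>" and ?\<tau> = "inv_into UNIV (straightener \<kappa>)" and ?a = "delta_shift \<kappa>"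
  have p: "?\<sigma> permutes {..<?N}" by (rule straightener_permutes)
  have less: "?\<sigma> i < ?N \<longleftrightarrow> i < ?N" for i
    using permutes_in_image[OF p, of i] by simp
  have decr: "?a ! ?\<sigma> j < ?a ! ?\<sigma> i" if "i < j" "j < ?N" for i j
    using sorted_wrt_nth_less[OF sorted_permuted, of i j] that p by (simp add: permute_list_nth)
  have iff: "?a ! ?\<sigma> j < ?a ! ?\<sigma> i \<longleftrightarrow> i < j" if "i < ?N" "j < ?N" for i j
    using decr[of i j] decr[of j i] that by (metis less_asym less_irrefl linorder_neqE_nat)
  have "bij_betw (\<lambda>(i, j). (?\<sigma> j, ?\<sigma> i)) {(i, j). i < j \<and> j < ?N \<and> ?\<sigma> j < ?\<sigma> i}
      {(i, j). i < j \<and> j < ?N \<and> ?a ! i < ?a ! j}"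
  proof (rule bij_betw_byWitness[where f' = "\<lambda>(i, j). (?\<tau> j, ?\<tau> i)"])
    have inv: "?\<tau> (?\<sigma> i) = i" "?\<sigma> (?\<tau> i) = i" for i
      using permutes_inverses[OF p] by auto
    have less': "?\<tau> i < ?N \<longleftrightarrow> i < ?N" for i
      using less[of "?\<tau> i"] by (simp add: inv)
    show "(\<lambda>(i, j). (?\<tau> j, ?\<tau> i)) ` {(i, j). i < j \<and> j < ?N \<and> ?a ! i < ?a ! j}
        \<subseteq> {(i, j). i < j \<and> j < ?N \<and> ?\<sigma> j < ?\<sigma> i}"
    proof clarsimp
      fix i j assume ij: "i < j" "j < ?N" "?a ! i < ?a ! j"
      then show "?\<tau> j < ?\<tau> i \<and> ?\<tau> i < ?N \<and> ?\<sigma> (?\<tau> i) < ?\<sigma> (?\<tau> j)"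
        using iff[of "?\<tau> j" "?\<tau> i"] by (simp add: inv less')
    qed
    show "(\<lambda>(i, j). (?\<sigma> j, ?\<sigma> i)) ` {(i, j). i < j \<and> j < ?N \<and> ?\<sigma> j < ?\<sigma> i}
        \<subseteq> {(i, j). i < j \<and> j < ?N \<and> ?a ! i < ?a ! j}"
      by (auto simp: less decr)
  qed (auto simp: permutes_inverses[OF p])
  then show ?thesis
    unfolding perm_length_def inversions_eq_card by (simp add: bij_betw_same_card)
qed

lemma sum_list_straighten: "sum_list (straighten \<kappa>) = sum_list \<kappa>"
proof -
  have *: "sum_list (map2 (-) xs (delta N)) = sum_list xs - sum_list (delta N)" if "length xs = N" for xs N
    using that by (induction xs arbitrary: N) (auto simp: delta_Suc delta_def[of 0])
  have "sum_list (permute_list (straightener \<kappa>) (delta_shift \<kappa>)) = sum_list (delta_shift \<kappa>)"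
    using mset_permuted by (metis sum_mset_sum_list)
  then show ?thesis
    using *[of "delta_shift \<kappa>" "length \<kappa>"]
    by (simp add: straighten_def * delta_shift_minus_delta)
qed

end

lemma vertex_word_straighten:
  assumes "\<epsilon> * \<epsilon> = 1"
  shows "vertex_word \<epsilon> \<kappa> 1 = of_int (tuple_sgn \<kappa>) * vertex_word \<epsilon> (straighten \<kappa>) 1"
proof (cases "degenerate \<kappa>")
  \<comment> \<open>A degenerate \<open>\<kappa>\<close> has no canonical
    \<open>straighten \<kappa>\<close>; the factor \<open>tuple_sgn \<kappa>\<close> is 0, and the
    word vanishes by its repeated entry.\<close>
  case True
  then show ?thesis
    using shifted_word_sort[OF assms, of "delta_shift \<kappa>"]
    by (simp add: degenerate_def vertex_word_eq_shifted_word tuple_sgn_def)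
next
  case False
  then obtain b where b: "mset b = mset (delta_shift \<kappa>)" "sorted_wrt (>) b"
    "shifted_word \<epsilon> (delta_shift \<kappa>) = (- 1) ^ inversions (delta_shift \<kappa>) * shifted_word \<epsilon> b"
    using shifted_word_sort[OF assms, of "delta_shift \<kappa>"] by (auto simp: degenerate_def)
  have "b = permute_list (straightener \<kappa>) (delta_shift \<kappa>)"
    using b mset_permuted[OF False] sorted_permuted[OF False] by (intro sorted_desc_unique) auto
  then have "shifted_word \<epsilon> b = vertex_word \<epsilon> (straighten \<kappa>) 1"
    by (simp add: shifted_word_eq straighten_def)
  then show ?thesis
    using False b(3) by (simp add: vertex_word_eq_shifted_word tuple_sgn_def perm_length_straightener)
qed

text \<open>The last entry of \<delta> is 0, so the last straightened entry is an entry of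
  \<open>\<kappa> + \<delta>\<close> and hence nonnegative; the others are at least as
  large.\<close>

lemma straighten_nonneg:
  assumes "\<not> degenerate \<kappa>" "\<And>k. k \<in> set \<kappa> \<Longrightarrow> k \<ge> 0" "x \<in> set (straighten \<kappa>)"
  shows "x \<ge> 0"
proof (cases "\<kappa> = []")
  case False
  let ?b = "permute_list (straightener \<kappa>) (delta_shift \<kappa>)"
  have s: "straighten \<kappa> \<noteq> []" "length (straighten \<kappa>) = length \<kappa>"
    using False by (simp_all add: straighten_def)
      (metis length_0_conv length_delta length_delta_shift length_map length_permute_list length_zip min.idem)
  have "last (straighten \<kappa>) = last ?b"
    using s False by (simp add: last_conv_nth straighten_def delta_def)
  also have "last ?b \<in> set (delta_shift \<kappa>)"
    using mset_permuted[OF assms(1)] False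
    by (metis last_in_set length_0_conv length_delta_shift length_permute_list set_mset_mset)
  then have "last ?b \<ge> 0"
    using assms(2) by (fastforce simp: delta_shift_def in_set_zip delta_def in_set_conv_nth)
  finally have "last (straighten \<kappa>) \<ge> 0" .
  moreover have "last (straighten \<kappa>) \<le> x"
  proof -
    obtain i where i: "i < length (straighten \<kappa>)" "x = straighten \<kappa> ! i"
      using assms(3) by (metis in_set_conv_nth)
    then show ?thesis
      using sorted_wrt_nth_less[OF sorted_straighten[OF assms(1)], of i "length (straighten \<kappa>) - 1"] s(1)
      by (cases "i = length (straighten \<kappa>) - 1") (auto simp: last_conv_nth)
  qed
  ultimately show ?thesis by simp
qed (use assms in \<open>simp add: straighten_def delta_def delta_shift_def\<close>)

section \<open>Orthonormality and completeness\<close>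

text \<open>Every letter is below \<open>k\<close>, so no delta term occurs and the operator reaches
  the vacuum with index \<open>- k - length l\<close>, which is negative unless the word is empty
  and \<open>k = 0\<close>.\<close>

lemma vertex_coeff_opp_kills:
  assumes "\<epsilon> * \<epsilon> = 1" "\<And>x. x \<in> set l \<Longrightarrow> x < k"
  shows "vertex_coeff (- \<epsilon>) (- int k) (vertex_word \<epsilon> (map int l) 1) = (if l = [] \<and> k = 0 then 1 else 0)"
proof (cases "l = [] \<and> k = 0")
  case False
  have "int (l ! i) \<noteq> int i + int k" if "i < length l" for i
    using assms(2)[of "l ! i"] that by simp
  moreover have "- int k - int (length l) < 0"
    using False by (cases l) auto
  ultimately show ?thesis
    using False by (subst vertex_coeff_opp_vertex_word[OF assms(1)]) auto
qed (auto simp: vertex_coeff_1)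

text \<open>The adjoint of the larger first letter kills the other word; if the first letters agree,
  the Clifford relation strips both.\<close>

lemma vertex_word_orthonormal:
  assumes ip: "fock_inner_product ip" and "\<epsilon> * \<epsilon> = 1"
  shows "is_partition l \<Longrightarrow> is_partition m \<Longrightarrow>
    ip (vertex_word \<epsilon> (map int l) 1) (vertex_word \<epsilon> (map int m) 1) = (if l = m then 1 else 0)"
proof (induction l arbitrary: m)
  case Nil
  show ?case
  proof (cases m)
    case Nil
    then show ?thesis using ip_1_1[OF ip] by simp
  next
    case (Cons b m')
    then have "ip (vertex_word \<epsilon> (map int m) 1) 1 = 0"
      using Nil.prems assms(2) by (simp add: ip_vertex_coeff[OF ip] vertex_coeff_1 ip_zero[OF ip] is_partition_def)
    then show ?thesis
      using Cons by (simp add: ip_commute[OF ip, of 1])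
  qed
next
  case (Cons a l)
  note l = \<open>is_partition (a # l)\<close>
  show ?case
  proof (cases m)
    case Nil
    then show ?thesis
      using l by (simp add: ip_vertex_coeff[OF ip] vertex_coeff_1 ip_zero[OF ip] is_partition_def)
  next
    case m: (Cons b m')
    have smaller: "ip (vertex_word \<epsilon> (map int (a # l)) 1) (vertex_word \<epsilon> (map int (b # m)) 1) = 0"
      if "is_partition (a # l)" "is_partition (b # m)" "b < a" for a b l m
    proof -
      have "vertex_coeff (- \<epsilon>) (- int a) (vertex_word \<epsilon> (map int (b # m)) 1) = 0"
        using that by (subst vertex_coeff_opp_kills[OF assms(2)]) (auto simp: is_partition_def)
      then show ?thesis
        by (simp add: ip_vertex_coeff[OF ip] ip_zero[OF ip])
    qed
    consider "b < a" | "a < b" | "a = b" by linarith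
    then show ?thesis
    proof cases
      case 1
      then show ?thesis using smaller[of a l b m'] Cons.prems m by simp
    next
      case 2
      then show ?thesis
        using smaller[of b m' a l] Cons.prems m ip_commute[OF ip] by (metis list.inject less_irrefl)
    next
      case 3
      \<comment> \<open>The second Clifford term contains the index \<open>- a - 1\<close>, which
        kills the tail because its letters are at most \<open>a\<close>.\<close>
      have "- int (Suc a) = - int a - 1" by simp
      moreover have "vertex_coeff (- \<epsilon>) (- int (Suc a)) (vertex_word \<epsilon> (map int m') 1) = 0"
        using Cons.prems m 3 by (subst vertex_coeff_opp_kills[OF assms(2)]) (auto simp: is_partition_def)
      ultimately have "vertex_coeff (- \<epsilon>) (- int a - 1) (vertex_word \<epsilon> (map int m') 1) = 0"
        by (simp only:)
      then have "vertex_coeff (- \<epsilon>) (- int a) (vertex_word \<epsilon> (map int m) 1) = vertex_word \<epsilon> (map int m') 1"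
        using vertex_coeff_clifford[of "- \<epsilon>" "- int a" "int a" "vertex_word \<epsilon> (map int m') 1"] assms(2) m 3
        by (simp add: algebra_simps)
      then have "ip (vertex_word \<epsilon> (map int (a # l)) 1) (vertex_word \<epsilon> (map int m) 1)
          = ip (vertex_word \<epsilon> (map int l) 1) (vertex_word \<epsilon> (map int m') 1)"
        by (simp add: ip_vertex_coeff[OF ip])
      then show ?thesis
        using Cons m 3 by (simp add: is_partition_def)
    qed
  qed
qed

text \<open>Newton's identity \<open>cre_rec\<close> at \<open>Suc i\<close> expresses the variable
  with index \<open>i\<close> through \<open>cre\<close> and variables of smaller index.\<close>

lemma fvar_mult_stable:
  assumes "\<epsilon> * \<epsilon> = 1" "fock.subspace W" "\<And>n v. v \<in> W \<Longrightarrow> cre \<epsilon> n * v \<in> W"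
  shows "v \<in> W \<Longrightarrow> fvar i * v \<in> W"
proof (induction i arbitrary: v rule: less_induct)
  case (less i)
  have "of_int (int (Suc i)) * cre \<epsilon> (int (Suc i))
      = (\<Sum>m=1..Suc i. fscale \<epsilon> (fvar (m - 1) * cre \<epsilon> (int (Suc i) - int m)))"
    by (rule cre_rec) simp
  also have "\<dots> = fscale \<epsilon> (fvar i) + (\<Sum>m=1..i. fscale \<epsilon> (fvar (m - 1) * cre \<epsilon> (int (Suc i) - int m)))"
    by simp
  finally have "fscale \<epsilon> (fvar i) * v = fscale (of_int (int (Suc i))) (cre \<epsilon> (int (Suc i)) * v)
      - (\<Sum>m=1..i. fscale \<epsilon> (fvar (m - 1) * (cre \<epsilon> (int (Suc i) - int m) * v)))"
    by (simp only: fscale_of_int mult.assoc[symmetric] fscale_mult_left[symmetric] sum_distrib_right[symmetric] left_diff_distrib[symmetric])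
      simp
  also have "\<dots> \<in> W"
    using less assms by (intro fock.subspace_diff fock.subspace_sum fock.subspace_scale) auto
  finally have "fscale \<epsilon> (fscale \<epsilon> (fvar i) * v) \<in> W"
    using assms(2) by (intro fock.subspace_scale)
  then show ?case
    using assms(1) by (simp add: fscale_mult_left)
qed

lemma cre_stable_eq_UNIV:
  assumes "\<epsilon> * \<epsilon> = 1" "fock.subspace W" "\<And>n v. v \<in> W \<Longrightarrow> cre \<epsilon> n * v \<in> W" "1 \<in> W"
  shows "W = UNIV"
proof -
  have "u \<in> W" for u
  proof (induction u rule: fock_induct)
    case (const c)
    then show ?case using assms by (simp add: fock_single_0 fock.subspace_scale)
  next
    case (fvar i u)
    then show ?case using fvar_mult_stable[OF assms(1-3)] by blast
  next
    case (add u v)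
    then show ?case using assms by (simp add: fock.subspace_add)
  qed
  then show ?thesis by blast
qed

text \<open>By \<open>vertex_coeff_cre_mult\<close>, \<open>cre n\<close> moves past the first
  letter at the cost of a term with \<open>cre (n - 1)\<close> and a larger letter. Hence an
  induction on the length with an inner one on \<open>n\<close>, the letter being arbitrary.\<close>

lemma cre_mult_span_vertex_words:
  assumes "\<epsilon> * \<epsilon> = 1"
  defines "W \<equiv> fock.span {vertex_word \<epsilon> (map int l) 1 | l. True}"
  shows "v \<in> W \<Longrightarrow> cre \<epsilon> n * v \<in> W"
proof -
  have T: "vertex_coeff \<epsilon> (int k) v \<in> W" if "v \<in> W" for k v
    using that unfolding W_def
  proof (induction rule: fock.span_induct_alt)
    case (step c x y)
    then obtain l where "x = vertex_word \<epsilon> (map int l) 1" by blast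
    then have "vertex_coeff \<epsilon> (int k) x = vertex_word \<epsilon> (map int (k # l)) 1" by simp
    then have "vertex_coeff \<epsilon> (int k) x \<in> W"
      unfolding W_def by (blast intro: fock.span_base)
    with step show ?case
      unfolding W_def by (simp add: vertex_coeff_add vertex_coeff_fscale fock.span_add fock.span_scale)
  qed (simp add: fock.span_zero)
  have base: "cre \<epsilon> n * vertex_word \<epsilon> (map int l) 1 \<in> W" for n l
  proof (induction l arbitrary: n)
    case Nil
    show ?case
    proof (cases "n < 0")
      case False
      then have "cre \<epsilon> n = vertex_word \<epsilon> (map int [nat n]) 1" by (simp add: vertex_coeff_1)
      then have "cre \<epsilon> n \<in> W" unfolding W_def by (blast intro: fock.span_base)
      then show ?thesis by simp
    qed (simp add: W_def fock.span_zero)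
  next
    case (Cons k l)
    let ?v = "vertex_word \<epsilon> (map int l) 1"
    have "cre \<epsilon> n * vertex_coeff \<epsilon> (int k) ?v \<in> W" for k
    proof (induction n arbitrary: k rule: nat_int_induct)
      case (nonneg n)
      have "cre \<epsilon> n * vertex_coeff \<epsilon> (int k) ?v
          = vertex_coeff \<epsilon> (int k) (cre \<epsilon> n * ?v) + cre \<epsilon> (n - 1) * vertex_coeff \<epsilon> (int (Suc k)) ?v"
        by (simp add: vertex_coeff_cre_mult[OF assms(1)] add.commute)
      moreover have "vertex_coeff \<epsilon> (int k) (cre \<epsilon> n * ?v) \<in> W"
        by (intro T Cons)
      moreover have "cre \<epsilon> (n - 1) * vertex_coeff \<epsilon> (int (Suc k)) ?v \<in> W"
        by (intro nonneg) simp
      ultimately show ?case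
        unfolding W_def by (simp add: fock.span_add)
    qed (simp add: W_def fock.span_zero)
    then show ?case by simp
  qed
  show "cre \<epsilon> n * v \<in> W" if "v \<in> W"
    using that unfolding W_def
  proof (induction rule: fock.span_induct_alt)
    case (step c x y)
    then have "cre \<epsilon> n * x \<in> W" using base by blast
    with step show ?case
      unfolding W_def by (simp add: distrib_left fscale_mult_right fock.span_add fock.span_scale)
  qed (simp add: fock.span_zero)
qed

text \<open>Zeros of a decreasing word stand at its end, where the coefficient 0 fixes the
  vacuum.\<close>

lemma vertex_word_remove_zeros:
  assumes "sorted_wrt (\<ge>) l"
  shows "vertex_word \<epsilon> (map int (filter (\<lambda>x. x \<noteq> 0) l)) 1 = vertex_word \<epsilon> (map int l) 1"
  using assms
proof (induction l)
  case (Cons x l)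
  show ?case
  proof (cases "x = 0")
    case True
    then have "filter (\<lambda>x. x \<noteq> 0) l = []"
      using Cons.prems by (auto simp: filter_empty_conv)
    then show ?thesis
      using Cons True by (simp add: vertex_coeff_1)
  qed (use Cons in simp)
qed simp

lemma is_partition_filter: "sorted_wrt (\<ge>) l \<Longrightarrow> is_partition (filter (\<lambda>x. x \<noteq> 0) l)"
  by (auto simp: is_partition_def sorted_wrt_filter)

lemma straighten_nat:
  assumes "\<not> degenerate (map int l)"
  shows "map int (map nat (straighten (map int l))) = straighten (map int l)"
    and "sorted_wrt (\<ge>) (map nat (straighten (map int l)))"
    and "sum_list (map nat (straighten (map int l))) = sum_list l"
proof -
  have nonneg: "x \<ge> 0" if "x \<in> set (straighten (map int l))" for x
    using straighten_nonneg[OF assms _ that] by fastforce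
  then show eq: "map int (map nat (straighten (map int l))) = straighten (map int l)"
    by (simp add: map_idI)
  show "sorted_wrt (\<ge>) (map nat (straighten (map int l)))"
    unfolding sorted_wrt_map
    by (rule sorted_wrt_mono_rel[OF _ sorted_straighten[OF assms]]) auto
  have "int (sum_list k) = sum_list (map int k)" for k
    by (induction k) auto
  then have "int (sum_list (map nat (straighten (map int l)))) = int (sum_list l)"
    by (metis eq sum_list_straighten[OF assms])
  then show "sum_list (map nat (straighten (map int l))) = sum_list l"
    by simp
qed

text \<open>All words with nonnegative letters span, and straightening turns each into 0 or a signed
  partition word.\<close>

lemma span_partition_vertex_words:
  assumes "\<epsilon> * \<epsilon> = 1"
  shows "fock.span {vertex_word \<epsilon> (map int l) 1 | l. is_partition l} = UNIV"
proof -
  let ?B = "{vertex_word \<epsilon> (map int l) 1 | l. is_partition l}"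
  have "vertex_word \<epsilon> (map int l) 1 \<in> fock.span ?B" for l
  proof (cases "degenerate (map int l)")
    case True
    then show ?thesis
      by (subst vertex_word_straighten[OF assms]) (simp add: tuple_sgn_def fock.span_zero)
  next
    case False
    let ?m = "map nat (straighten (map int l))"
    have "vertex_word \<epsilon> (straighten (map int l)) 1 = vertex_word \<epsilon> (map int (filter (\<lambda>x. x \<noteq> 0) ?m)) 1"
      by (subst vertex_word_remove_zeros[OF straighten_nat(2)[OF False]]) (simp only: straighten_nat(1)[OF False])
    then have "vertex_word \<epsilon> (straighten (map int l)) 1 \<in> ?B"
      using is_partition_filter[OF straighten_nat(2)[OF False]] by blast
    then show ?thesis
      by (subst vertex_word_straighten[OF assms]) (simp flip: fscale_of_int add: fock.span_scale fock.span_base)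
  qed
  then have "fock.span {vertex_word \<epsilon> (map int l) 1 | l. True} \<subseteq> fock.span ?B"
    by (intro fock.span_minimal) auto
  moreover have "fock.span {vertex_word \<epsilon> (map int l) 1 | l. True} = UNIV"
  proof (rule cre_stable_eq_UNIV[OF assms fock.subspace_span cre_mult_span_vertex_words[OF assms]])
    show "1 \<in> fock.span {vertex_word \<epsilon> (map int l) 1 | l. True}"
      by (rule fock.span_base) (auto intro: exI[of _ "[]"])
  qed
  ultimately show ?thesis by blast
qed

lemma orthonormal_basisI:
  assumes ip: "fock_inner_product ip"
    and orth: "\<And>u v. u \<in> B \<Longrightarrow> v \<in> B \<Longrightarrow> ip u v = (if u = v then 1 else 0)"
    and "fock.span B = UNIV"
  shows "orthonormal_basis ip B"
proof -
  have "fock.independent B"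
    unfolding fock.independent_explicit_module
  proof (intro allI impI)
    fix S f v
    assume S: "finite S" "S \<subseteq> B" "(\<Sum>v\<in>S. fscale (f v) v) = 0" "v \<in> S"
    have "0 = ip (\<Sum>v\<in>S. fscale (f v) v) v"
      by (simp add: S ip_zero[OF ip])
    also have "\<dots> = (\<Sum>u\<in>S. if u = v then f u else 0)"
      unfolding ip_sum[OF ip] ip_fscale_left[OF ip]
      using S by (intro sum.cong refl) (subst orth, auto)
    finally show "f v = 0"
      using S by simp
  qed
  with assms show ?thesis
    by (simp add: orthonormal_basis_def)
qed

lemma orthonormal_basis_vertex_words:
  assumes "fock_inner_product ip" "\<epsilon> * \<epsilon> = 1"
  shows "orthonormal_basis ip {vertex_word \<epsilon> (map int l) 1 | l. is_partition l}"
proof (rule orthonormal_basisI[OF assms(1) _ span_partition_vertex_words[OF assms(2)]])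
  fix u v
  assume "u \<in> {vertex_word \<epsilon> (map int l) 1 | l. is_partition l}" "v \<in> {vertex_word \<epsilon> (map int l) 1 | l. is_partition l}"
  then obtain l m where lm: "is_partition l" "is_partition m"
    "u = vertex_word \<epsilon> (map int l) 1" "v = vertex_word \<epsilon> (map int m) 1"
    by blast
  \<comment> \<open>Different partitions give different vectors, since a vector has product 1 with
    itself.\<close>
  show "ip u v = (if u = v then 1 else 0)"
    using vertex_word_orthonormal[OF assms lm(1,2)] vertex_word_orthonormal[OF assms lm(1,1)] lm
    by (cases "l = m") auto
qed

section \<open>The Jacobi-Trudi formula\<close>

lemma mps_eqI: "(\<And>a. mps_coeff f a = mps_coeff g a) \<Longrightarrow> f = g"
  by (metis ext mps_coeff_inject)

lemma mps_coeff_sum: "mps_coeff (sum f A) a = (\<Sum>x\<in>A. mps_coeff (f x) a)"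
  by (induction A rule: infinite_finite_induct) (auto simp: plus_mps.rep_eq zero_mps.rep_eq)

lemma poly_mapping_diff_single_add:
  fixes a :: "'a \<Rightarrow>\<^sub>0 nat"
  assumes "Poly_Mapping.lookup a i \<ge> k"
  shows "a - Poly_Mapping.single i k + Poly_Mapping.single i k = a"
  using assms by (intro poly_mapping_eqI) (auto simp: lookup_add lookup_minus lookup_single when_def)

definition mdegree :: "(nat \<Rightarrow>\<^sub>0 nat) \<Rightarrow> nat" where
  "mdegree a = (\<Sum>i\<in>Poly_Mapping.keys a. Poly_Mapping.lookup a i)"

lemma mdegree_add: "mdegree (a + b) = mdegree a + mdegree b"
  unfolding mdegree_def by (subst setsum_keys_plus_distrib) auto

lemma mdegree_single [simp]: "mdegree (Poly_Mapping.single i k) = k"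
  by (simp add: mdegree_def)

lemma mdegree_zero_iff: "mdegree a = 0 \<longleftrightarrow> a = 0"
  by (auto simp: mdegree_def in_keys_iff intro!: poly_mapping_eqI)

lemma complete_sym_coeff: "mps_coeff (complete_sym n) a = (if int (mdegree a) = n then 1 else 0)"
  by (simp add: complete_sym.rep_eq mdegree_def)

definition mps_monom :: "(nat \<Rightarrow>\<^sub>0 nat) \<Rightarrow> 'a::zero_neq_one mps" where
  "mps_monom b = Abs_mps (\<lambda>a. if a = b then 1 else 0)"

lemma mps_coeff_monom: "mps_coeff (mps_monom b) a = (if a = b then 1 else 0)"
  by (simp add: mps_monom_def Abs_mps_inverse)

lemma mps_coeff_monom_mult:
  "mps_coeff (mps_monom (Poly_Mapping.single i k) * f) a =
    (if k \<le> Poly_Mapping.lookup a i then mps_coeff f (a - Poly_Mapping.single i k) else 0)"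
proof -
  let ?e = "Poly_Mapping.single i k :: nat \<Rightarrow>\<^sub>0 nat"
  have "mps_coeff (mps_monom ?e * f) a = (\<Sum>(b, c)\<in>splits a. if b = ?e then mps_coeff f c else 0)"
    by (auto simp: times_mps.rep_eq mps_coeff_monom intro!: sum.cong)
  also have "\<dots> = (\<Sum>(b, c)\<in>{(b, c)\<in>splits a. b = ?e}. mps_coeff f c)"
    by (intro sum.mono_neutral_cong_right finite_splits) (auto split: if_splits)
  also have "{(b, c)\<in>splits a. b = ?e} = (if k \<le> Poly_Mapping.lookup a i then {(?e, a - ?e)} else {})"
    using poly_mapping_diff_single_add[of k a i]
    by (auto simp: splits_def lookup_add add.commute)
  finally show ?thesis by simp
qed

lemma mps_monom_add: "mps_monom (a + b) = mps_monom a * (mps_monom b :: 'a :: comm_ring_1 mps)"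
proof (rule mps_eqI)
  fix c
  have "mps_coeff (mps_monom a * (mps_monom b :: 'a mps)) c = (\<Sum>p\<in>splits c. if p = (a, b) then 1 else 0)"
    by (auto simp: times_mps.rep_eq mps_coeff_monom intro!: sum.cong)
  also have "\<dots> = (if (a, b) \<in> splits c then 1 else 0)"
    by (simp add: finite_splits)
  also have "\<dots> = mps_coeff (mps_monom (a + b)) c"
    by (auto simp: splits_def mps_coeff_monom)
  finally show "mps_coeff (mps_monom (a + b)) c = mps_coeff (mps_monom a * (mps_monom b :: 'a mps)) c" ..
qed

lemma mps_monom_0: "mps_monom 0 = (1 :: 'a :: comm_ring_1 mps)"
  by (rule mps_eqI) (simp add: mps_coeff_monom one_mps.rep_eq)

lemma mps_monom_single_power:
  "mps_monom (Poly_Mapping.single i 1) ^ k = (mps_monom (Poly_Mapping.single i k) :: 'a :: comm_ring_1 mps)"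
  by (induction k) (auto simp: mps_monom_0 mps_monom_add[symmetric] single_add[symmetric])

text \<open>The substitution of 0 for all \<open>x_i\<close> with \<open>i \<ge> n\<close>. It is a
  ring homomorphism because exponents cannot cancel: a product of monomials uses only the first
  \<open>n\<close> variables iff both factors do.\<close>

lift_definition mps_restrict :: "nat \<Rightarrow> 'a::zero mps \<Rightarrow> 'a mps" is
  "\<lambda>n f a. if Poly_Mapping.keys a \<subseteq> {..<n} then f a else 0" .

interpretation mps_restrict: comm_ring_hom "mps_restrict n :: 'a::comm_ring_1 mps \<Rightarrow> 'a mps" for n
proof
  fix f g :: "'a mps"
  show "mps_restrict n (f * g) = mps_restrict n f * mps_restrict n g"
  proof (rule mps_eqI)
    fix a
    have keys: "Poly_Mapping.keys b \<union> Poly_Mapping.keys c = Poly_Mapping.keys a" if "(b, c) \<in> splits a" for b c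
      using that by (auto simp: splits_def in_keys_iff lookup_add)
    show "mps_coeff (mps_restrict n (f * g)) a = mps_coeff (mps_restrict n f * mps_restrict n g) a"
    proof (cases "Poly_Mapping.keys a \<subseteq> {..<n}")
      case True
      then have "Poly_Mapping.keys b \<subseteq> {..<n}" "Poly_Mapping.keys c \<subseteq> {..<n}" if "(b, c) \<in> splits a" for b c
        using keys[OF that] by auto
      with True show ?thesis
        by (auto simp: times_mps.rep_eq mps_restrict.rep_eq intro!: sum.cong)
    next
      case False
      then have "\<not> Poly_Mapping.keys b \<subseteq> {..<n} \<or> \<not> Poly_Mapping.keys c \<subseteq> {..<n}" if "(b, c) \<in> splits a" for b c
        using keys[OF that] by blast
      then have "(case p of (b, c) \<Rightarrow> mps_coeff (mps_restrict n f) b * mps_coeff (mps_restrict n g) c) = 0"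
        if "p \<in> splits a" for p
        using that by (cases p) (fastforce simp: mps_restrict.rep_eq)
      with False show ?thesis
        by (simp add: times_mps.rep_eq mps_restrict.rep_eq[of n "f * g"] sum.neutral)
    qed
  qed
qed (auto intro!: mps_eqI simp: mps_restrict.rep_eq plus_mps.rep_eq zero_mps.rep_eq one_mps.rep_eq)

text \<open>Every monomial involves finitely many variables; this opens the way to induction on
  their number.\<close>

lemma mps_eq_restrictI:
  assumes "\<And>n. mps_restrict n f = mps_restrict n g"
  shows "f = g"
proof (rule mps_eqI)
  fix a :: "nat \<Rightarrow>\<^sub>0 nat"
  obtain n where "\<forall>i\<in>Poly_Mapping.keys a. i < n"
    using finite_nat_set_iff_bounded[of "Poly_Mapping.keys a"] by auto
  then show "mps_coeff f a = mps_coeff g a"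
    using arg_cong[OF assms[of n], of "\<lambda>f. mps_coeff f a"] by (auto simp: mps_restrict.rep_eq split: if_splits)
qed

abbreviation mps_var :: "nat \<Rightarrow> rat mps" where
  "mps_var n \<equiv> mps_monom (Poly_Mapping.single n 1)"

abbreviation complete_sym_in :: "nat \<Rightarrow> int \<Rightarrow> rat mps" where
  "complete_sym_in n k \<equiv> mps_restrict n (complete_sym k)"

lemma complete_sym_in_neg: "k < 0 \<Longrightarrow> complete_sym_in n k = 0"
  by (rule mps_eqI) (auto simp: mps_restrict.rep_eq complete_sym_coeff zero_mps.rep_eq)

lemma complete_sym_in_0: "complete_sym_in 0 k = (if k = 0 then 1 else 0)"
  by (rule mps_eqI) (auto simp: mps_restrict.rep_eq complete_sym_coeff zero_mps.rep_eq one_mps.rep_eq mdegree_def)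

text \<open>Monomials are split according to whether \<open>x_n\<close> occurs in them.\<close>

lemma complete_sym_in_Suc:
  "complete_sym_in (Suc n) k = complete_sym_in n k + mps_var n * complete_sym_in (Suc n) (k - 1)"
proof (rule mps_eqI)
  fix a :: "nat \<Rightarrow>\<^sub>0 nat"
  show "mps_coeff (complete_sym_in (Suc n) k) a
      = mps_coeff (complete_sym_in n k + mps_var n * complete_sym_in (Suc n) (k - 1)) a"
  proof (cases "Poly_Mapping.lookup a n = 0")
    case True
    then have "Poly_Mapping.keys a \<subseteq> {..<Suc n} \<longleftrightarrow> Poly_Mapping.keys a \<subseteq> {..<n}"
      by (simp add: lessThan_Suc subset_insert in_keys_iff)
    with True show ?thesis
      by (simp add: plus_mps.rep_eq mps_coeff_monom_mult mps_restrict.rep_eq)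
  next
    case False
    define b where "b = a - Poly_Mapping.single n 1"
    have a: "a = b + Poly_Mapping.single n 1"
      using False poly_mapping_diff_single_add[of 1 a n] by (simp add: b_def)
    have b: "a - Poly_Mapping.single n (Suc 0) = b"
      by (simp add: b_def)
    have "\<not> Poly_Mapping.keys a \<subseteq> {..<n}"
      using False by (auto simp: subset_iff in_keys_iff)
    moreover have "Poly_Mapping.keys a \<subseteq> {..<Suc n} \<longleftrightarrow> Poly_Mapping.keys b \<subseteq> {..<Suc n}"
      unfolding a by (auto simp: subset_iff in_keys_iff lookup_add lookup_single when_def)
    moreover have "mdegree a = mdegree b + 1"
      by (simp add: a mdegree_add)
    ultimately show ?thesis
      using False by (simp add: plus_mps.rep_eq mps_coeff_monom_mult mps_restrict.rep_eq complete_sym_coeff b)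
  qed
qed

lemma complete_sym_in_Suc_iter:
  "complete_sym_in (Suc n) k = (\<Sum>r\<le>R. mps_var n ^ r * complete_sym_in n (k - int r))
     + mps_var n ^ Suc R * complete_sym_in (Suc n) (k - int (Suc R))"
proof (induction R)
  case 0
  show ?case using complete_sym_in_Suc[of n k] by simp
next
  case (Suc R)
  show ?case
    using complete_sym_in_Suc[of n "k - int (Suc R)"] unfolding Suc.IH by (simp add: algebra_simps)
qed

section \<open>Removing one variable from the Jacobi-Trudi determinant\<close>

lemma det_mat:
  "det (mat N N (\<lambda>(i, j). B i j)) = (\<Sum>p | p permutes {0..<N}. signof p * (\<Prod>i<N. B i (p i)))"
proof -
  have p: "p i < N" if "p permutes {0..<N}" "i < N" for p i
    using that permutes_in_image[OF that(1), of i] by simp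
  have *: "(\<Prod>i = 0..<N. mat N N (\<lambda>(i, j). B i j) $$ (i, p i)) = (\<Prod>i<N. B i (p i))" if "p permutes {0..<N}" for p
    unfolding atLeast0LessThan
    by (rule prod.cong[OF refl]) (use p[OF that] in simp)
  have "det (mat N N (\<lambda>(i, j). B i j)) = (\<Sum>p | p permutes {0..<N}.
      signof p * (\<Prod>i = 0..<N. mat N N (\<lambda>(i, j). B i j) $$ (i, p i)))"
    by (rule det_def') simp
  also have "\<dots> = (\<Sum>p | p permutes {0..<N}. signof p * (\<Prod>i<N. B i (p i)))"
    by (rule sum.cong[OF refl]) (simp only: mem_Collect_eq *)
  finally show ?thesis .
qed

text \<open>Multilinearity in all rows at once: one term for each choice \<open>f\<close> of a
  summand per row.\<close>

lemma det_rows_sum: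
  fixes A :: "nat \<Rightarrow> 'b \<Rightarrow> nat \<Rightarrow> 'a :: comm_ring_1"
  assumes "\<And>i. i < N \<Longrightarrow> finite (R i)"
  shows "det (mat N N (\<lambda>(i, j). \<Sum>s\<in>R i. c i s * A i s j))
    = (\<Sum>f\<in>PiE {..<N} R. (\<Prod>i<N. c i (f i)) * det (mat N N (\<lambda>(i, j). A i (f i) j)))"
proof -
  have "det (mat N N (\<lambda>(i, j). \<Sum>s\<in>R i. c i s * A i s j))
      = (\<Sum>p | p permutes {0..<N}. signof p * (\<Prod>i<N. \<Sum>s\<in>R i. c i s * A i s (p i)))"
    by (simp only: det_mat)
  also have "\<dots> = (\<Sum>p | p permutes {0..<N}. \<Sum>f\<in>PiE {..<N} R. signof p * (\<Prod>i<N. c i (f i) * A i (f i) (p i)))"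
    using assms by (intro sum.cong refl, subst prod_sum_PiE) (auto simp: sum_distrib_left)
  also have "\<dots> = (\<Sum>f\<in>PiE {..<N} R. (\<Prod>i<N. c i (f i)) * (\<Sum>p | p permutes {0..<N}. signof p * (\<Prod>i<N. A i (f i) (p i))))"
    by (subst sum.swap) (simp add: prod.distrib sum_distrib_left mult_ac)
  also have "\<dots> = (\<Sum>f\<in>PiE {..<N} R. (\<Prod>i<N. c i (f i)) * det (mat N N (\<lambda>(i, j). A i (f i) j)))"
    by (simp only: det_mat)
  finally show ?thesis .
qed

text \<open>Interlacing sequences \<open>f\<close> index the horizontal strips \<open>L / f\<close>.\<close>

abbreviation interlacing :: "nat \<Rightarrow> (nat \<Rightarrow> nat) \<Rightarrow> (nat \<Rightarrow> nat) set" where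
  "interlacing N L \<equiv> PiE {..<N} (\<lambda>i. {L (Suc i)..L i})"

text \<open>
  Subtracting \<open>x\<^sub>n\<^bsup>L\<^sub>i - L\<^sub>i\<^sub>+\<^sub>1 + 1\<^esup>\<close> times row \<open>i + 1\<close> from row \<open>i\<close> truncates the expansion of row \<open>i\<close>
  in powers of \<open>x\<^sub>n\<close> exactly at the horizontal strips.
\<close>

lemma det_complete_sym_in_Suc:
  fixes L :: "nat \<Rightarrow> nat"
  assumes anti: "\<And>i. L (Suc i) \<le> L i" and "L N = 0"
  shows "det (mat N N (\<lambda>(i, j). complete_sym_in (Suc n) (int (L i) - int i + int j)))
    = (\<Sum>f\<in>interlacing N L. mps_var n ^ (\<Sum>i<N. L i - f i) *
        det (mat N N (\<lambda>(i, j). complete_sym_in n (int (f i) - int i + int j))))"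
proof -
  define M where "M = mat N N (\<lambda>(i, j). complete_sym_in (Suc n) (int (L i) - int i + int j))"
  define U where "U = mat N N (\<lambda>(i, j). if i = j then 1 else if j = Suc i then - (mps_var n ^ Suc (L i - L (Suc i))) else 0)"
  have carrier: "M \<in> carrier_mat N N" "U \<in> carrier_mat N N"
    by (simp_all add: M_def U_def)
  have "upper_triangular U" "diag_mat U = replicate N 1"
    by (auto simp: U_def diag_mat_def map_replicate_const[symmetric] intro!: nth_equalityI)
  then have "det U = 1"
    using carrier by (subst det_upper_triangular[of _ N]) auto
  have UM: "U * M = mat N N (\<lambda>(i, j). \<Sum>s\<in>{L (Suc i)..L i}. mps_var n ^ (L i - s) * complete_sym_in n (int s - int i + int j))"
  proof (rule eq_matI)
    fix i j assume "i < dim_row (mat N N (\<lambda>(i, j). \<Sum>s\<in>{L (Suc i)..L i}. mps_var n ^ (L i - s) * complete_sym_in n (int s - int i + int j)))"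
      and "j < dim_col (mat N N (\<lambda>(i, j). \<Sum>s\<in>{L (Suc i)..L i}. mps_var n ^ (L i - s) * complete_sym_in n (int s - int i + int j)))"
    then have ij: "i < N" "j < N" by simp_all
    define R where "R = L i - L (Suc i)"
    define k where "k = int (L i) - int i + int j"
    have "(U * M) $$ (i, j) = (\<Sum>l<N. U $$ (i, l) * M $$ (l, j))"
      using ij carrier by (simp add: scalar_prod_def atLeast0LessThan)
    also have "\<dots> = (\<Sum>l<N. (if l = i then M $$ (i, j) else 0) + (if l = Suc i then - (mps_var n ^ Suc R * M $$ (Suc i, j)) else 0))"
      using ij by (intro sum.cong refl) (auto simp: U_def R_def)
    also have "\<dots> = M $$ (i, j) - (if Suc i < N then mps_var n ^ Suc R * M $$ (Suc i, j) else 0)"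
      using ij by (simp only: sum.distrib sum.delta finite_lessThan) auto
    also have "(if Suc i < N then mps_var n ^ Suc R * M $$ (Suc i, j) else 0)
        = mps_var n ^ Suc R * complete_sym_in (Suc n) (k - int (Suc R))"
    proof (cases "Suc i < N")
      case True
      have "int (L (Suc i)) - int (Suc i) + int j = k - int (Suc R)"
        using anti[of i] by (simp add: k_def R_def of_nat_diff)
      moreover have "M $$ (Suc i, j) = complete_sym_in (Suc n) (int (L (Suc i)) - int (Suc i) + int j)"
        using True ij by (simp add: M_def del: of_nat_Suc)
      ultimately show ?thesis
        using True by (simp only: if_True)
    next
      \<comment> \<open>Nothing is subtracted from the last row; its remainder has index
        \<open>j - N < 0\<close> because \<open>L N = 0\<close>.\<close>
      case False
      with ij have "Suc i = N" by simp
      with ij assms have "k - int (Suc R) < 0" by (simp add: k_def R_def)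
      with False show ?thesis by (simp add: complete_sym_in_neg)
    qed
    also have "M $$ (i, j) - \<dots> = (\<Sum>r\<le>R. mps_var n ^ r * complete_sym_in n (k - int r))"
      using ij complete_sym_in_Suc_iter[of n k R] by (simp add: M_def k_def)
    also have "\<dots> = (\<Sum>s\<in>{L (Suc i)..L i}. mps_var n ^ (L i - s) * complete_sym_in n (int s - int i + int j))"
      using anti[of i]
      by (intro sum.reindex_bij_witness[where i = "\<lambda>s. L i - s" and j = "\<lambda>r. L i - r"])
        (auto simp: R_def k_def of_nat_diff algebra_simps)
    finally show "(U * M) $$ (i, j) = mat N N (\<lambda>(i, j). \<Sum>s\<in>{L (Suc i)..L i}. mps_var n ^ (L i - s) * complete_sym_in n (int s - int i + int j)) $$ (i, j)"
      using ij by simp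
  qed (use carrier in auto)
  have "det M = det (U * M)"
    using carrier \<open>det U = 1\<close> by (simp add: det_mult)
  also have "\<dots> = (\<Sum>f\<in>interlacing N L. (\<Prod>i<N. mps_var n ^ (L i - f i)) *
        det (mat N N (\<lambda>(i, j). complete_sym_in n (int (f i) - int i + int j))))"
    unfolding UM by (rule det_rows_sum) simp
  finally show ?thesis
    by (simp add: M_def power_sum)
qed

section \<open>The branching rule for semistandard tableaux\<close>

definition tableaux :: "nat list \<Rightarrow> (nat \<Rightarrow>\<^sub>0 nat) \<Rightarrow> (nat \<times> nat \<Rightarrow> nat) set" where
  "tableaux l a = {T \<in> ssyt l. \<forall>k. card {c \<in> diagram l. T c = k} = Poly_Mapping.lookup a k}"

lemma schur_coeff: "mps_coeff (schur l) a = of_nat (card (tableaux l a))"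
  by (simp add: schur.rep_eq tableaux_def)

lemma finite_diagram [simp]: "finite (diagram l)"
proof -
  have "diagram l = Sigma {..<length l} (\<lambda>i. {..<l ! i})" by (auto simp: diagram_def)
  then show ?thesis by simp
qed

lemma card_diagram_diff:
  assumes "length m = length l" "\<And>i. i < length l \<Longrightarrow> m ! i \<le> l ! i"
  shows "card (diagram l - diagram m) = (\<Sum>i<length l. l ! i - m ! i)"
proof -
  have "diagram l - diagram m = Sigma {..<length l} (\<lambda>i. {m ! i..<l ! i})"
    using assms by (auto simp: diagram_def)
  then show ?thesis by simp
qed

lemma tableaux_entry:
  assumes "T \<in> tableaux l a" "c \<in> diagram l"
  shows "T c \<in> Poly_Mapping.keys a"
proof -
  have "{d \<in> diagram l. T d = T c} \<noteq> {}"
    using assms(2) by blast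
  then have "card {d \<in> diagram l. T d = T c} > 0"
    by (intro card_gt_0_iff[THEN iffD2] conjI) simp_all
  then show ?thesis
    using assms(1) by (simp add: tableaux_def in_keys_iff)
qed

lemma finite_tableaux [simp]: "finite (tableaux l a)"
proof (rule finite_subset)
  show "tableaux l a \<subseteq> diagram l \<rightarrow>\<^sub>E Poly_Mapping.keys a"
  proof
    fix T assume T: "T \<in> tableaux l a"
    then have "T \<in> diagram l \<rightarrow>\<^sub>E UNIV"
      by (simp add: tableaux_def ssyt_def)
    then show "T \<in> diagram l \<rightarrow>\<^sub>E Poly_Mapping.keys a"
      using tableaux_entry[OF T] by (auto simp: PiE_iff)
  qed
qed (auto intro!: finite_PiE)

lemma downward_closed_eq_lessThan:
  assumes "finite S" "\<And>j k. k \<in> S \<Longrightarrow> j \<le> k \<Longrightarrow> j \<in> S"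
  shows "S = {..<card (S :: nat set)}"
proof (cases "S = {}")
  case False
  then have "S = {..<Suc (Max S)}"
    using assms(2)[OF Max_in[OF assms(1) False]] Max_ge[OF assms(1)] by (auto simp: less_Suc_eq_le)
  then show ?thesis by (metis card_lessThan)
qed simp

lemma ssyt_row_mono:
  assumes "T \<in> ssyt l" "(i, k) \<in> diagram l" "j \<le> k"
  shows "T (i, j) \<le> T (i, k)"
  using assms(3,2)
proof (induction k rule: dec_induct)
  case (step k)
  then have "(i, k) \<in> diagram l" by (auto simp: diagram_def)
  with step assms(1) show ?case by (fastforce simp: ssyt_def)
qed simp

context
  fixes l :: "nat list" and n :: nat and a :: "nat \<Rightarrow>\<^sub>0 nat"
  assumes sorted: "sorted_wrt (\<ge>) l" and keys: "Poly_Mapping.keys a \<subseteq> {..n}"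
begin

text \<open>Padding by 0 makes the interlacing condition of the last row uniform with the
  others.\<close>

definition "row_len i = (if i < length l then l ! i else 0)"

lemma row_len_anti: "row_len (Suc i) \<le> row_len i"
  using sorted sorted_wrt_nth_less[OF sorted, of i "Suc i"] by (auto simp: row_len_def)

definition "sub_shape f = map f [0..<length l]"

text \<open>The cells outside \<open>f\<close> then all carry the largest possible entry
  \<open>n\<close>.\<close>

definition "strip_tableaux f = {T \<in> tableaux l a. \<forall>(i, j)\<in>diagram l. T (i, j) < n \<longleftrightarrow> j < f i}"

lemma tableaux_column:
  assumes "T \<in> tableaux l a" "(Suc i, j) \<in> diagram l"
  shows "T (i, j) < n" "(i, j) \<in> diagram l"
proof -
  show ij: "(i, j) \<in> diagram l"
    using row_len_anti[of i] assms(2) by (auto simp: diagram_def row_len_def split: if_splits)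
  then have "T (i, j) < T (Suc i, j)"
    using assms by (auto simp: tableaux_def ssyt_def)
  also have "T (Suc i, j) \<le> n"
    using tableaux_entry[OF assms] keys by auto
  finally show "T (i, j) < n" .
qed

text \<open>Rows increase weakly, so the entries below \<open>n\<close> form an initial segment of
  length \<open>f i\<close>. A cell with another below it has an entry less than \<open>n\<close>,
  so this segment covers the length of the next row.\<close>

lemma strip_tableaux_interlacing:
  assumes "T \<in> tableaux l a"
  shows "\<exists>f\<in>interlacing (length l) row_len. T \<in> strip_tableaux f"
proof -
  define f where "f = restrict (\<lambda>i. card {j. (i, j) \<in> diagram l \<and> T (i, j) < n}) {..<length l}"
  have f: "{j. (i, j) \<in> diagram l \<and> T (i, j) < n} = {..<f i}" if "i < length l" for i
  proof -
    let ?S = "{j. (i, j) \<in> diagram l \<and> T (i, j) < n}"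
    have "j \<in> ?S" if "k \<in> ?S" "j \<le> k" for j k
    proof -
      have "(i, j) \<in> diagram l"
        using that by (simp add: diagram_def)
      moreover have "T (i, j) \<le> T (i, k)"
        using assms that by (intro ssyt_row_mono[of T l]) (simp_all add: tableaux_def)
      ultimately show ?thesis using that by simp
    qed
    moreover have "finite ?S"
      by (rule finite_subset[of _ "{..<l ! i}"]) (auto simp: diagram_def)
    ultimately have "?S = {..<card ?S}"
      by (intro downward_closed_eq_lessThan) blast+
    then show ?thesis using that by (simp add: f_def)
  qed
  have "f i \<in> {row_len (Suc i)..row_len i}" if "i < length l" for i
  proof -
    have "{..<f i} \<subseteq> {..<row_len i}"
      using that by (subst f[symmetric]) (auto simp: diagram_def row_len_def)
    moreover have "{..<row_len (Suc i)} \<subseteq> {..<f i}"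
      using that tableaux_column[OF assms] by (subst f[symmetric]) (auto simp: diagram_def row_len_def split: if_splits)
    ultimately show ?thesis by simp
  qed
  then have "f \<in> interlacing (length l) row_len"
    by (auto simp: f_def PiE_iff)
  moreover have "T (i, j) < n \<longleftrightarrow> j < f i" if "(i, j) \<in> diagram l" for i j
    using f[of i] that by (auto simp: diagram_def)
  ultimately show ?thesis
    using assms by (auto simp: strip_tableaux_def)
qed

context
  fixes f
  assumes f: "f \<in> interlacing (length l) row_len"
begin

lemma interlacing_bounds: "i < length l \<Longrightarrow> f i \<le> l ! i" "Suc i < length l \<Longrightarrow> l ! Suc i \<le> f i"
  using PiE_mem[OF f, of i] by (auto simp: row_len_def)

lemma diagram_sub_shape: "(i, j) \<in> diagram (sub_shape f) \<longleftrightarrow> (i, j) \<in> diagram l \<and> j < f i"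
  using interlacing_bounds(1)[of i] by (auto simp: diagram_def sub_shape_def)

lemma diagram_sub_shape_subset: "diagram (sub_shape f) \<subseteq> diagram l"
  using diagram_sub_shape by auto

lemma card_strip: "card (diagram l - diagram (sub_shape f)) = (\<Sum>i<length l. row_len i - f i)"
  using interlacing_bounds(1)
  by (subst card_diagram_diff) (auto simp: sub_shape_def row_len_def intro!: sum.cong)

lemma strip_tableaux_n:
  assumes "T \<in> strip_tableaux f"
  shows "{c \<in> diagram l. T c = n} = diagram l - diagram (sub_shape f)"
proof -
  have "T c \<le> n" if "c \<in> diagram l" for c
    using assms tableaux_entry[of T l a c] keys that by (auto simp: strip_tableaux_def)
  moreover have "T c < n \<longleftrightarrow> c \<in> diagram (sub_shape f)" if "c \<in> diagram l" for c
    using assms that diagram_sub_shape by (cases c) (auto simp: strip_tableaux_def)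
  ultimately have "T c = n \<longleftrightarrow> c \<notin> diagram (sub_shape f)" if "c \<in> diagram l" for c
    using that by (metis le_neq_implies_less less_irrefl)
  then show ?thesis by blast
qed

text \<open>Deleting the entries \<open>n\<close> is a bijection onto tableaux of the smaller shape,
  inverted by filling the strip with \<open>n\<close>; the content requires the strip to have as
  many cells as the exponent of \<open>x_n\<close>.\<close>

lemma card_strip_tableaux:
  "card (strip_tableaux f) = (if (\<Sum>i<length l. row_len i - f i) = Poly_Mapping.lookup a n
     then card (tableaux (sub_shape f) (a - Poly_Mapping.single n (Poly_Mapping.lookup a n))) else 0)"
proof (cases "(\<Sum>i<length l. row_len i - f i) = Poly_Mapping.lookup a n")
  case False
  have "strip_tableaux f = {}"
  proof (intro equals0I)
    fix T assume T: "T \<in> strip_tableaux f"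
    then have "card {c \<in> diagram l. T c = n} = Poly_Mapping.lookup a n"
      by (simp add: strip_tableaux_def tableaux_def)
    with False show False
      unfolding strip_tableaux_n[OF T] card_strip by blast
  qed
  with False show ?thesis by simp
next
  case True
  let ?b = "a - Poly_Mapping.single n (Poly_Mapping.lookup a n)"
  let ?m = "sub_shape f"
  have b: "Poly_Mapping.lookup ?b k = (if k = n then 0 else Poly_Mapping.lookup a k)" for k
    by (simp add: lookup_minus lookup_single when_def)
  have keys_b: "k < n" if "k \<in> Poly_Mapping.keys ?b" for k
  proof -
    have "k \<noteq> n" "k \<in> Poly_Mapping.keys a"
      using that unfolding in_keys_iff b by (simp_all split: if_splits)
    then show ?thesis using keys by (meson atMost_iff le_neq_implies_less subsetD)
  qed
  define extend where "extend T = (\<lambda>c. if c \<in> diagram ?m then T c else if c \<in> diagram l then n else undefined)" for T :: "nat \<times> nat \<Rightarrow> nat"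
  have "bij_betw (\<lambda>T. restrict T (diagram ?m)) (strip_tableaux f) (tableaux ?m ?b)"
  proof (rule bij_betw_byWitness[where f' = extend])
    show "\<forall>T\<in>strip_tableaux f. extend (restrict T (diagram ?m)) = T"
    proof
      fix T assume T: "T \<in> strip_tableaux f"
      then have "T \<in> extensional (diagram l)"
        by (auto simp: strip_tableaux_def tableaux_def ssyt_def PiE_def)
      then have "T c = undefined" if "c \<notin> diagram l" for c
        using that by (rule extensional_arb)
      moreover have "T c = n" if "c \<in> diagram l" "c \<notin> diagram ?m" for c
        using strip_tableaux_n[OF T] that by blast
      ultimately show "extend (restrict T (diagram ?m)) = T"
        by (intro ext) (simp add: extend_def)
    qed
    show "\<forall>T\<in>tableaux ?m ?b. restrict (extend T) (diagram ?m) = T"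
    proof
      fix T assume "T \<in> tableaux ?m ?b"
      then have "T \<in> extensional (diagram ?m)"
        by (simp add: tableaux_def ssyt_def PiE_def)
      then have "T c = undefined" if "c \<notin> diagram ?m" for c
        using that by (rule extensional_arb)
      then show "restrict (extend T) (diagram ?m) = T"
        by (intro ext) (simp add: extend_def)
    qed
    show "(\<lambda>T. restrict T (diagram ?m)) ` strip_tableaux f \<subseteq> tableaux ?m ?b"
    proof clarify
      fix T assume T: "T \<in> strip_tableaux f"
      have row: "T (i, j) \<le> T (i, Suc j)" if "(i, j) \<in> diagram l" "(i, Suc j) \<in> diagram l" for i j
        using T that by (simp add: strip_tableaux_def tableaux_def ssyt_def)
      have column: "T (i, j) < T (Suc i, j)" if "(i, j) \<in> diagram l" "(Suc i, j) \<in> diagram l" for i j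
        using T that by (simp add: strip_tableaux_def tableaux_def ssyt_def)
      have T_n: "T c = n \<longleftrightarrow> c \<notin> diagram ?m" if "c \<in> diagram l" for c
        using strip_tableaux_n[OF T] that by blast
      have "restrict T (diagram ?m) \<in> ssyt ?m"
        using row column subsetD[OF diagram_sub_shape_subset] by (simp add: ssyt_def)
      moreover have "card {c \<in> diagram ?m. restrict T (diagram ?m) c = k} = Poly_Mapping.lookup ?b k" for k
      proof (cases "k = n")
        case True
        then have "{c \<in> diagram ?m. restrict T (diagram ?m) c = k} = {}"
          using T_n subsetD[OF diagram_sub_shape_subset] by simp
        then show ?thesis using True by (simp add: b)
      next
        case False
        then have "{c \<in> diagram ?m. restrict T (diagram ?m) c = k} = {c \<in> diagram l. T c = k}"
          using T_n subsetD[OF diagram_sub_shape_subset] by (intro Collect_cong) (metis restrict_apply)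
        then show ?thesis
          using T False by (simp add: b strip_tableaux_def tableaux_def)
      qed
      ultimately show "restrict T (diagram ?m) \<in> tableaux ?m ?b"
        by (simp add: tableaux_def)
    qed
    show "extend ` tableaux ?m ?b \<subseteq> strip_tableaux f"
    proof clarify
      fix T assume T: "T \<in> tableaux ?m ?b"
      have less: "T c < n" if "c \<in> diagram ?m" for c
        using tableaux_entry[OF T that] keys_b by blast
      have "extend T \<in> ssyt l"
        unfolding ssyt_def
      proof (intro CollectI conjI allI impI)
        show "extend T \<in> diagram l \<rightarrow>\<^sub>E UNIV"
          using diagram_sub_shape_subset by (auto simp: extend_def PiE_iff extensional_def)
        fix i j
        show "extend T (i, j) \<le> extend T (i, Suc j)" if ij: "(i, j) \<in> diagram l \<and> (i, Suc j) \<in> diagram l"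
        proof (cases "(i, Suc j) \<in> diagram ?m")
          case True
          then have "(i, j) \<in> diagram ?m"
            using ij by (simp add: diagram_sub_shape)
          then show ?thesis
            using True T by (simp add: extend_def tableaux_def ssyt_def)
        next
          case False
          then show ?thesis
            using ij less[of "(i, j)"] by (simp add: extend_def less_imp_le)
        qed
        show "extend T (i, j) < extend T (Suc i, j)" if ij: "(i, j) \<in> diagram l \<and> (Suc i, j) \<in> diagram l"
        proof -
          \<comment> \<open>Interlacing forbids two strip cells in one column.\<close>
          have "(i, j) \<in> diagram ?m"
            using ij interlacing_bounds(2)[of i] by (simp only: diagram_sub_shape) (auto simp: diagram_def)
          then show ?thesis
            using ij T less[of "(i, j)"] by (simp add: extend_def tableaux_def ssyt_def)
        qed
      qed
      moreover have "card {c \<in> diagram l. extend T c = k} = Poly_Mapping.lookup a k" for k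
      proof (cases "k = n")
        case k: True
        have "{c \<in> diagram l. extend T c = k} = diagram l - diagram ?m"
          using k less by (auto simp: extend_def nat_neq_iff)
        then show ?thesis
          using k True card_strip by simp
      next
        case False
        then have "{c \<in> diagram l. extend T c = k} = {c \<in> diagram ?m. T c = k}"
          using subsetD[OF diagram_sub_shape_subset] by (intro Collect_cong) (auto simp: extend_def)
        then show ?thesis
          using T False by (simp add: b tableaux_def)
      qed
      moreover have "extend T (i, j) < n \<longleftrightarrow> j < f i" if "(i, j) \<in> diagram l" for i j
        using that less[of "(i, j)"] diagram_sub_shape[of i j] by (auto simp: extend_def)
      ultimately show "extend T \<in> strip_tableaux f"
        by (auto simp: strip_tableaux_def tableaux_def)
    qed
  qed
  then show ?thesis
    using True by (simp add: bij_betw_same_card)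
qed

end

lemma strip_tableaux_disjoint:
  assumes "f \<in> interlacing (length l) row_len" "g \<in> interlacing (length l) row_len" "f \<noteq> g"
  shows "strip_tableaux f \<inter> strip_tableaux g = {}"
proof (rule ccontr)
  assume "strip_tableaux f \<inter> strip_tableaux g \<noteq> {}"
  then obtain T where T: "T \<in> strip_tableaux f" "T \<in> strip_tableaux g" by blast
  have "f i = g i" if i: "i < length l" for i
  proof -
    have "j < f i \<longleftrightarrow> j < g i" if "j < l ! i" for j
      using T that i by (auto simp: strip_tableaux_def diagram_def)
    then show ?thesis
      using interlacing_bounds(1)[OF assms(1) i] interlacing_bounds(1)[OF assms(2) i]
      by (metis less_le_trans linorder_neqE_nat less_irrefl)
  qed
  then have "f = g"
    using assms by (intro PiE_ext) auto
  with assms show False by simp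
qed

lemma card_tableaux_branching:
  "card (tableaux l a) = (\<Sum>f\<in>interlacing (length l) row_len.
     if (\<Sum>i<length l. row_len i - f i) = Poly_Mapping.lookup a n
     then card (tableaux (sub_shape f) (a - Poly_Mapping.single n (Poly_Mapping.lookup a n))) else 0)"
proof -
  have "tableaux l a = (\<Union>f\<in>interlacing (length l) row_len. strip_tableaux f)"
    using strip_tableaux_interlacing by (auto simp: strip_tableaux_def)
  also have "card \<dots> = (\<Sum>f\<in>interlacing (length l) row_len. card (strip_tableaux f))"
  proof (rule card_UN_disjoint)
    show "\<forall>f\<in>interlacing (length l) row_len. finite (strip_tableaux f)"
      by (auto simp: strip_tableaux_def)
  qed (use strip_tableaux_disjoint in \<open>auto intro!: finite_PiE\<close>)
  finally show ?thesis
    by (simp add: card_strip_tableaux)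
qed

end

lemma schur_branching:
  assumes "sorted_wrt (\<ge>) l"
  defines "L \<equiv> \<lambda>i. if i < length l then l ! i else 0"
  shows "mps_restrict (Suc n) (schur l) = (\<Sum>f\<in>interlacing (length l) L.
    mps_var n ^ (\<Sum>i<length l. L i - f i) * mps_restrict n (schur (map f [0..<length l])))"
proof (rule mps_eqI)
  fix a :: "nat \<Rightarrow>\<^sub>0 nat"
  let ?b = "a - Poly_Mapping.single n (Poly_Mapping.lookup a n)"
  \<comment> \<open>The restricted Schur function does not involve \<open>x_n\<close>, so
    \<open>r\<close> must be the full exponent of \<open>x_n\<close> in \<open>a\<close>.\<close>
  have coeff: "mps_coeff (mps_var n ^ r * mps_restrict n (schur m)) a =
      (if Poly_Mapping.keys a \<subseteq> {..n} \<and> r = Poly_Mapping.lookup a n then of_nat (card (tableaux m ?b)) else 0)" for r m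
  proof (cases "r \<le> Poly_Mapping.lookup a n")
    case True
    then have keys: "Poly_Mapping.keys (a - Poly_Mapping.single n r)
        = Poly_Mapping.keys a - {n} \<union> (if r = Poly_Mapping.lookup a n then {} else {n})"
      by (auto simp: in_keys_iff lookup_minus lookup_single when_def split: if_splits)
    have "Poly_Mapping.keys (a - Poly_Mapping.single n r) \<subseteq> {..<n}
        \<longleftrightarrow> Poly_Mapping.keys a \<subseteq> {..n} \<and> r = Poly_Mapping.lookup a n"
      unfolding keys by (cases "r = Poly_Mapping.lookup a n") (force simp: subset_iff order_le_less)+
    with True show ?thesis
      by (simp only: mps_monom_single_power mps_coeff_monom_mult mps_restrict.rep_eq schur_coeff)
        (cases "r = Poly_Mapping.lookup a n"; simp)
  next
    case False
    then have "r \<noteq> Poly_Mapping.lookup a n" by simp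
    with False show ?thesis
      by (simp only: mps_monom_single_power mps_coeff_monom_mult) simp
  qed
  show "mps_coeff (mps_restrict (Suc n) (schur l)) a = mps_coeff (\<Sum>f\<in>interlacing (length l) L.
    mps_var n ^ (\<Sum>i<length l. L i - f i) * mps_restrict n (schur (map f [0..<length l]))) a"
  proof (cases "Poly_Mapping.keys a \<subseteq> {..n}")
    case True
    have "row_len l = L"
      by (simp add: row_len_def[OF assms(1) True] L_def fun_eq_iff)
    then show ?thesis
      using True
      by (simp add: mps_coeff_sum coeff[unfolded One_nat_def] mps_restrict.rep_eq schur_coeff lessThan_Suc_atMost
        card_tableaux_branching[OF assms(1) True] sub_shape_def[OF assms(1) True] if_distrib[of rat_of_nat] cong: sum.cong if_cong)
  next
    case False
    then show ?thesis
      by (simp add: mps_coeff_sum coeff[unfolded One_nat_def] mps_restrict.rep_eq lessThan_Suc_atMost)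
  qed
qed

lemma schur_no_variables:
  "mps_restrict 0 (schur l) = (if \<forall>x\<in>set l. x = 0 then 1 else 0)"
proof -
  have "card (tableaux l 0) = (if diagram l = {} then 1 else 0)"
  proof (cases "diagram l = {}")
    case True
    then have "tableaux l 0 = {\<lambda>_. undefined}"
      by (auto simp: tableaux_def ssyt_def)
    with True show ?thesis by simp
  next
    case False
    then have "tableaux l 0 = {}"
      using tableaux_entry[of _ l 0] by fastforce
    with False show ?thesis by simp
  qed
  moreover have "diagram l = {} \<longleftrightarrow> (\<forall>x\<in>set l. x = 0)"
    by (auto simp: diagram_def in_set_conv_nth) (metis neq0_conv, metis nth_mem less_nat_zero_code)
  ultimately show ?thesis
    by (intro mps_eqI) (auto simp: mps_restrict.rep_eq schur_coeff zero_mps.rep_eq one_mps.rep_eq)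
qed

text \<open>Both sides obey the same branching rule when \<open>x_n\<close> is removed. Lists with
  zeros are included because an interlacing shape keeps the length of \<open>l\<close>.\<close>

lemma schur_restrict_eq_det:
  assumes "sorted_wrt (\<ge>) l"
  shows "mps_restrict n (schur l) = det (mat (length l) (length l)
    (\<lambda>(i, j). complete_sym_in n (int (l ! i) - int i + int j)))"
  using assms
proof (induction n arbitrary: l)
  case 0
  let ?N = "length l"
  let ?A = "mat ?N ?N (\<lambda>(i, j). complete_sym_in 0 (int (l ! i) - int i + int j))"
  show ?case
  proof (cases "\<forall>x\<in>set l. x = 0")
    case True
    then have "l ! i = 0" if "i < ?N" for i
      using that by simp
    then have "?A = 1\<^sub>m ?N"
      by (intro eq_matI) (auto simp: complete_sym_in_0)
    with True show ?thesis by (simp add: schur_no_variables)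
  next
    case False
    then obtain i where "i < ?N" "l ! i > 0"
      by (auto simp: in_set_conv_nth)
    \<comment> \<open>A nonzero row forces the first one to be nonzero; the indices
      \<open>l ! 0 + j\<close> are then positive, so the first matrix row is 0 without
      variables.\<close>
    then have N: "0 < ?N" and "l ! 0 > 0"
      using sorted_wrt_nth_less[OF 0, of 0 i] by (cases "i = 0"; force)+
    have "(\<Prod>i = 0..<?N. ?A $$ (i, p i)) = 0" if "p permutes {0..<?N}" for p
    proof (rule prod_zero)
      have "p 0 < ?N"
        using permutes_in_image[OF that, of 0] N by simp
      then have "?A $$ (0, p 0) = 0"
        using N \<open>l ! 0 > 0\<close> by (simp add: complete_sym_in_0)
      then show "\<exists>i\<in>{0..<?N}. ?A $$ (i, p i) = 0"
        using N by (intro bexI[of _ 0]) auto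
    qed simp
    then have "det ?A = 0"
      by (subst det_def') (auto intro!: sum.neutral)
    with False show ?thesis by (simp add: schur_no_variables)
  qed
next
  case (Suc n)
  define L where "L i = (if i < length l then l ! i else 0)" for i
  have anti: "L (Suc i) \<le> L i" for i
    using sorted_wrt_nth_less[OF Suc.prems, of i "Suc i"] by (auto simp: L_def)
  have "mps_restrict (Suc n) (schur l) = (\<Sum>f\<in>interlacing (length l) L.
    mps_var n ^ (\<Sum>i<length l. L i - f i) * mps_restrict n (schur (map f [0..<length l])))"
    unfolding L_def by (rule schur_branching[OF Suc.prems])
  also have "\<dots> = (\<Sum>f\<in>interlacing (length l) L. mps_var n ^ (\<Sum>i<length l. L i - f i) *
      det (mat (length l) (length l) (\<lambda>(i, j). complete_sym_in n (int (f i) - int i + int j))))"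
  proof (intro sum.cong refl arg_cong2[of _ _ _ _ "(*)"])
    fix f assume f: "f \<in> interlacing (length l) L"
    have "f (Suc i) \<le> f i" if "Suc i < length l" for i
      using PiE_mem[OF f, of i] PiE_mem[OF f, of "Suc i"] that by auto
    then have "sorted_wrt (\<ge>) (map f [0..<length l])"
      by (subst sorted_wrt_iff_nth_Suc_transp) (auto simp: transp_def)
    then have "mps_restrict n (schur (map f [0..<length l])) = det (mat (length l) (length l)
       (\<lambda>(i, j). complete_sym_in n (int (map f [0..<length l] ! i) - int i + int j)))"
      using Suc.IH[of "map f [0..<length l]"] by simp
    also have "mat (length l) (length l) (\<lambda>(i, j). complete_sym_in n (int (map f [0..<length l] ! i) - int i + int j))
      = mat (length l) (length l) (\<lambda>(i, j). complete_sym_in n (int (f i) - int i + int j))"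
      by (rule cong_mat) auto
    finally show "mps_restrict n (schur (map f [0..<length l]))
      = det (mat (length l) (length l) (\<lambda>(i, j). complete_sym_in n (int (f i) - int i + int j)))" .
  qed
  also have "\<dots> = det (mat (length l) (length l) (\<lambda>(i, j). complete_sym_in (Suc n) (int (L i) - int i + int j)))"
    using anti by (intro det_complete_sym_in_Suc[symmetric]) (auto simp: L_def)
  also have "mat (length l) (length l) (\<lambda>(i, j). complete_sym_in (Suc n) (int (L i) - int i + int j))
    = mat (length l) (length l) (\<lambda>(i, j). complete_sym_in (Suc n) (int (l ! i) - int i + int j))"
    by (rule cong_mat) (auto simp: L_def)
  finally show ?case .
qed

lemma jacobi_trudi:
  assumes "sorted_wrt (\<ge>) l"
  shows "schur l = det (mat (length l) (length l) (\<lambda>(i, j). complete_sym (int (l ! i) - int i + int j)))"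
proof (rule mps_eq_restrictI)
  fix n
  have "map_mat (mps_restrict n) (mat (length l) (length l) (\<lambda>(i, j). complete_sym (int (l ! i) - int i + int j)))
    = mat (length l) (length l) (\<lambda>(i, j). complete_sym_in n (int (l ! i) - int i + int j))"
    by (rule eq_matI) auto
  then show "mps_restrict n (schur l) = mps_restrict n (det (mat (length l) (length l) (\<lambda>(i, j). complete_sym (int (l ! i) - int i + int j))))"
    by (simp add: schur_restrict_eq_det[OF assms] flip: mps_restrict.hom_det)
qed

section \<open>Vertex operators and determinants\<close>

text \<open>Collecting all \<open>ann \<epsilon> j\<close> in a power series in \<open>y\<close>
  makes \<open>ann_mult\<close> a homomorphism property, applicable entrywise to
  determinants.\<close>

interpretation ann_fps: comm_ring_hom "\<lambda>v. Abs_fps (\<lambda>j. ann \<epsilon> (int j) v)" for \<epsilon>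
proof
  fix u v :: fock
  show "Abs_fps (\<lambda>j. ann \<epsilon> (int j) (u * v)) = Abs_fps (\<lambda>j. ann \<epsilon> (int j) u) * Abs_fps (\<lambda>j. ann \<epsilon> (int j) v)"
  proof (rule fps_ext)
    fix n
    have "ann \<epsilon> (int n) (u * v) = (\<Sum>i\<in>{0..int n}. ann \<epsilon> i u * ann \<epsilon> (int n - i) v)"
      by (rule ann_mult) simp
    also have "\<dots> = (\<Sum>i=0..n. ann \<epsilon> (int i) u * ann \<epsilon> (int (n - i)) v)"
      by (rule sum.reindex_bij_witness[where i = int and j = nat]) (auto simp: of_nat_diff)
    finally show "fps_nth (Abs_fps (\<lambda>j. ann \<epsilon> (int j) (u * v))) n
        = fps_nth (Abs_fps (\<lambda>j. ann \<epsilon> (int j) u) * Abs_fps (\<lambda>j. ann \<epsilon> (int j) v)) n"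
      by (simp add: fps_mult_nth)
  qed
qed (auto intro!: fps_ext simp: ann_add ann_1)

interpretation fps_const: comm_ring_hom "fps_const :: 'a :: comm_ring_1 \<Rightarrow> 'a fps"
  by unfold_locales auto

abbreviation jacobi_trudi_mat :: "int list \<Rightarrow> (int \<Rightarrow> 'a) \<Rightarrow> 'a mat" where
  "jacobi_trudi_mat \<kappa> h \<equiv> mat (length \<kappa>) (length \<kappa>) (\<lambda>(i, j). h (\<kappa> ! i - int i + int j))"

text \<open>
  Substituting \<open>h\<^sub>n - y h\<^sub>n\<^sub>-\<^sub>1\<close> for \<open>h\<^sub>n\<close> amounts, after column operations, to bordering the matrix by
  the row \<open>(1, y, y\<^sup>2, \<dots>)\<close>.
\<close>

lemma ann_fps_det:
  fixes \<kappa> :: "int list"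
  defines "N \<equiv> length \<kappa>"
  shows "Abs_fps (\<lambda>j. ann (- 1) (int j) (det (jacobi_trudi_mat \<kappa> (cre 1))))
    = det (mat (Suc N) (Suc N) (\<lambda>(i, j). if i = 0 then fps_X ^ j
        else fps_const (cre 1 ((a # \<kappa>) ! i - int i + int j))))"
    (is "_ = det ?C")
proof -
  let ?E = "\<lambda>v. Abs_fps (\<lambda>j. ann (- 1) (int j) v)"
  define U :: "fock fps mat" where
    "U = mat (Suc N) (Suc N) (\<lambda>(i, j). if i = j then 1 else if j = Suc i then - fps_X else 0)"
  have carrier: "?C \<in> carrier_mat (Suc N) (Suc N)" "U \<in> carrier_mat (Suc N) (Suc N)"
    by (simp_all add: U_def)
  have "upper_triangular U" "diag_mat U = replicate (Suc N) 1"
    by (auto simp: U_def diag_mat_def map_replicate_const[symmetric] intro!: nth_equalityI simp del: upt_Suc replicate_Suc)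
  then have "det U = 1"
    using carrier by (subst det_upper_triangular[of _ "Suc N"]) auto
  have E: "?E (cre 1 n) = fps_const (cre 1 n) - fps_X * fps_const (cre 1 (n - 1))" for n
  proof (rule fps_ext)
    fix j
    show "fps_nth (?E (cre 1 n)) j = fps_nth (fps_const (cre 1 n) - fps_X * fps_const (cre 1 (n - 1))) j"
      using ann_cre_opp[of "- 1" 1 "int j" n] by (cases j) (auto simp: fps_X_mult_nth)
  qed
  have CU: "(?C * U) $$ (i, j) = ?C $$ (i, j) - (if j = 0 then 0 else ?C $$ (i, j - 1) * fps_X)"
    if "i < Suc N" "j < Suc N" for i j
  proof -
    have "(?C * U) $$ (i, j) = (\<Sum>l<Suc N. ?C $$ (i, l) * U $$ (l, j))"
      using that carrier by (simp add: scalar_prod_def atLeast0LessThan)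
    also have "\<dots> = (\<Sum>l<Suc N. (if l = j then ?C $$ (i, j) else 0)
        - (if l = j - 1 then (if j = 0 then 0 else ?C $$ (i, j - 1) * fps_X) else 0))"
      using that by (intro sum.cong refl) (auto simp: U_def)
    also have "\<dots> = ?C $$ (i, j) - (if j = 0 then 0 else ?C $$ (i, j - 1) * fps_X)"
      using that by (simp only: sum_subtractf sum.delta finite_lessThan) auto
    finally show ?thesis .
  qed
  \<comment> \<open>The column operations turn \<open>(1, y, y^2, ...)\<close> into the first unit
    vector, so the expansion along it leaves only the lower right block.\<close>
  have row0: "(?C * U) $$ (0, j) = (if j = 0 then 1 else 0)" if "j < Suc N" for j
    using that by (cases j) (simp_all add: CU del: index_mult_mat)
  have "mat_delete (?C * U) 0 0 = map_mat ?E (jacobi_trudi_mat \<kappa> (cre 1))"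
  proof (rule eq_matI)
    fix i j
    assume "i < dim_row (map_mat ?E (jacobi_trudi_mat \<kappa> (cre 1)))" "j < dim_col (map_mat ?E (jacobi_trudi_mat \<kappa> (cre 1)))"
    then have ij: "i < N" "j < N" by (simp_all add: N_def)
    have "mat_delete (?C * U) 0 0 $$ (i, j) = (?C * U) $$ (Suc i, Suc j)"
      using ij carrier by (simp add: mat_delete_def del: index_mult_mat(1))
    also have "\<dots> = fps_const (cre 1 (\<kappa> ! i - int i + int j)) - fps_X * fps_const (cre 1 (\<kappa> ! i - int i + int j - 1))"
      using ij by (simp add: CU algebra_simps del: index_mult_mat(1))
    also have "\<dots> = map_mat ?E (jacobi_trudi_mat \<kappa> (cre 1)) $$ (i, j)"
      using ij by (simp add: E N_def)
    finally show "mat_delete (?C * U) 0 0 $$ (i, j) = map_mat ?E (jacobi_trudi_mat \<kappa> (cre 1)) $$ (i, j)" .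
  qed (use carrier in \<open>simp_all add: mat_delete_def N_def\<close>)
  moreover have "det (?C * U) = det (mat_delete (?C * U) 0 0)"
  proof -
    have "det (?C * U) = (\<Sum>j<Suc N. (?C * U) $$ (0, j) * cofactor (?C * U) 0 j)"
      using carrier by (intro laplace_expansion_row) auto
    also have "\<dots> = (\<Sum>j<Suc N. if j = 0 then cofactor (?C * U) 0 0 else 0)"
      by (intro sum.cong refl) (simp add: row0 del: index_mult_mat(1))
    also have "\<dots> = det (mat_delete (?C * U) 0 0)"
      by (simp add: cofactor_def)
    finally show ?thesis .
  qed
  ultimately show ?thesis
    using det_mult[OF carrier] \<open>det U = 1\<close> by (simp add: ann_fps.hom_det)
qed

text \<open>The coefficient of \<open>y^j\<close> in \<open>A(y)\<close> applied to the smaller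
  determinant is the cofactor at \<open>(0, j)\<close> of the larger matrix. Multiplying by
  \<open>cre 1 (a + j)\<close> and summing is then the Laplace expansion along the first
  row.\<close>

lemma vertex_word_eq_det: "vertex_word 1 \<kappa> 1 = det (jacobi_trudi_mat \<kappa> (cre 1))"
proof (induction \<kappa>)
  case (Cons a \<kappa>)
  let ?N = "length \<kappa>"
  let ?M = "jacobi_trudi_mat (a # \<kappa>) (cre 1)"
  let ?C = "mat (Suc ?N) (Suc ?N) (\<lambda>(i, j). if i = 0 then fps_X ^ j
        else fps_const (cre 1 ((a # \<kappa>) ! i - int i + int j)))"
  let ?v = "det (jacobi_trudi_mat \<kappa> (cre 1))"
  have cofactor: "cofactor ?C 0 k = fps_const (cofactor ?M 0 k)" if "k < Suc ?N" for k
  proof -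
    have "mat_delete ?C 0 k = map_mat fps_const (mat_delete ?M 0 k)"
      using that by (intro eq_matI) (auto simp: mat_delete_def)
    then show ?thesis
      by (simp add: cofactor_def fps_const.hom_det fps_const.hom_power fps_const.hom_mult fps_const.hom_uminus
        del: fps_const_mult fps_const_power fps_const_neg)
  qed
  have "ann (- 1) (int j) ?v = (if j \<le> ?N then cofactor ?M 0 j else 0)" for j
  proof -
    have "ann (- 1) (int j) ?v = fps_nth (det ?C) j"
      using arg_cong[OF ann_fps_det[of \<kappa> a], of "\<lambda>f. fps_nth f j"] by simp
    also have "det ?C = (\<Sum>k<Suc ?N. ?C $$ (0, k) * cofactor ?C 0 k)"
      by (rule laplace_expansion_row) auto
    also have "\<dots> = (\<Sum>k<Suc ?N. fps_const (cofactor ?M 0 k) * fps_X ^ k)"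
      by (intro sum.cong refl) (simp add: cofactor mult.commute)
    also have "fps_nth \<dots> j = (\<Sum>k<Suc ?N. if k = j then cofactor ?M 0 k else 0)"
      unfolding fps_sum_nth by (intro sum.cong refl) (auto simp: fps_X_power_iff)
    finally show ?thesis by (auto simp: less_Suc_eq_le)
  qed note ann = this
  have "vertex_coeff 1 a ?v = (\<Sum>j\<in>{0..int ?N}. cre 1 (a + j) * ann (- 1) j ?v)"
  proof (rule vertex_coeff_eq)
    fix j assume "j > int ?N"
    then show "ann (- 1) j ?v = 0"
      using ann[of "nat j"] by simp
  qed
  also have "\<dots> = (\<Sum>j<Suc ?N. cre 1 (a + int j) * ann (- 1) (int j) ?v)"
    by (rule sum.reindex_bij_witness[where i = int and j = nat]) auto
  also have "\<dots> = (\<Sum>j<Suc ?N. ?M $$ (0, j) * cofactor ?M 0 j)"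
    by (intro sum.cong refl) (simp add: ann)
  also have "\<dots> = det ?M"
    by (rule laplace_expansion_row[symmetric]) auto
  finally show ?case by (simp add: Cons)
qed simp

section \<open>Symmetric functions\<close>

lemma mps_coeff_const_mult: "mps_coeff (mps_const c * f) a = c * mps_coeff f a"
  by (simp add: times_mps.rep_eq mps_const.rep_eq) (subst sum_splits_zero, auto)

lemma mps_coeff_of_nat_mult: "mps_coeff (of_nat n * f) a = of_nat n * mps_coeff f a"
  by (induction n) (auto simp: zero_mps.rep_eq plus_mps.rep_eq distrib_right)

lemma mps_of_nat_cancel:
  fixes f g :: "'a :: {idom, ring_char_0} mps"
  assumes "n > 0" "of_nat n * f = of_nat n * g"
  shows "f = g"
proof (rule mps_eqI)
  fix a
  have "of_nat n * mps_coeff f a = of_nat n * mps_coeff g a"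
    using assms(2) by (simp flip: mps_coeff_of_nat_mult)
  then show "mps_coeff f a = mps_coeff g a"
    using assms(1) by simp
qed

definition power_sum_monom :: "(nat \<Rightarrow>\<^sub>0 nat) \<Rightarrow> rat mps" where
  "power_sum_monom m = (\<Prod>i\<in>Poly_Mapping.keys m. power_sum (i + 1) ^ Poly_Mapping.lookup m i)"

lemma power_sum_monom_0: "power_sum_monom 0 = 1"
  by (simp add: power_sum_monom_def)

lemma power_sum_monom_superset:
  "finite A \<Longrightarrow> Poly_Mapping.keys m \<subseteq> A \<Longrightarrow> power_sum_monom m = (\<Prod>i\<in>A. power_sum (i + 1) ^ Poly_Mapping.lookup m i)"
  unfolding power_sum_monom_def by (rule prod.mono_neutral_left) (auto simp: in_keys_iff)

lemma power_sum_monom_add: "power_sum_monom (l + m) = power_sum_monom l * power_sum_monom m"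
proof -
  let ?A = "Poly_Mapping.keys l \<union> Poly_Mapping.keys m"
  have "Poly_Mapping.keys (l + m) \<subseteq> ?A"
    by (rule Poly_Mapping.keys_add)
  then show ?thesis
    by (subst (1 2 3) power_sum_monom_superset[of ?A])
      (auto simp: lookup_add power_add prod.distrib)
qed

lemma fock_to_sym_superset:
  "finite A \<Longrightarrow> Poly_Mapping.keys v \<subseteq> A \<Longrightarrow>
    fock_to_sym v = (\<Sum>m\<in>A. mps_const (Poly_Mapping.lookup v m) * power_sum_monom m)"
  unfolding fock_to_sym_def power_sum_monom_def[symmetric]
  by (rule sum.mono_neutral_left) (auto simp: in_keys_iff intro!: mps_eqI simp: mps_coeff_const_mult zero_mps.rep_eq)

lemma fock_to_sym_add: "fock_to_sym (u + v) = fock_to_sym u + fock_to_sym v"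
proof -
  let ?A = "Poly_Mapping.keys u \<union> Poly_Mapping.keys v"
  have "mps_const (a + b) * f = mps_const a * f + mps_const b * f" for a b :: rat and f
    by (rule mps_eqI) (simp add: mps_coeff_const_mult plus_mps.rep_eq distrib_right)
  then show ?thesis
    using Poly_Mapping.keys_add[of u v]
    by (subst (1 2 3) fock_to_sym_superset[of ?A]) (auto simp: lookup_add sum.distrib)
qed

lemma fock_to_sym_single: "fock_to_sym (Poly_Mapping.single m c) = mps_const c * power_sum_monom m"
  by (subst fock_to_sym_superset[of "{m}"]) auto

lemma fock_to_sym_single_mult:
  "fock_to_sym (Poly_Mapping.single m c * v) = mps_const c * power_sum_monom m * fock_to_sym v"
proof (induction v rule: fock_induct_sum)
  case (single n d)
  have "mps_const (c * d) * f = mps_const c * (mps_const d * f)" for f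
    by (rule mps_eqI) (simp add: mps_coeff_const_mult)
  then show ?case
    by (simp add: mult_single fock_to_sym_single power_sum_monom_add mult_ac)
next
  case (add u v)
  then show ?case by (simp add: distrib_left fock_to_sym_add)
qed

interpretation fock_to_sym: comm_ring_hom fock_to_sym
proof
  show "fock_to_sym (u + v) = fock_to_sym u + fock_to_sym v" for u v
    by (rule fock_to_sym_add)
  show "fock_to_sym (u * v) = fock_to_sym u * fock_to_sym v" for u v
    by (induction u rule: fock_induct_sum)
      (simp_all add: fock_to_sym_single_mult fock_to_sym_single distrib_right fock_to_sym_add)
  have "mps_const 1 * 1 = (1 :: rat mps)"
    by (rule mps_eqI) (simp add: mps_const.rep_eq one_mps.rep_eq)
  then show "fock_to_sym 1 = 1"
    using fock_to_sym_single[of 0 1] by (simp add: power_sum_monom_0)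
  show "fock_to_sym 0 = 0"
    by (simp add: fock_to_sym_def)
qed

lemma fock_to_sym_fvar: "fock_to_sym (fvar i) = power_sum (i + 1)"
  unfolding fvar_def fock_to_sym_single power_sum_monom_def
  by (rule mps_eqI) (simp add: mps_coeff_const_mult)

text \<open>As \<open>m\<close> is positive, \<open>x_i^m\<close> determines \<open>i\<close>, so
  each monomial of the power sum is counted once.\<close>

lemma mps_coeff_power_sum_mult:
  assumes "m > 0"
  shows "mps_coeff (power_sum m * f) a
    = (\<Sum>i | m \<le> Poly_Mapping.lookup a i. mps_coeff f (a - Poly_Mapping.single i m))"
proof -
  let ?S = "\<lambda>i. Poly_Mapping.single i m :: nat \<Rightarrow>\<^sub>0 nat"
  have "mps_coeff (power_sum m * f) a = (\<Sum>(b, c)\<in>splits a. if \<exists>i. b = ?S i then mps_coeff f c else 0)"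
    by (auto simp: times_mps.rep_eq power_sum.rep_eq intro!: sum.cong)
  also have "\<dots> = (\<Sum>(b, c)\<in>{(b, c)\<in>splits a. \<exists>i. b = ?S i}. mps_coeff f c)"
    by (intro sum.mono_neutral_cong_right finite_splits) (auto split: if_splits)
  also have "{(b, c)\<in>splits a. \<exists>i. b = ?S i} = (\<lambda>i. (?S i, a - ?S i)) ` {i. m \<le> Poly_Mapping.lookup a i}"
  proof (intro equalityI subsetI)
    fix p assume "p \<in> (\<lambda>i. (?S i, a - ?S i)) ` {i. m \<le> Poly_Mapping.lookup a i}"
    then show "p \<in> {(b, c)\<in>splits a. \<exists>i. b = ?S i}"
      using poly_mapping_diff_single_add[of m a] by (auto simp: splits_def add.commute)
  qed (auto simp: splits_def lookup_add)
  also have "(\<Sum>(b, c)\<in>\<dots>. mps_coeff f c) = (\<Sum>i | m \<le> Poly_Mapping.lookup a i. mps_coeff f (a - ?S i))"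
  proof (subst sum.reindex)
    have "i = j" if "?S i = ?S j" for i j
      using arg_cong[OF that, of "\<lambda>a. Poly_Mapping.lookup a i"] assms by (auto simp: lookup_single when_def split: if_splits)
    then show "inj_on (\<lambda>i. (?S i, a - ?S i)) {i. m \<le> Poly_Mapping.lookup a i}"
      by (auto intro: inj_onI)
  qed simp
  finally show ?thesis .
qed

text \<open>For a monomial of degree \<open>n\<close>, the pairs \<open>(m, i)\<close> with
  \<open>m\<close> between 1 and the exponent of \<open>x_i\<close> are counted in two ways; their
  number is the degree.\<close>

lemma newton_complete_sym:
  "of_nat n * complete_sym (int n) = (\<Sum>m=1..n. power_sum m * complete_sym (int n - int m))"
proof (rule mps_eqI)
  fix a :: "nat \<Rightarrow>\<^sub>0 nat"
  have coeff: "mps_coeff (power_sum m * complete_sym (int n - int m)) a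
      = (if mdegree a = n then of_nat (card {i \<in> Poly_Mapping.keys a. m \<le> Poly_Mapping.lookup a i}) else 0)"
    if "m \<in> {1..n}" for m
  proof -
    have "int (mdegree (a - Poly_Mapping.single i m)) = int n - int m \<longleftrightarrow> mdegree a = n" if "m \<le> Poly_Mapping.lookup a i" for i
      using mdegree_add[of "a - Poly_Mapping.single i m" "Poly_Mapping.single i m"] poly_mapping_diff_single_add[OF that] by auto
    then have "mps_coeff (power_sum m * complete_sym (int n - int m)) a
        = (\<Sum>i | m \<le> Poly_Mapping.lookup a i. if mdegree a = n then 1 else 0)"
      using that by (subst mps_coeff_power_sum_mult) (auto simp: complete_sym_coeff intro!: sum.cong)
    also have "{i. m \<le> Poly_Mapping.lookup a i} = {i \<in> Poly_Mapping.keys a. m \<le> Poly_Mapping.lookup a i}"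
      using that by (auto simp: in_keys_iff)
    finally show ?thesis by simp
  qed
  have "(\<Sum>m=1..n. card {i \<in> Poly_Mapping.keys a. m \<le> Poly_Mapping.lookup a i}) = n" if "mdegree a = n"
  proof -
    have le: "Poly_Mapping.lookup a i \<le> n" if "i \<in> Poly_Mapping.keys a" for i
      using that \<open>mdegree a = n\<close> unfolding mdegree_def by (metis finite_keys member_le_sum zero_le)
    have "(\<Sum>m=1..n. card {i \<in> Poly_Mapping.keys a. m \<le> Poly_Mapping.lookup a i})
        = (\<Sum>i\<in>Poly_Mapping.keys a. card {m \<in> {1..n}. m \<le> Poly_Mapping.lookup a i})"
      by (rule sum_multicount_gen) auto
    also have "\<dots> = (\<Sum>i\<in>Poly_Mapping.keys a. Poly_Mapping.lookup a i)"
    proof (rule sum.cong[OF refl])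
      fix i assume "i \<in> Poly_Mapping.keys a"
      then have "{m \<in> {1..n}. m \<le> Poly_Mapping.lookup a i} = {1..Poly_Mapping.lookup a i}"
        using le by fastforce
      then show "card {m \<in> {1..n}. m \<le> Poly_Mapping.lookup a i} = Poly_Mapping.lookup a i"
        by simp
    qed
    finally show ?thesis using that by (simp add: mdegree_def)
  qed
  then have "(\<Sum>m=1..n. mps_coeff (power_sum m * complete_sym (int n - int m)) a) = (if mdegree a = n then of_nat n else 0)"
    by (simp add: coeff flip: of_nat_sum)
  then show "mps_coeff (of_nat n * complete_sym (int n)) a
      = mps_coeff (\<Sum>m=1..n. power_sum m * complete_sym (int n - int m)) a"
    by (simp add: mps_coeff_sum mps_coeff_of_nat_mult complete_sym_coeff)
qed

text \<open>The image of \<open>cre_rec\<close> is Newton's identity, so both families satisfy the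
  same recursion.\<close>

lemma fock_to_sym_cre: "fock_to_sym (cre 1 n) = complete_sym n"
proof (induction n rule: nat_int_induct)
  case (neg n)
  then show ?case
    by (auto intro!: mps_eqI simp: complete_sym_coeff zero_mps.rep_eq)
next
  case (nonneg n)
  show ?case
  proof (cases "n = 0")
    case True
    then show ?thesis
      by (auto intro!: mps_eqI simp: complete_sym_coeff one_mps.rep_eq mdegree_zero_iff)
  next
    case False
    define k where "k = nat n"
    have k: "n = int k" "k > 0" using False nonneg(1) by (simp_all add: k_def)
    have "of_nat k * fock_to_sym (cre 1 n) = fock_to_sym (of_int n * cre 1 n)"
      by (simp add: k fock_to_sym.hom_mult fock_to_sym.hom_of_nat)
    also have "\<dots> = (\<Sum>m=1..k. power_sum m * complete_sym (n - int m))"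
      using k nonneg(2)
      by (subst cre_rec[of _ k]) (auto simp: fock_to_sym.hom_sum fock_to_sym.hom_mult fock_to_sym_fvar intro!: sum.cong)
    also have "\<dots> = of_nat k * complete_sym n"
      unfolding k(1) by (rule newton_complete_sym[symmetric])
    finally show ?thesis
      using k(2) mps_of_nat_cancel by blast
  qed
qed

lemma fock_to_sym_vertex_word:
  assumes "sorted_wrt (\<ge>) l"
  shows "fock_to_sym (vertex_word 1 (map int l) 1) = schur l"
proof -
  have "fock_to_sym (vertex_word 1 (map int l) 1) = det (map_mat fock_to_sym (jacobi_trudi_mat (map int l) (cre 1)))"
    by (simp only: vertex_word_eq_det fock_to_sym.hom_det)
  also have "map_mat fock_to_sym (jacobi_trudi_mat (map int l) (cre 1))
      = mat (length l) (length l) (\<lambda>(i, j). complete_sym (int (l ! i) - int i + int j))"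
    by (rule eq_matI) (auto simp: fock_to_sym_cre)
  finally show ?thesis
    by (simp only: jacobi_trudi[OF assms])
qed

lemma sorted_conj_partition: "sorted_wrt (\<ge>) (conj_partition l)"
  by (subst sorted_wrt_iff_nth_less)
    (auto simp: nth_conj_partition intro!: card_mono)

text \<open>The second formula conjugates the straightened word; straightening preserves the size,
  so the sign depends on \<open>l\<close> alone.\<close>

lemma fock_to_sym_straighten:
  fixes l :: "nat list"
  defines "\<kappa> \<equiv> map int l"
  shows "fock_to_sym (vertex_word 1 \<kappa> 1) = of_int (tuple_sgn \<kappa>) * schur (map nat (straighten \<kappa>))"
    and "fock_to_sym (vertex_word (- 1) \<kappa> 1)
      = (- 1) ^ sum_list l * of_int (tuple_sgn \<kappa>) * schur (conj_partition (map nat (straighten \<kappa>)))"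
proof -
  have eq: "vertex_word \<epsilon> \<kappa> 1 = of_int (tuple_sgn \<kappa>) * vertex_word \<epsilon> (straighten \<kappa>) 1" if "\<epsilon> * \<epsilon> = 1" for \<epsilon>
    using that by (rule vertex_word_straighten)
  show "fock_to_sym (vertex_word 1 \<kappa> 1) = of_int (tuple_sgn \<kappa>) * schur (map nat (straighten \<kappa>))"
  proof (cases "degenerate \<kappa>")
    case True
    then show ?thesis by (subst eq) (simp_all add: tuple_sgn_def)
  next
    case False
    note nat = straighten_nat[OF False[unfolded \<kappa>_def], folded \<kappa>_def]
    have "fock_to_sym (vertex_word 1 (map int (map nat (straighten \<kappa>))) 1) = schur (map nat (straighten \<kappa>))"
      by (rule fock_to_sym_vertex_word[OF nat(2)])
    then show ?thesis
      by (subst eq) (simp, simp only: nat(1) fock_to_sym.hom_mult fock_to_sym.hom_of_int)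
  qed
  show "fock_to_sym (vertex_word (- 1) \<kappa> 1)
      = (- 1) ^ sum_list l * of_int (tuple_sgn \<kappa>) * schur (conj_partition (map nat (straighten \<kappa>)))"
  proof (cases "degenerate \<kappa>")
    case True
    then show ?thesis by (subst eq) (simp_all add: tuple_sgn_def)
  next
    case False
    note nat = straighten_nat[OF False[unfolded \<kappa>_def], folded \<kappa>_def]
    have "vertex_word (- 1) (straighten \<kappa>) 1
        = (- 1) ^ sum_list l * vertex_word 1 (map int (conj_partition (map nat (straighten \<kappa>)))) 1"
      using vertex_word_conj[of 1, OF _ nat(2)] by (simp only: nat(1,3))
    then have "fock_to_sym (vertex_word (- 1) (straighten \<kappa>) 1)
        = (- 1) ^ sum_list l * schur (conj_partition (map nat (straighten \<kappa>)))"
      by (simp add: fock_to_sym.hom_mult fock_to_sym.hom_power fock_to_sym.hom_uminus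
        fock_to_sym_vertex_word[OF sorted_conj_partition])
    then show ?thesis
      by (subst eq) (simp_all add: fock_to_sym.hom_mult fock_to_sym.hom_of_int mult_ac)
  qed
qed

theorem theorem2p6:
  fixes ip :: "fock \<Rightarrow> fock \<Rightarrow> rat"
  assumes "fock_inner_product ip"
  shows
    "orthonormal_basis ip {foldr (\<lambda>n. vS_star (int n)) l 1 | l. is_partition l} \<and>
     (\<forall>l. is_partition l \<longrightarrow>
        fock_to_sym (foldr (\<lambda>n. vS_star (int n)) l 1)
          = (- 1) ^ sum_list l * schur (conj_partition l) \<and>
        (- 1) ^ sum_list l * schur (conj_partition l)
          = (- 1) ^ sum_list l *
            det (mat (length (conj_partition l)) (length (conj_partition l))
              (\<lambda>(i, j). complete_sym (int (conj_partition l ! i) - int i + int j)))) \<and>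
     (\<forall>\<mu> \<nu>. is_partition \<mu> \<longrightarrow> is_partition \<nu> \<longrightarrow>
        (let \<kappa> = map int (\<mu> @ conj_partition \<nu>) in
           fock_to_sym (foldr (\<lambda>n. vS (- int n)) \<mu> (foldr (\<lambda>n. vS_star (int n)) \<nu> 1))
             = (- 1) ^ sum_list \<nu> * of_int (tuple_sgn \<kappa>)
               * schur (map nat (straighten \<kappa>)))) \<and>
     (\<forall>\<mu> \<nu>. is_partition \<mu> \<longrightarrow> is_partition \<nu> \<longrightarrow>
        (let \<kappa> = map int (\<mu> @ conj_partition \<nu>) in
           fock_to_sym (foldr (\<lambda>n. vS_star (int n)) \<mu> (foldr (\<lambda>n. vS (- int n)) \<nu> 1))
             = (- 1) ^ sum_list \<mu> * of_int (tuple_sgn \<kappa>)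
               * schur (conj_partition (map nat (straighten \<kappa>)))))"
  unfolding foldr_vS foldr_vS_star Let_def
proof (intro conjI allI impI)
  show "orthonormal_basis ip {vertex_word (- 1) (map int l) 1 | l. is_partition l}"
    by (rule orthonormal_basis_vertex_words[OF assms]) simp
next
  fix l assume "is_partition l"
  then have "sorted_wrt (\<ge>) l" by (simp add: is_partition_def)
  then have "vertex_word (- 1) (map int l) 1 = (- 1) ^ sum_list l * vertex_word 1 (map int (conj_partition l)) 1"
    using vertex_word_conj[of 1] by simp
  then show "fock_to_sym (vertex_word (- 1) (map int l) 1) = (- 1) ^ sum_list l * schur (conj_partition l)"
    by (simp add: fock_to_sym.hom_mult fock_to_sym.hom_power fock_to_sym.hom_uminus
      fock_to_sym_vertex_word[OF sorted_conj_partition])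
next
  fix l
  show "(- 1) ^ sum_list l * schur (conj_partition l)
      = (- 1) ^ sum_list l * det (mat (length (conj_partition l)) (length (conj_partition l))
          (\<lambda>(i, j). complete_sym (int (conj_partition l ! i) - int i + int j)))"
    by (simp only: jacobi_trudi[OF sorted_conj_partition])
next
  fix \<mu> \<nu> assume "is_partition \<mu>" "is_partition \<nu>"
  then have \<nu>: "sorted_wrt (\<ge>) \<nu>" by (simp add: is_partition_def)
  let ?\<kappa> = "map int (\<mu> @ conj_partition \<nu>)"
  have "vertex_word 1 (map int \<mu>) (vertex_word (- 1) (map int \<nu>) 1) = (- 1) ^ sum_list \<nu> * vertex_word 1 ?\<kappa> 1"
    using vertex_word_conj[of 1, OF _ \<nu>] by (simp add: vertex_word_sign vertex_word_append)
  then show "fock_to_sym (vertex_word 1 (map int \<mu>) (vertex_word (- 1) (map int \<nu>) 1))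
      = (- 1) ^ sum_list \<nu> * of_int (tuple_sgn ?\<kappa>) * schur (map nat (straighten ?\<kappa>))"
    by (simp only: fock_to_sym.hom_mult fock_to_sym.hom_power fock_to_sym.hom_uminus fock_to_sym.hom_one
      fock_to_sym_straighten(1) mult.assoc)
next
  fix \<mu> \<nu> assume "is_partition \<mu>" "is_partition \<nu>"
  then have \<nu>: "sorted_wrt (\<ge>) \<nu>" by (simp add: is_partition_def)
  let ?\<kappa> = "map int (\<mu> @ conj_partition \<nu>)"
  \<comment> \<open>Conjugation applied with sign \<open>- 1\<close> turns the inner word into one
    of the same kind as the outer word.\<close>
  have "vertex_word (- 1) (map int \<mu>) (vertex_word 1 (map int \<nu>) 1) = (- 1) ^ sum_list \<nu> * vertex_word (- 1) ?\<kappa> 1"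
    using vertex_word_conj[of "- 1", OF _ \<nu>] by (simp add: vertex_word_sign vertex_word_append)
  \<comment> \<open>Conjugation preserves the size, so the signs from \<open>\<nu>\<close> and its
    conjugate cancel and that of \<open>\<mu>\<close> remains.\<close>
  moreover have "(- 1) ^ sum_list \<nu> * (- 1) ^ sum_list (\<mu> @ conj_partition \<nu>) = ((- 1) ^ sum_list \<mu> :: rat mps)"
    by (simp add: sum_list_conj_partition[OF \<nu>] power_add mult_ac flip: power_mult_distrib)
  ultimately show "fock_to_sym (vertex_word (- 1) (map int \<mu>) (vertex_word 1 (map int \<nu>) 1))
      = (- 1) ^ sum_list \<mu> * of_int (tuple_sgn ?\<kappa>) * schur (conj_partition (map nat (straighten ?\<kappa>)))"
    by (simp only: fock_to_sym.hom_mult fock_to_sym.hom_power fock_to_sym.hom_uminus fock_to_sym.hom_one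
      fock_to_sym_straighten(2) mult.assoc[symmetric])
qed

end
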